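(* Let $\Omega=(K,L,q,1,X,\cdot,h,\theta)$ be a quadrangular algebra with $\operatorname{char}(K)\neq 2,3$. Then there exists a family of pairwise isotopic structurable algebras on $X$ (i.e. with underlying $K$-vector space $X$), such that each algebra $\mathcal{A}$ in this family satisfies the following properties (products and involution being those of $\mathcal{A}$, except that $x\pi(x)$ denotes the action of $\pi(x)\in L$ on $x\in X$ in $\Omega$): (i) $\mathcal{A}$ has skew-dimension one; (ii) $\mathcal{A}$ is a (conjugate) division algebra; (iii) there is a skew-symmetric element $s_0\in\mathcal{S}$ such that $U_x(s_0x)=3\,x\pi(x)$ for all $x\in\mathcal{A}$; (iv) the conjugate norm of $\mathcal{A}$ is a scalar multiple of $q\circ\pi$; (v) the conjugate inverse in $\mathcal{A}$ behaves as the inverse in the Moufang quadrangle associated with $\Omega$, in the following sense: for $u\in X\setminus\{0\}$, the expression $\frac{u\pi(u)}{q(\pi(u))}$ plays the role of an inverse of $u$ in the Moufang quadrangle, since the $\mu$-map of $x_1(u,0)$ is $$\mu(x_1(u,0))=x_5\Bigl(\frac{u\pi(u)}{q(\pi(u))},0\Bigr)\,x_1(u,0)\,x_5\Bigl(\frac{u\pi(u)}{q(\pi(u))},0\Bigr),$$ and, up to left multiplication by $s_0$, this same expression is the conjugate inverse of $u$ in $\mathcal{A}$: with $s_0$ as in (iii), $\hat u=s_0\,\frac{u\pi(u)}{q(\pi(u))}$.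
   Context: **Quadrangular algebras.** A quadrangular algebra of characteristic different from 2 is an 8-tuple $(K,L,q,1,X,\cdot,h,\theta)$ where $K$ is a commutative field with $\operatorname{char}K\ne2$, $L$ is a $K$-vector space, $q:L\to K$ is an anisotropic quadratic form, $1\in L$ satisfies $q(1)=1$, $X$ is a nonzero $K$-vector space, $\cdot:X\times L\to X$, $(a,v)\mapsto av$, $h:X\times X\to L$ and $\theta:X\times L\to L$ are maps such that, with $f(u,v)=q(u+v)-q(u)-q(v)$, $v^\sigma=f(1,v)1-v$, $v^{-1}=v^\sigma/q(v)$ for $v\neq 0$: (A1) $\cdot$ is $K$-bilinear; (A2) $a\cdot1=a$; (A3) $(av)v^{-1}=a$ for $v\ne0$; (B1) $h$ is $K$-bilinear; (B2) $h(a,bv)=h(b,av)+f(h(a,b),1)v$; (B3) $f(h(av,b),1)=f(h(a,b),v)$; (C) $\theta(a,v)=\frac12h(a,av)$; (D1) with $\pi(a):=\theta(a,1)$, $a\theta(a,v)=(a\pi(a))v$; (D2) $\pi(a)\in K1$ if and only if $a=0$; for all $a,b\in X$, $v\in L$. Put $g(a,b)=\frac12f(h(a,b),1)$. **Structurable algebras.** Let $\operatorname{char}K\ne2,3$. A structurable algebra over $K$ is a unital, not necessarily associative $K$-algebra $\mathcal{A}$ with involution $\bar{\ }$ (a $K$-linear map of order dividing 2 with $\overline{xy}=\overline y\,\overline x$) such that, with $V_{x,y}z:=\{x,y,z\}:=(x\overline y)z+(z\overline y)x-(z\overline x)y$, one has $[V_{x,y},V_{z,w}]=V_{\{x,y,z\},w}-V_{z,\{y,x,w\}}$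 for all $x,y,z,w$. Put $U_xy:=V_{x,y}x$. Put $\mathcal{S}=\{s:\overline s=-s\}$; the skew-dimension is $\dim_K\mathcal{S}$. An element $\hat x$ is a conjugate inverse of $x$ if $V_{\hat x,x}=V_{x,\hat x}=\mathrm{id}$ (it is unique if it exists); $\mathcal{A}$ is a (conjugate) division algebra if every nonzero element has a conjugate inverse. Two structurable algebras $\mathcal{A},\mathcal{A}'$ over $K$ are isotopic if there are $K$-vector space isomorphisms $\psi,\chi:\mathcal{A}\to\mathcal{A}'$ with $\psi(V_{x,y}z)=V_{\psi(x),\chi(y)}\psi(z)$ for all $x,y,z$. **Conjugate norm in skew-dimension one.** If $\mathcal{A}$ has skew-dimension one, fix $0\ne s_0\in\mathcal{S}$; then $s_0^2=\mu1$ with $\mu\in K^*$. Define $\langle x,y\rangle\in K$ by $\langle x,y\rangle1=(x\overline y-y\overline x)s_0$ and $yzw=2\{y,s_0z,w\}-\langle z,w\rangle y-\langle z,y\rangle w-\langle y,w\rangle z$. The conjugate norm is $\nu(x)=\frac1{12\mu}\langle x,xxx\rangle$; it does not depend on the choice of $s_0$. **The Moufang quadrangle of $\Omega$.** A Moufang quadrangle is a thick generalized quadrangle (a connected bipartite graph of diameter 4 and girth 8 in which every vertex has at least 3 neighbours) all of whose roots (non-stammering paths of length 4) are Moufang, i.e. the root group of the root acts regularly on the set of apartments (circuits of length 8) containing it; the root group of $(x_0,\dots,x_4)$ consists of all automorphisms fixing all neighbours of $x_1,x_2,x_3$. It is determined by four root groups $U_1,U_2,U_3,U_4$ (of consecutive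 roots in an apartment) and their commutator relations; $U_5,U_6,\dots$ denote the root groups of the next roots of the same apartment. For the Moufang quadrangle associated with $\Omega$, $U_1$ and $U_3$ are parametrized, via isomorphisms $x_1,x_3$, by the group $X\times K$ with operation $(a,s)\cdot(b,t)=(a+b,\,s+t+g(b,a))$, and $U_2$ and $U_4$ are parametrized by $(L,+)$ via $x_2,x_4$; the commutator relations are $[x_1(a,t),x_3(b,s)^{-1}]=x_2(h(a,b))$, $[x_2(u),x_4(v)^{-1}]=x_3(0,f(u,v))$, $[x_1(a,t),x_4(v)^{-1}]=x_2(\theta(a,v)+tv)\,x_3(av,tq(v))$, the remaining ones ($[U_i,U_{i+1}]$) being trivial. The group $U_5$ (whose root is opposite to that of $U_1$) is again suitably parametrized by $X\times K$ via $x_5$. For $1\neq w\in U_1$, $\mu(w)$ denotes the unique element of $U_5^*\,w\,U_5^*$ (with $U_5^*=U_5\setminus\{1\}$) that reflects the apartment, interchanging $U_1$ and $U_5$. *)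

theory Defs
  imports Complex_Main "HOL-Algebra.Group"
begin

section \<open>Quadrangular algebras\<close>

definition bilinear_map ::
  "('k::field \<Rightarrow> 'a::ab_group_add \<Rightarrow> 'a) \<Rightarrow> ('k \<Rightarrow> 'b::ab_group_add \<Rightarrow> 'b) \<Rightarrow>
   ('k \<Rightarrow> 'c::ab_group_add \<Rightarrow> 'c) \<Rightarrow> ('a \<Rightarrow> 'b \<Rightarrow> 'c) \<Rightarrow> bool" where
  "bilinear_map s1 s2 s3 b \<longleftrightarrow>
     (\<forall>x. Vector_Spaces.linear s2 s3 (b x)) \<and> (\<forall>y. Vector_Spaces.linear s1 s3 (\<lambda>x. b x y))"

definition polar :: "('a::ab_group_add \<Rightarrow> 'k::field) \<Rightarrow> 'a \<Rightarrow> 'a \<Rightarrow> 'k" where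
  "polar q u v = q (u + v) - q u - q v"

definition quadratic_form :: "('k::field \<Rightarrow> 'a::ab_group_add \<Rightarrow> 'a) \<Rightarrow> ('a \<Rightarrow> 'k) \<Rightarrow> bool" where
  "quadratic_form s q \<longleftrightarrow>
     (\<forall>t v. q (s t v) = t\<^sup>2 * q v) \<and> bilinear_map s s (*) (polar q)"

definition anisotropic :: "('a::ab_group_add \<Rightarrow> 'k::field) \<Rightarrow> bool" where
  "anisotropic q \<longleftrightarrow> (\<forall>v. q v = 0 \<longrightarrow> v = 0)"

text \<open>
  The data \<open>(K, L, q, 1, X, \<cdot>, h, \<theta>)\<close>; the field \<open>K\<close> and the additive groups of \<open>L\<close> and \<open>X\<close> are
  the types \<open>'k\<close>, \<open>'l\<close>, \<open>'x\<close>, and the vector space structures are the two scalar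
  multiplications.
\<close>

record ('k, 'l, 'x) quad_data =
  scaleL :: "'k \<Rightarrow> 'l \<Rightarrow> 'l"
  scaleX :: "'k \<Rightarrow> 'x \<Rightarrow> 'x"
  qform :: "'l \<Rightarrow> 'k"
  base :: "'l"
  act :: "'x \<Rightarrow> 'l \<Rightarrow> 'x"
  hmap :: "'x \<Rightarrow> 'x \<Rightarrow> 'l"
  theta :: "'x \<Rightarrow> 'l \<Rightarrow> 'l"

definition fform :: "('k::field, 'l::ab_group_add, 'x) quad_data \<Rightarrow> 'l \<Rightarrow> 'l \<Rightarrow> 'k" where
  "fform \<Omega> u v = polar (qform \<Omega>) u v"

definition sigmaL :: "('k::field, 'l::ab_group_add, 'x) quad_data \<Rightarrow> 'l \<Rightarrow> 'l" where
  "sigmaL \<Omega> v = scaleL \<Omega> (fform \<Omega> (base \<Omega>) v) (base \<Omega>) - v"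

definition inverseL :: "('k::field, 'l::ab_group_add, 'x) quad_data \<Rightarrow> 'l \<Rightarrow> 'l" where
  "inverseL \<Omega> v = scaleL \<Omega> (1 / qform \<Omega> v) (sigmaL \<Omega> v)"

definition pi_map :: "('k, 'l, 'x) quad_data \<Rightarrow> 'x \<Rightarrow> 'l" where
  "pi_map \<Omega> a = theta \<Omega> a (base \<Omega>)"

definition gform :: "('k::field, 'l::ab_group_add, 'x) quad_data \<Rightarrow> 'x \<Rightarrow> 'x \<Rightarrow> 'k" where
  "gform \<Omega> a b = fform \<Omega> (hmap \<Omega> a b) (base \<Omega>) / 2"

locale quadrangular_algebra =
  fixes \<Omega> :: "('k::field, 'l::ab_group_add, 'x::ab_group_add) quad_data"
  assumes char_not_2: "CHAR('k) \<noteq> 2"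
    and vector_space_L: "vector_space (scaleL \<Omega>)"
    and quadratic_form_q: "quadratic_form (scaleL \<Omega>) (qform \<Omega>)"
    and anisotropic_q: "anisotropic (qform \<Omega>)"
    and q_base: "qform \<Omega> (base \<Omega>) = 1"
    and vector_space_X: "vector_space (scaleX \<Omega>)"
    and X_nonzero: "\<exists>a :: 'x. a \<noteq> 0"
    and A1: "bilinear_map (scaleX \<Omega>) (scaleL \<Omega>) (scaleX \<Omega>) (act \<Omega>)"
    and A2: "act \<Omega> a (base \<Omega>) = a"
    and A3: "v \<noteq> 0 \<Longrightarrow> act \<Omega> (act \<Omega> a v) (inverseL \<Omega> v) = a"
    and B1: "bilinear_map (scaleX \<Omega>) (scaleX \<Omega>) (scaleL \<Omega>) (hmap \<Omega>)"
    and B2: "hmap \<Omega> a (act \<Omega> b v) =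
               hmap \<Omega> b (act \<Omega> a v) + scaleL \<Omega> (fform \<Omega> (hmap \<Omega> a b) (base \<Omega>)) v"
    and B3: "fform \<Omega> (hmap \<Omega> (act \<Omega> a v) b) (base \<Omega>) = fform \<Omega> (hmap \<Omega> a b) v"
    and C: "theta \<Omega> a v = scaleL \<Omega> (1 / 2) (hmap \<Omega> a (act \<Omega> a v))"
    and D1: "act \<Omega> a (theta \<Omega> a v) = act \<Omega> (act \<Omega> a (pi_map \<Omega> a)) v"
    and D2: "(\<exists>t. pi_map \<Omega> a = scaleL \<Omega> t (base \<Omega>)) \<longleftrightarrow> a = 0"

definition quad_inverse ::
  "('k::field, 'l::ab_group_add, 'x::ab_group_add) quad_data \<Rightarrow> 'x \<Rightarrow> 'x" where
  "quad_inverse \<Omega> u =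
     scaleX \<Omega> (1 / qform \<Omega> (pi_map \<Omega> u)) (act \<Omega> u (pi_map \<Omega> u))"


section \<open>Structurable algebras\<close>

record 'a inv_alg =
  amul :: "'a \<Rightarrow> 'a \<Rightarrow> 'a"
  aone :: "'a"
  ainv :: "'a \<Rightarrow> 'a"  \<comment> \<open>the involution\<close>

definition Vop :: "'a::ab_group_add inv_alg \<Rightarrow> 'a \<Rightarrow> 'a \<Rightarrow> 'a \<Rightarrow> 'a" where
  "Vop A x y z = amul A (amul A x (ainv A y)) z + amul A (amul A z (ainv A y)) x
                 - amul A (amul A z (ainv A x)) y"

definition Uop :: "'a::ab_group_add inv_alg \<Rightarrow> 'a \<Rightarrow> 'a \<Rightarrow> 'a" where
  "Uop A x y = Vop A x y x"

locale structurable_algebra = vector_space scale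
  for scale :: "'k::field \<Rightarrow> 'a::ab_group_add \<Rightarrow> 'a" +
  fixes A :: "'a inv_alg"
  assumes char_not_2: "CHAR('k) \<noteq> 2"
    and char_not_3: "CHAR('k) \<noteq> 3"
    and bilinear_mul: "bilinear_map scale scale scale (amul A)"
    and one_left: "amul A (aone A) x = x"
    and one_right: "amul A x (aone A) = x"
    and linear_inv: "Vector_Spaces.linear scale scale (ainv A)"
    and inv_inv: "ainv A (ainv A x) = x"
    and inv_mul: "ainv A (amul A x y) = amul A (ainv A y) (ainv A x)"
    and V_commutator:
      "Vop A x y (Vop A z w t) - Vop A z w (Vop A x y t) =
         Vop A (Vop A x y z) w t - Vop A z (Vop A y x w) t"

definition skew_elements :: "'a::ab_group_add inv_alg \<Rightarrow> 'a set" where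
  "skew_elements A = {s. ainv A s = - s}"

definition skew_dimension ::
  "('k::field \<Rightarrow> 'a::ab_group_add \<Rightarrow> 'a) \<Rightarrow> 'a inv_alg \<Rightarrow> nat" where
  "skew_dimension scale A = vector_space.dim scale (skew_elements A)"

definition is_conj_inverse :: "'a::ab_group_add inv_alg \<Rightarrow> 'a \<Rightarrow> 'a \<Rightarrow> bool" where
  "is_conj_inverse A x x' \<longleftrightarrow> Vop A x' x = id \<and> Vop A x x' = id"

definition conj_division_algebra :: "'a::ab_group_add inv_alg \<Rightarrow> bool" where
  "conj_division_algebra A \<longleftrightarrow> (\<forall>x. x \<noteq> 0 \<longrightarrow> (\<exists>x'. is_conj_inverse A x x'))"

definition isotopic ::
  "('k::field \<Rightarrow> 'a::ab_group_add \<Rightarrow> 'a) \<Rightarrow> 'a inv_alg \<Rightarrow>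
   ('k \<Rightarrow> 'b::ab_group_add \<Rightarrow> 'b) \<Rightarrow> 'b inv_alg \<Rightarrow> bool" where
  "isotopic scale A scale' A' \<longleftrightarrow>
     (\<exists>\<psi> \<chi>. Vector_Spaces.linear scale scale' \<psi> \<and> bij \<psi> \<and>
             Vector_Spaces.linear scale scale' \<chi> \<and> bij \<chi> \<and>
             (\<forall>x y z. \<psi> (Vop A x y z) = Vop A' (\<psi> x) (\<chi> y) (\<psi> z)))"

text \<open>
  The conjugate norm. The definite descriptions below are meaningful for structurable algebras
  of skew-dimension one and a nonzero skew element \<open>s\<close>.
\<close>

definition skew_square ::
  "('k::field \<Rightarrow> 'a::ab_group_add \<Rightarrow> 'a) \<Rightarrow> 'a inv_alg \<Rightarrow> 'a \<Rightarrow> 'k" where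
  "skew_square scale A s = (THE \<mu>. amul A s s = scale \<mu> (aone A))"

definition skew_form ::
  "('k::field \<Rightarrow> 'a::ab_group_add \<Rightarrow> 'a) \<Rightarrow> 'a inv_alg \<Rightarrow> 'a \<Rightarrow> 'a \<Rightarrow> 'a \<Rightarrow> 'k" where
  "skew_form scale A s x y =
     (THE c. scale c (aone A) = amul A (amul A x (ainv A y) - amul A y (ainv A x)) s)"

definition sym_triple ::
  "('k::field \<Rightarrow> 'a::ab_group_add \<Rightarrow> 'a) \<Rightarrow> 'a inv_alg \<Rightarrow> 'a \<Rightarrow> 'a \<Rightarrow> 'a \<Rightarrow> 'a \<Rightarrow> 'a" where
  "sym_triple scale A s y z w =
     scale 2 (Vop A y (amul A s z) w) - scale (skew_form scale A s z w) y
     - scale (skew_form scale A s z y) w - scale (skew_form scale A s y w) z"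

definition conj_norm ::
  "('k::field \<Rightarrow> 'a::ab_group_add \<Rightarrow> 'a) \<Rightarrow> 'a inv_alg \<Rightarrow> 'a \<Rightarrow> 'k" where
  "conj_norm scale A x =
     (let s = (SOME s. s \<in> skew_elements A \<and> s \<noteq> 0)
      in skew_form scale A s x (sym_triple scale A s x x x) / (12 * skew_square scale A s))"


section \<open>Moufang quadrangles\<close>

text \<open>A graph is given by its (symmetric, irreflexive) adjacency relation on a type of vertices.\<close>

definition graph_dist :: "('v \<Rightarrow> 'v \<Rightarrow> bool) \<Rightarrow> 'v \<Rightarrow> 'v \<Rightarrow> nat" where
  "graph_dist E x y = (LEAST n. (E ^^ n) x y)"

text \<open>A circuit of length \<open>k\<close>, as a \<open>k\<close>-periodic labelling of its vertices by the integers.\<close>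

definition circuit :: "('v \<Rightarrow> 'v \<Rightarrow> bool) \<Rightarrow> nat \<Rightarrow> (int \<Rightarrow> 'v) \<Rightarrow> bool" where
  "circuit E k c \<longleftrightarrow> 3 \<le> k \<and> (\<forall>i. c (i + int k) = c i) \<and> inj_on c {0..<int k}
     \<and> (\<forall>i. E (c i) (c (i + 1)))"

locale thick_generalized_quadrangle =
  fixes E :: "'v \<Rightarrow> 'v \<Rightarrow> bool"
  assumes adj_sym: "E x y \<Longrightarrow> E y x"
    and adj_irrefl: "\<not> E x x"
    and connected: "E\<^sup>*\<^sup>* x y"
    and bipartite: "\<exists>P. \<forall>x y. E x y \<longrightarrow> (x \<in> P \<longleftrightarrow> y \<notin> P)"
    and diameter_4: "(\<forall>x y. graph_dist E x y \<le> 4) \<and> (\<exists>x y. graph_dist E x y = 4)"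
    and girth_8: "(\<exists>c. circuit E 8 c) \<and> (\<forall>k c. circuit E k c \<longrightarrow> 8 \<le> k)"
    and thick: "\<exists>N. card N = 3 \<and> (\<forall>y\<in>N. E x y)"

text \<open>
  Automorphisms act from the right: the product \<open>\<phi>\<psi>\<close> is \<open>\<phi>\<close> followed by \<open>\<psi>\<close>.
\<close>

definition aut_group :: "('v \<Rightarrow> 'v \<Rightarrow> bool) \<Rightarrow> ('v \<Rightarrow> 'v) monoid" where
  "aut_group E = \<lparr>carrier = {\<phi>. bij \<phi> \<and> (\<forall>x y. E (\<phi> x) (\<phi> y) \<longleftrightarrow> E x y)},
                  mult = (\<lambda>\<phi> \<psi>. \<psi> \<circ> \<phi>), one = id\<rparr>"

definition is_root :: "('v \<Rightarrow> 'v \<Rightarrow> bool) \<Rightarrow> 'v list \<Rightarrow> bool" where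
  "is_root E r \<longleftrightarrow> length r = 5 \<and> successively E r \<and> (\<forall>i<3. r ! i \<noteq> r ! (i + 2))"

definition root_group :: "('v \<Rightarrow> 'v \<Rightarrow> bool) \<Rightarrow> 'v list \<Rightarrow> ('v \<Rightarrow> 'v) set" where
  "root_group E r =
     {\<phi> \<in> carrier (aut_group E). \<forall>i\<in>{1, 2, 3}. \<forall>y. E (r ! i) y \<longrightarrow> \<phi> y = y}"

text \<open>
  Since the girth is 8, a circuit of length 8 has no chords, so it is determined by its set of
  vertices.
\<close>

definition is_apartment :: "('v \<Rightarrow> 'v \<Rightarrow> bool) \<Rightarrow> 'v set \<Rightarrow> bool" where
  "is_apartment E A \<longleftrightarrow> (\<exists>c. circuit E 8 c \<and> A = range c)"

definition moufang_root :: "('v \<Rightarrow> 'v \<Rightarrow> bool) \<Rightarrow> 'v list \<Rightarrow> bool" where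
  "moufang_root E r \<longleftrightarrow>
     (\<forall>A B. is_apartment E A \<and> set r \<subseteq> A \<and> is_apartment E B \<and> set r \<subseteq> B
        \<longrightarrow> (\<exists>!\<phi>. \<phi> \<in> root_group E r \<and> \<phi> ` A = B))"

locale moufang_quadrangle = thick_generalized_quadrangle E for E :: "'v \<Rightarrow> 'v \<Rightarrow> bool" +
  assumes roots_moufang: "is_root E r \<Longrightarrow> moufang_root E r"

text \<open>
  For an apartment labelled by \<open>c\<close>, the group \<open>U\<^sub>i\<close> is the root group of the root
  \<open>(c i, \<dots>, c (i + 4))\<close>. Thus \<open>U\<^sub>1\<close> and \<open>U\<^sub>5\<close> belong to opposite roots, with common end vertices
  \<open>c 1\<close> and \<open>c 5\<close>.
\<close>

definition Ugrp :: "('v \<Rightarrow> 'v \<Rightarrow> bool) \<Rightarrow> (int \<Rightarrow> 'v) \<Rightarrow> int \<Rightarrow> ('v \<Rightarrow> 'v) set" where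
  "Ugrp E c i = root_group E (map c [i..i + 4])"

definition conjugate :: "('g, 'z) monoid_scheme \<Rightarrow> 'g \<Rightarrow> 'g \<Rightarrow> 'g" where
  "conjugate G m a = inv\<^bsub>G\<^esub> m \<otimes>\<^bsub>G\<^esub> a \<otimes>\<^bsub>G\<^esub> m"

definition commutator :: "('g, 'z) monoid_scheme \<Rightarrow> 'g \<Rightarrow> 'g \<Rightarrow> 'g" where
  "commutator G a b = inv\<^bsub>G\<^esub> a \<otimes>\<^bsub>G\<^esub> inv\<^bsub>G\<^esub> b \<otimes>\<^bsub>G\<^esub> a \<otimes>\<^bsub>G\<^esub> b"

text \<open>
  \<open>\<mu>(w)\<close> for \<open>1 \<noteq> w \<in> U\<^sub>1\<close>. The reflection of the apartment interchanging the roots of \<open>U\<^sub>1\<close> and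
  \<open>U\<^sub>5\<close> fixes \<open>c 1\<close> and \<open>c 5\<close> and hence maps \<open>c i\<close> to \<open>c (2 - i)\<close>.
\<close>

definition mu :: "('v \<Rightarrow> 'v \<Rightarrow> bool) \<Rightarrow> (int \<Rightarrow> 'v) \<Rightarrow> ('v \<Rightarrow> 'v) \<Rightarrow> ('v \<Rightarrow> 'v)" where
  "mu E c w = (THE m.
     (\<exists>y \<in> Ugrp E c 5 - {id}. \<exists>z \<in> Ugrp E c 5 - {id}.
        m = y \<otimes>\<^bsub>aut_group E\<^esub> w \<otimes>\<^bsub>aut_group E\<^esub> z) \<and>
     (\<forall>i. m (c i) = c (2 - i)) \<and>
     conjugate (aut_group E) m ` Ugrp E c 1 = Ugrp E c 5 \<and>
     conjugate (aut_group E) m ` Ugrp E c 5 = Ugrp E c 1)"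

definition additive_group :: "'a::ab_group_add monoid" where
  "additive_group = \<lparr>carrier = UNIV, mult = (+), one = 0\<rparr>"

definition XK_group ::
  "('k::field, 'l::ab_group_add, 'x::ab_group_add) quad_data \<Rightarrow> ('x \<times> 'k) monoid" where
  "XK_group \<Omega> = \<lparr>carrier = UNIV,
                  mult = (\<lambda>(a, s) (b, t). (a + b, s + t + gform \<Omega> b a)),
                  one = (0, 0)\<rparr>"

text \<open>
  The Moufang quadrangle associated with \<open>\<Omega>\<close>: a Moufang quadrangle \<open>E\<close> with a labelled apartment
  \<open>c\<close> and parametrizations of its root groups \<open>U\<^sub>1, \<dots>, U\<^sub>4\<close> satisfying the commutator relations
  (with the convention \<open>[a, b] = a\<inverse>b\<inverse>ab\<close>) given by \<open>\<Omega>\<close>. They determine the quadrangle up to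
  isomorphism.
\<close>

locale quadrangle_of = quadrangular_algebra \<Omega> + moufang_quadrangle E
  for \<Omega> :: "('k::field, 'l::ab_group_add, 'x::ab_group_add) quad_data"
    and E :: "'v \<Rightarrow> 'v \<Rightarrow> bool" +
  fixes c :: "int \<Rightarrow> 'v"
    and x1 :: "'x \<times> 'k \<Rightarrow> 'v \<Rightarrow> 'v"
    and x2 :: "'l \<Rightarrow> 'v \<Rightarrow> 'v"
    and x3 :: "'x \<times> 'k \<Rightarrow> 'v \<Rightarrow> 'v"
    and x4 :: "'l \<Rightarrow> 'v \<Rightarrow> 'v"
  assumes apartment: "circuit E 8 c"
    and x1_iso: "x1 \<in> iso (XK_group \<Omega>) ((aut_group E)\<lparr>carrier := Ugrp E c 1\<rparr>)"
    and x2_iso: "x2 \<in> iso additive_group ((aut_group E)\<lparr>carrier := Ugrp E c 2\<rparr>)"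
    and x3_iso: "x3 \<in> iso (XK_group \<Omega>) ((aut_group E)\<lparr>carrier := Ugrp E c 3\<rparr>)"
    and x4_iso: "x4 \<in> iso additive_group ((aut_group E)\<lparr>carrier := Ugrp E c 4\<rparr>)"
    and comm_13: "commutator (aut_group E) (x1 (a, t)) (inv\<^bsub>aut_group E\<^esub> (x3 (b, s))) =
                    x2 (hmap \<Omega> a b)"
    and comm_24: "commutator (aut_group E) (x2 u) (inv\<^bsub>aut_group E\<^esub> (x4 v)) =
                    x3 (0, fform \<Omega> u v)"
    and comm_14: "commutator (aut_group E) (x1 (a, t)) (inv\<^bsub>aut_group E\<^esub> (x4 v)) =
                    x2 (theta \<Omega> a v + scaleL \<Omega> t v) \<otimes>\<^bsub>aut_group E\<^esub>
                    x3 (act \<Omega> a v, t * qform \<Omega> v)"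
    and comm_adjacent: "\<lbrakk>i \<in> {1, 2, 3}; \<phi> \<in> Ugrp E c i; \<psi> \<in> Ugrp E c (i + 1)\<rbrakk>
                          \<Longrightarrow> commutator (aut_group E) \<phi> \<psi> = id"

text \<open>
  The parametrization of \<open>U\<^sub>5\<close>, transported from \<open>x\<^sub>1\<close> by \<open>\<mu>(x\<^sub>1(0,1))\<close>. This normalization is no
  restriction: as \<open>g\<close> is nondegenerate, \<open>X \<times> K\<close> is generated by the elements \<open>(b,0)\<close>, and every
  nonzero \<open>b\<close> is of the form \<open>u\<pi>(u)/q(\<pi>(u))\<close>; so there is at most one isomorphism \<open>x\<^sub>5\<close>
  from \<open>X \<times> K\<close> to \<open>U\<^sub>5\<close> for which
  \<open>\<mu>(x\<^sub>1(u,0)) = x\<^sub>5(u\<pi>(u)/q(\<pi>(u)),0) x\<^sub>1(u,0) x\<^sub>5(u\<pi>(u)/q(\<pi>(u)),0)\<close> for all nonzero \<open>u\<close>.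
\<close>

definition x5_param ::
  "('v \<Rightarrow> 'v \<Rightarrow> bool) \<Rightarrow> (int \<Rightarrow> 'v) \<Rightarrow> ('x::ab_group_add \<times> 'k::field \<Rightarrow> 'v \<Rightarrow> 'v) \<Rightarrow>
   'x \<times> 'k \<Rightarrow> 'v \<Rightarrow> 'v" where
  "x5_param E c x1 w = conjugate (aut_group E) (mu E c (x1 (0, 1))) (x1 w)"

end

theory Submission
  imports Defs
begin

text \<open>
  Polarizing \<open>6 x\<pi>(x)\<close> gives a symmetric trilinear product on \<open>X\<close> which, together with the
  skew-symmetric form \<open>g\<close>, is a Freudenthal triple system: the one axiom that is not immediate is the
  linearization of (D1) evaluated at \<open>\<pi>(x)\<close>. A Freudenthal triple system with a base point \<open>e\<close> on which
  the quartic form does not vanish carries a similitude \<open>J\<close> with \<open>J\<^sup>2 = \<mu>\<close>, and \<open>e\<close> and \<open>J\<close> become the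
  unit and the left multiplication by a skew element \<open>s = J e\<close> of a structurable algebra of
  skew-dimension one. Here the quartic form is a multiple of \<open>q \<circ> \<pi>\<close>, which is anisotropic, so every
  nonzero \<open>e \<in> X\<close> is admissible and every nonzero element has a conjugate inverse. One algebra
  constitutes an admissible family.

  For the quadrangle, write \<open>\<mu>(x\<^sub>1(a,t)) = y x\<^sub>1(a,t) z\<close> with \<open>y, z \<in> U\<^sub>5\<close>. Comparing components in
  \<open>U\<^sub>2U\<^sub>3U\<^sub>4\<close> shows that it maps \<open>x\<^sub>4(v)\<close> to \<open>x\<^sub>2(\<theta>(a,v) + tv)\<close> and reveals how \<open>z\<close> acts on \<open>U\<^sub>2\<close> modulo
  \<open>U\<^sub>4\<close>. Applied to \<open>\<mu>(x\<^sub>1(0,1))\<close> this yields \<open>y = z = x\<^sub>5(0,1)\<close>, hence \<open>\<mu>(x\<^sub>1(0,1))\<close> centralizes \<open>U\<^sub>3\<close>;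
  applied to \<open>\<mu>(x\<^sub>1(u,0))\<close> it then yields \<open>z = x\<^sub>5(b,0)\<close> with \<open>b\<pi>(u) = - u\<close>.
\<close>


section \<open>Polarization of forms that vanish on the diagonal\<close>

text \<open>The diagonal values at \<open>z + x\<close>, \<open>z - x\<close> and
  \<open>z + x + x\<close> separate the parts \<open>p\<close>, \<open>r\<close>, \<open>s\<close>
  of degree 1, 2 and 3 in \<open>x\<close> once 2 and 3 are invertible. Symmetry is assumed in the
  last three arguments only, as for \<open>defect\<close> below, so each part is a sum of two
  different terms.\<close>

lemma quartic_polarization:
  fixes B :: "'x::ab_group_add \<Rightarrow> 'x \<Rightarrow> 'x \<Rightarrow> 'x \<Rightarrow> 'k::field"
  assumes two: "(2::'k) \<noteq> 0" and three: "(3::'k) \<noteq> 0"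
    and add: "\<And>a a' b c d. B (a + a') b c d = B a b c d + B a' b c d"
      "\<And>a b b' c d. B a (b + b') c d = B a b c d + B a b' c d"
    and sym: "\<And>a b c d. B a b c d = B a c b d" "\<And>a b c d. B a b c d = B a b d c"
    and zero: "\<And>z. B z z z z = 0"
  shows "B x z z z + 3 * B z x z z = 0" and "B x x z z + B z x x z = 0"
proof -
  have add': "B a b (c + c') d = B a b c d + B a b c' d"
    "B a b c (d + d') = B a b c d + B a b c d'" for a b c c' d d'
    by (metis add(2) sym)+
  define p where "p = B x z z z + 3 * B z x z z"
  define r where "r = 3 * B x x z z + 3 * B z x x z"
  define s where "s = 3 * B x x x z + B z x x x"
  have "additive (\<lambda>a. B a b c d)" "additive (\<lambda>a. B b a c d)" "additive (\<lambda>a. B b c a d)"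
    "additive (\<lambda>a. B b c d a)" for b c d
    by (simp_all add: additive_def add add')
  note diff = this[THEN additive.diff]
  have sx: "B a z x x = B a x x z" "B a x z x = B a x x z" "B a z x z = B a x z z"
    "B a z z x = B a x z z" for a
    by (metis sym)+
  have "B (z + x) (z + x) (z + x) (z + x) = B z z z z + p + r + s + B x x x x"
    unfolding p_def r_def s_def by (simp add: add add' sx algebra_simps)
  then have 1: "p + r + s = 0" by (simp add: zero)
  have "B (z - x) (z - x) (z - x) (z - x) = B z z z z - p + r - s + B x x x x"
    unfolding p_def r_def s_def by (simp add: diff sx algebra_simps)
  then have 2: "- p + r - s = 0" by (simp add: zero)
  have "B (z + x + x) (z + x + x) (z + x + x) (z + x + x) =
      B z z z z + 2 * p + 4 * r + 8 * s + 16 * B x x x x"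
    unfolding p_def r_def s_def by (simp add: add add' sx algebra_simps)
  then have 3: "2 * p + 4 * r + 8 * s = 0" by (simp add: zero)
  have "2 * r = 0" using 1 2 by algebra
  then have r: "r = 0" using two by simp
  have "2 * 3 * s = 0" using 1 3 r by algebra
  then have s: "s = 0" using two three by (simp only: mult_eq_0_iff) simp
  from 1 r s show "B x z z z + 3 * B z x z z = 0" by (simp add: p_def)
  have "3 * (B x x z z + B z x x z) = 0" using r by (simp add: r_def algebra_simps)
  then show "B x x z z + B z x x z = 0" using three by (simp only: mult_eq_0_iff) simp
qed

text \<open>Comparing \<open>x + y\<close> with \<open>x - y\<close> kills the values with a
  repeated argument; polarizing the repetition then reaches three independent arguments.\<close>

lemma cubic_polarization:
  fixes C :: "'x::ab_group_add \<Rightarrow> 'x \<Rightarrow> 'x \<Rightarrow> 'k::field"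
  assumes two: "(2::'k) \<noteq> 0" and three: "(3::'k) \<noteq> 0"
    and add: "\<And>a a' b c. C (a + a') b c = C a b c + C a' b c"
    and sym: "\<And>a b c. C a b c = C b a c" "\<And>a b c. C a b c = C a c b"
    and zero: "\<And>z. C z z z = 0"
  shows "C x y z = 0"
proof -
  have add': "C a (b + b') c = C a b c + C a b' c" "C a b (c + c') = C a b c + C a b c'"
    for a b b' c c'
    by (metis add sym)+
  have "additive (\<lambda>a. C a b c)" "additive (\<lambda>a. C b a c)" "additive (\<lambda>a. C b c a)" for b c
    by (simp_all add: additive_def add add')
  note diff = this[THEN additive.diff]
  have 2: "C x x y = 0" for x y
  proof -
    have sx: "C x y x = C x x y" "C y x x = C x x y" "C y x y = C x y y" "C y y x = C x y y"
      by (metis sym)+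
    have "C (x + y) (x + y) (x + y) = C x x x + 3 * C x x y + 3 * C x y y + C y y y"
      by (simp add: add add' sx algebra_simps)
    moreover have "C (x - y) (x - y) (x - y) = C x x x - 3 * C x x y + 3 * C x y y - C y y y"
      by (simp add: diff sx algebra_simps)
    ultimately have "2 * 3 * C x x y = 0" unfolding zero by algebra
    then show ?thesis using two three by (simp only: mult_eq_0_iff) simp
  qed
  have "2 * C x y z = C (x + y) (x + y) z"
    unfolding add add' by (simp add: 2 sym(1)[of y x])
  also have "\<dots> = 0" by (rule 2)
  finally have "2 * C x y z = 0" .
  then show ?thesis using two by simp
qed

section \<open>Freudenthal triple systems\<close>

text \<open>With \<open>t_sym\<close>, \<open>g_t_sym\<close> makes \<open>g (t x y z) w\<close>
  symmetric in all four arguments. \<open>triple\<close> is Freudenthal's identity {x, xxx, y} = <y,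
  xxx> x + <y, x> xxx, with the arguments of the skew form exchanged.\<close>

locale freudenthal_triple_system = vector_space scale
  for scale :: "'k::field \<Rightarrow> 'x::ab_group_add \<Rightarrow> 'x" (infixr \<open>*s\<close> 75) +
  fixes g :: "'x \<Rightarrow> 'x \<Rightarrow> 'k"
    and t :: "'x \<Rightarrow> 'x \<Rightarrow> 'x \<Rightarrow> 'x"
  assumes two: "(2::'k) \<noteq> 0" and three: "(3::'k) \<noteq> 0"
    and g_add [simp]: "g (x + y) z = g x z + g y z"
    and g_scale [simp]: "g (c *s x) z = c * g x z"
    and g_skew: "g x y = - g y x"
    and nondegenerate: "(\<And>w. g x w = 0) \<Longrightarrow> x = 0"
    and t_add [simp]: "t (x + y) z w = t x z w + t y z w"
    and t_scale [simp]: "t (c *s x) z w = c *s t x z w"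
    and t_sym: "t x y z = t y x z" "t x y z = t x z y"
    and g_t_sym: "g (t x y z) w = g (t w y z) x"
    and triple: "t x (t x x x) y = - (g (t x x x) y *s x) - g x y *s t x x x"
begin

lemma numeral_nonzero [simp]:
  "(2::'k) \<noteq> 0" "(3::'k) \<noteq> 0" "(4::'k) \<noteq> 0" "(6::'k) \<noteq> 0" "(8::'k) \<noteq> 0" "(12::'k) \<noteq> 0"
proof -
  have "(2 * 2::'k) \<noteq> 0" "(2 * 3::'k) \<noteq> 0" "(2 * (2 * 2)::'k) \<noteq> 0" "(2 * (2 * 3)::'k) \<noteq> 0"
    using two three by (simp_all only: mult_eq_0_iff) simp_all
  with two three show "(2::'k) \<noteq> 0" "(3::'k) \<noteq> 0" "(4::'k) \<noteq> 0" "(6::'k) \<noteq> 0" "(8::'k) \<noteq> 0"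
    "(12::'k) \<noteq> 0" by simp_all
qed

lemma cancel_two: "2 * a = 2 * b \<Longrightarrow> a = b" for a b :: 'k
  by (rule mult_left_cancel[OF numeral_nonzero(1), THEN iffD1])

lemma g_right [simp]:
  "g z (x + y) = g z x + g z y" "g z (c *s x) = c * g z x"
  by (simp_all add: g_skew[of z])

lemma g_diff [simp]:
  "g 0 z = 0" "g (- x) z = - g x z" "g (x - y) z = g x z - g y z"
  "g z 0 = 0" "g z (- x) = - g z x" "g z (x - y) = g z x - g z y"
proof -
  interpret a: additive "\<lambda>x. g x z" by standard simp
  interpret b: additive "\<lambda>x. g z x" by standard simp
  show "g 0 z = 0" "g (- x) z = - g x z" "g (x - y) z = g x z - g y z"
    "g z 0 = 0" "g z (- x) = - g z x" "g z (x - y) = g z x - g z y"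
    by (rule a.zero a.minus a.diff b.zero b.minus b.diff)+
qed

lemma g_self [simp]: "g x x = 0"
proof -
  have "2 * g x x = 0" using g_skew[of x x] by (metis add.right_inverse mult_2)
  then show ?thesis using two by simp
qed

lemma eqI: "(\<And>w. g x w = g y w) \<Longrightarrow> x = y"
  using nondegenerate[of "x - y"] by simp

lemma t_right [simp]:
  "t w (x + y) z = t w x z + t w y z" "t w (c *s x) z = c *s t w x z"
  "t w z (x + y) = t w z x + t w z y" "t w z (c *s x) = c *s t w z x"
  by (metis t_sym t_add t_scale)+

lemma t_diff [simp]:
  "t 0 y z = 0" "t (- x) y z = - t x y z" "t (x - x') y z = t x y z - t x' y z"
  "t y 0 z = 0" "t y (- x) z = - t y x z" "t y (x - x') z = t y x z - t y x' z"
  "t y z 0 = 0" "t y z (- x) = - t y z x" "t y z (x - x') = t y z x - t y z x'"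
proof -
  interpret a: additive "\<lambda>x. t x y z" by standard simp
  interpret b: additive "\<lambda>x. t y x z" by standard simp
  interpret c: additive "\<lambda>x. t y z x" by standard simp
  show "t 0 y z = 0" "t (- x) y z = - t x y z" "t (x - x') y z = t x y z - t x' y z"
  "t y 0 z = 0" "t y (- x) z = - t y x z" "t y (x - x') z = t y x z - t y x' z"
  "t y z 0 = 0" "t y z (- x) = - t y z x" "t y z (x - x') = t y z x - t y z x'"
    by (rule a.zero a.minus a.diff b.zero b.minus b.diff c.zero c.minus c.diff)+
qed

definition q4 :: "'x \<Rightarrow> 'x \<Rightarrow> 'x \<Rightarrow> 'x \<Rightarrow> 'k" where
  "q4 x y z w = g (t x y z) w"

lemma q4_sym: "q4 x y z w = q4 y x z w" "q4 x y z w = q4 x z y w" "q4 x y z w = q4 x y w z"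
proof -
  show "q4 x y z w = q4 y x z w" "q4 x y z w = q4 x z y w"
    by (metis q4_def t_sym)+
  show "q4 x y z w = q4 x y w z"
    unfolding q4_def by (metis g_t_sym t_sym)
qed

lemma q4_linear [simp]:
  "q4 (x + x') y z w = q4 x y z w + q4 x' y z w" "q4 (c *s x) y z w = c * q4 x y z w"
  "q4 y (x + x') z w = q4 y x z w + q4 y x' z w" "q4 y (c *s x) z w = c * q4 y x z w"
  "q4 y z (x + x') w = q4 y z x w + q4 y z x' w" "q4 y z (c *s x) w = c * q4 y z x w"
  "q4 y z w (x + x') = q4 y z w x + q4 y z w x'" "q4 y z w (c *s x) = c * q4 y z w x"
  "q4 (- x) y z w = - q4 x y z w" "q4 (x - x') y z w = q4 x y z w - q4 x' y z w"
  "q4 y (- x) z w = - q4 y x z w" "q4 y (x - x') z w = q4 y x z w - q4 y x' z w"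
  "q4 y z (- x) w = - q4 y z x w" "q4 y z (x - x') w = q4 y z x w - q4 y z x' w"
  "q4 y z w (- x) = - q4 y z w x" "q4 y z w (x - x') = q4 y z w x - q4 y z w x'"
  by (simp_all add: q4_def)

lemma g_t: "g (t x y z) w = q4 x y z w" "g w (t x y z) = - q4 x y z w"
  by (simp_all add: q4_def g_skew[of w])

text \<open>The failure of \<open>triple\<close> when its four occurrences of \<open>x\<close> are
  replaced by \<open>a\<close>, \<open>b\<close>, \<open>c\<close>, \<open>d\<close>, tested against
  \<open>w\<close>. The slot of \<open>a\<close> plays a different role from the symmetric slots
  \<open>b\<close>, \<open>c\<close>, \<open>d\<close>.\<close>

definition defect :: "'x \<Rightarrow> 'x \<Rightarrow> 'x \<Rightarrow> 'x \<Rightarrow> 'x \<Rightarrow> 'x \<Rightarrow> 'k" where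
  "defect y w a b c d = q4 a (t b c d) y w + g (t b c d) y * g a w + g a y * g (t b c d) w"

lemma defect_diagonal: "defect y w z z z z = 0"
  unfolding defect_def q4_def by (simp add: triple)

lemma triple_31: "defect y w x z z z + 3 * defect y w z x z z = 0"
  and triple_22: "defect y w x x z z + defect y w z x x z = 0"
proof -
  have 1: "defect y w (a + a') b c d = defect y w a b c d + defect y w a' b c d"
    "defect y w a (b + b') c d = defect y w a b c d + defect y w a b' c d"
    for a a' b b' c d
    by (simp_all add: defect_def algebra_simps)
  have 2: "defect y w a b c d = defect y w a c b d" "defect y w a b c d = defect y w a b d c"
    for a b c d
    by (simp_all only: defect_def t_sym(1)[of b c d] t_sym(2)[of b d c])
  show "defect y w x z z z + 3 * defect y w z x z z = 0"
    "defect y w x x z z + defect y w z x x z = 0"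
    by (rule quartic_polarization[of "defect y w", OF two three 1 2 defect_diagonal])+
qed

text \<open>These operators turn out to be derivations of \<open>t\<close> that are skew for
  \<open>g\<close>: the inner derivations of the triple system.\<close>

definition D :: "'x \<Rightarrow> 'x \<Rightarrow> 'x \<Rightarrow> 'x" where
  "D x y z = (1 / 2) *s (t x y z + g x z *s y + g y z *s x)"

lemma D_linear [simp]:
  "D (x + x') y z = D x y z + D x' y z" "D (c *s x) y z = c *s D x y z"
  "D y (x + x') z = D y x z + D y x' z" "D y (c *s x) z = c *s D y x z"
  "D y z (x + x') = D y z x + D y z x'" "D y z (c *s x) = c *s D y z x"
  "D (- x) y z = - D x y z" "D (x - x') y z = D x y z - D x' y z"
  "D y (- x) z = - D y x z" "D y (x - x') z = D y x z - D y x' z"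
  "D y z (- x) = - D y z x" "D y z (x - x') = D y z x - D y z x'"
  by (simp_all add: D_def algebra_simps)

lemma D_sym: "D x y z = D y x z"
  by (simp add: D_def t_sym(1)[of x y] algebra_simps)

lemma g_D: "g (D x y z) w = (q4 x y z w + g x z * g y w + g y z * g x w) / 2"
  by (simp add: D_def g_t)

lemma D_skew: "g (D x y z) w = - g z (D x y w)"
proof -
  have "g (D x y z) w = g (D x y w) z"
    unfolding g_D by (simp add: q4_sym(3)[of x y z] algebra_simps)
  then show ?thesis using g_skew[of z] by simp
qed

text \<open>The two polarized axioms are taken with \<open>y\<close> specialized to \<open>x\<close>
  and to \<open>z\<close>. They involve the same three quartic terms \<open>a\<close>,
  \<open>b\<close>, \<open>c\<close>, and eliminating \<open>b\<close> leaves the derivation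
  identity.\<close>

lemma D_derivation_cubic: "g (D x x (t z z z)) w = 3 * g (t (D x x z) z z) w"
proof -
  have 1: "defect x w x z z z + 3 * defect x w z x z z = 0" by (rule triple_31)
  have 2: "defect z w x x z z + defect z w z x x z = 0" by (rule triple_22)
  define a where "a = q4 x x (t z z z) w"
  define b where "b = q4 x z (t x z z) w"
  define c where "c = q4 z z (t x x z) w"
  have s: "q4 x (t z z z) x w = a" "q4 z (t x z z) x w = b" "q4 x (t x z z) z w = b"
    "q4 z (t x x z) z w = c" "q4 (t x x z) z z w = c"
    "q4 z z z x = q4 x z z z" "q4 x x z z = q4 x z z x"
    "g z x = - g x z"
    unfolding a_def b_def c_def by (metis q4_sym g_skew)+
  from 1 have 1: "a + q4 x z z z * g x w + 3 * (b + q4 x z z x * g z w - g x z * q4 x z z w) = 0"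
    by (simp add: defect_def g_t s algebra_simps)
  from 2 have 2: "b + q4 x z z z * g x w + g x z * q4 x z z w + c + q4 x z z x * g z w = 0"
    by (simp add: defect_def g_t s algebra_simps)
  have "2 * (g (D x x (t z z z)) w - 3 * g (t (D x x z) z z) w)
     = a - 2 * q4 x z z z * g x w - 3 * (c + 2 * g x z * q4 x z z w)"
    by (simp add: g_D D_def[of x x z] g_t s a_def[symmetric] field_simps)
  also have "\<dots> = 0" using 1 2 by algebra
  finally have "2 * g (D x x (t z z z)) w = 2 * (3 * g (t (D x x z) z z) w)"
    by (simp add: algebra_simps)
  then show ?thesis by (rule cancel_two)
qed

text \<open>The cubic case is polarized twice: in \<open>z\<close>, \<open>w\<close>,
  \<open>u\<close> for the operators \<open>D x x\<close>, and then in \<open>x\<close>.\<close>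

lemma D_derivation: "D x y (t z w u) = t (D x y z) w u + t z (D x y w) u + t z w (D x y u)"
proof (rule eqI)
  fix v
  have diagonal: "g (D x x (t z w u)) v = g (t (D x x z) w u + t z (D x x w) u + t z w (D x x u)) v"
    for x
  proof -
    define C where "C z w u =
      g (D x x (t z w u)) v - g (t (D x x z) w u + t z (D x x w) u + t z w (D x x u)) v" for z w u
    have "C z w u = 0"
    proof (rule cubic_polarization[of C, OF two three])
      show "C (a + a') b c = C a b c + C a' b c" for a a' b c
        by (simp add: C_def algebra_simps)
      show "C a b c = C b a c" for a b c
        unfolding C_def t_sym(1)[of a b] t_sym(1)[of "D x x a" b] t_sym(1)[of a "D x x b"] by simp
      show "C a b c = C a c b" for a b c
        unfolding C_def t_sym(2)[of a b c] t_sym(2)[of "D x x a" b c] t_sym(2)[of a "D x x b"]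
          t_sym(2)[of a b "D x x c"] by simp
      show "C z z z = 0" for z
      proof -
        have "t z (D x x z) z = t (D x x z) z z" "t z z (D x x z) = t (D x x z) z z"
          by (metis t_sym)+
        then show ?thesis by (simp add: C_def D_derivation_cubic)
      qed
    qed
    then show ?thesis by (simp add: C_def)
  qed
  have "2 * g (D x y (t z w u)) v =
      2 * g (t (D x y z) w u + t z (D x y w) u + t z w (D x y u)) v"
    using diagonal[of "x + y"] diagonal[of x] diagonal[of y]
    by (simp add: D_sym[of y x] algebra_simps)
  then show "g (D x y (t z w u)) v = g (t (D x y z) w u + t z (D x y w) u + t z w (D x y u)) v"
    by (rule cancel_two)
qed

text \<open>\<open>D z w\<close> is built from \<open>t\<close> and \<open>g\<close> alone, so a
  derivation of \<open>t\<close> that is skew for \<open>g\<close> acts on it through its two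
  arguments.\<close>

lemma D_commutator: "D x y (D z w u) - D z w (D x y u) = D (D x y z) w u + D z (D x y w) u"
proof -
  have g: "g (D x y z) u + g z (D x y u) = 0" for z u
    by (simp add: D_skew)
  have "D x y (D z w u) =
      (1 / 2) *s (D x y (t z w u) + g z u *s D x y w + g w u *s D x y z)"
    by (simp add: D_def[of z w])
  also have "\<dots> = D (D x y z) w u + D z (D x y w) u + D z w (D x y u)"
    unfolding D_derivation D_def[of "D x y z"] D_def[of z "D x y w"] D_def[of z w "D x y u"]
    by (simp add: algebra_simps D_skew)
  finally show ?thesis by simp
qed

text \<open>
  In the structurable algebra attached to a base point below, \<open>T x y z\<close> is \<open>{x, s y, z}\<close> for a skew
  element \<open>s\<close>.
\<close>

definition T :: "'x \<Rightarrow> 'x \<Rightarrow> 'x \<Rightarrow> 'x" where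
  "T x y z = D x y z - (g x y / 2) *s z"

lemma T_linear [simp]:
  "T (x + x') y z = T x y z + T x' y z" "T (c *s x) y z = c *s T x y z"
  "T y (x + x') z = T y x z + T y x' z" "T y (c *s x) z = c *s T y x z"
  "T y z (x + x') = T y z x + T y z x'" "T y z (c *s x) = c *s T y z x"
  "T (- x) y z = - T x y z" "T (x - x') y z = T x y z - T x' y z"
  "T y (- x) z = - T y x z" "T y (x - x') z = T y x z - T y x' z"
  "T y z (- x) = - T y z x" "T y z (x - x') = T y z x - T y z x'"
  by (simp_all add: T_def algebra_simps diff_divide_distrib add_divide_distrib)

text \<open>\<open>T\<close> differs from \<open>D\<close> by scalar operators, which drop out of
  the commutator; on the right the scalars cancel because \<open>- T y x\<close> is the adjoint of
  \<open>T x y\<close> under \<open>g\<close>. The plus sign becomes the minus sign of the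
  structurable identity through \<open>T_Jinv\<close>.\<close>

lemma T_commutator:
  "T x y (T z w u) - T z w (T x y u) = T (T x y z) w u + T z (T y x w) u"
proof -
  have 1: "g (T x y z) w + g z (T y x w) = 0"
    using g_skew[of y x] by (simp add: T_def D_skew D_sym[of y x])
  have "T x y (T z w u) - T z w (T x y u) = D x y (D z w u) - D z w (D x y u)"
    by (simp add: T_def algebra_simps)
  also have "\<dots> = D (T x y z) w u + D z (T y x w) u"
    using g_skew[of y x] unfolding D_commutator by (simp add: T_def D_sym[of y x])
  also have "\<dots> = T (T x y z) w u + T z (T y x w) u +
      ((g (T x y z) w + g z (T y x w)) / 2) *s u"
    unfolding T_def[of "T x y z" w] T_def[of z "T y x w"]
    by (simp add: algebra_simps add_divide_distrib)
  finally show ?thesis by (simp add: 1)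
qed

lemma T_swap: "T x y z - T z y x = g x z *s y"
proof (rule eqI)
  fix w
  have "2 * g (T x y z - T z y x) w = 2 * g (g x z *s y) w"
    using g_skew[of z x] g_skew[of z y] g_skew[of x y] q4_sym[of x y z w] q4_sym[of y z x w]
       q4_sym[of z y x w]
    by (simp add: T_def g_D field_simps)
  then show "g (T x y z - T z y x) w = g (g x z *s y) w" by (rule cancel_two)
qed

end


section \<open>Triple systems with a base point and the similitude J\<close>

locale pointed_freudenthal_triple_system = freudenthal_triple_system scale g t
  for scale :: "'k::field \<Rightarrow> 'x::ab_group_add \<Rightarrow> 'x" (infixr \<open>*s\<close> 75) and g t +
  fixes e :: 'x
  assumes e_nondegenerate: "g e (t e e e) \<noteq> 0"
begin

text \<open>The constants here and in \<open>s\<close> are normalized so that in the algebra below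
  \<open>s\<close> squares to \<open>\<mu>\<close> times the unit \<open>e\<close>, and the
  conjugate norm of \<open>e\<close> is 1.\<close>

definition \<mu> :: 'k where "\<mu> = g e (t e e e) / 12"

definition s :: 'x where "s = (- 1 / 6) *s t e e e"

text \<open>
  \<open>J\<close> will be the left multiplication by the skew element \<open>s\<close>. Over \<open>K(\<surd>\<mu>)\<close> the derivation \<open>D e e\<close>
  has eigenvalues \<open>\<plusminus>3\<surd>\<mu>\<close> on the span of \<open>e\<close> and \<open>s\<close>, and \<open>\<plusminus>\<surd>\<mu>\<close> on its orthogonal complement \<open>M\<close>;
  \<open>J\<close> is \<open>D e e\<close> on \<open>M\<close> and \<open>- 1 / 3\<close> times \<open>D e e\<close> on the span. Thus \<open>J / \<surd>\<mu>\<close> is \<open>1\<close> or \<open>- 1\<close>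
  according to the degree modulo \<open>4\<close> in the grading of \<open>t\<close> by the eigenvalues \<open>- 3, - 1, 1, 3\<close>
  of \<open>D e e / \<surd>\<mu>\<close>, which is why \<open>J\<close> is a similitude of \<open>t\<close>.
\<close>

definition J :: "'x \<Rightarrow> 'x" where
  "J x = D e e x - (2 / \<mu> * g x s) *s s - (2 * g e x) *s e"

definition M :: "'x set" where "M = {m. g e m = 0 \<and> g s m = 0}"

lemma mu_nonzero [simp]: "\<mu> \<noteq> 0"
  using e_nondegenerate by (simp add: \<mu>_def)

lemma g_e_s [simp]: "g e s = - 2 * \<mu>" "g s e = 2 * \<mu>"
proof -
  show "g e s = - 2 * \<mu>" by (simp add: s_def \<mu>_def)
  then show "g s e = 2 * \<mu>" by (simp add: g_skew[of s e])
qed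

lemma t_e_e_e: "t e e e = - 6 *s s"
  by (simp add: s_def)

text \<open>This is \<open>triple\<close> at the base point, divided by -6. In terms of
  \<open>D\<close> it says that \<open>D e s\<close> vanishes.\<close>

lemma t_e_s: "t e s y = - (g s y *s e) - g e y *s s"
  unfolding s_def t_right triple by (simp add: algebra_simps)

lemma D_e_s [simp]: "D e s y = 0"
  unfolding D_def t_e_s by (simp add: algebra_simps)

lemma D_e_e_e: "D e e e = - 3 *s s" and D_e_e_s: "D e e s = - (3 * \<mu>) *s e"
proof -
  show "D e e e = - 3 *s s" by (simp add: D_def t_e_e_e)
  have "t e e s = - (2 * \<mu>) *s e" using t_sym(2)[of e s e] by (simp add: t_e_s)
  then show "D e e s = - (3 * \<mu>) *s e"
    by (simp add: D_def scale_left_distrib[symmetric] flip: scale_minus_left)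
qed

lemma J_linear [simp]:
  "J (x + y) = J x + J y" "J (c *s x) = c *s J x" "J (- x) = - J x" "J (x - y) = J x - J y"
  by (simp_all add: J_def algebra_simps)

lemma J_e [simp]: "J e = s" and J_s [simp]: "J s = \<mu> *s e"
  by (simp_all add: J_def D_e_e_e D_e_e_s flip: scale_minus_left scale_left_distrib
      scale_left_diff_distrib)

lemma J_M: "m \<in> M \<Longrightarrow> D e e m = J m"
  by (simp add: J_def M_def g_skew[of m])

lemma M_iff: "m \<in> M \<longleftrightarrow> g e m = 0 \<and> g s m = 0 \<and> g m e = 0 \<and> g m s = 0"
  by (auto simp: M_def g_skew[of m])

lemma g_J: "g (J x) y = - g x (J y)"
  by (simp add: J_def D_skew g_skew[of s y] g_skew[of x e] field_simps)

lemma J_in_M [simp]: "m \<in> M \<Longrightarrow> J m \<in> M"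
proof -
  assume m: "m \<in> M"
  have "g (J m) e = 0" "g (J m) s = 0"
    using m by (simp_all add: M_iff g_J)
  then show ?thesis by (simp add: M_def g_skew[of _ "J m"])
qed

lemma decomposition:
  obtains a b m where "x = a *s e + b *s s + m" "m \<in> M"
proof
  define a where "a = - g x s / (2 * \<mu>)"
  define b where "b = - g e x / (2 * \<mu>)"
  show "x = a *s e + b *s s + (x - a *s e - b *s s)" by simp
  show "x - a *s e - b *s s \<in> M"
    by (simp add: M_def a_def b_def g_skew[of s x])
qed

text \<open>Identities that are linear in a variable are checked on \<open>e\<close>,
  \<open>s\<close> and \<open>M\<close> from here on.\<close>

lemma EM_induct [case_names e s M add scale]:
  assumes "P e" "P s" "\<And>m. m \<in> M \<Longrightarrow> P m" "\<And>x y. P x \<Longrightarrow> P y \<Longrightarrow> P (x + y)"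
    "\<And>c x. P x \<Longrightarrow> P (c *s x)"
  shows "P x"
proof -
  obtain a b m where x: "x = a *s e + b *s s + m" and "m \<in> M"
    by (rule decomposition)
  show ?thesis unfolding x by (intro assms) fact
qed

lemma t_e_e_M: "m \<in> M \<Longrightarrow> t e e m = 2 *s J m"
  by (simp add: J_M[symmetric] D_def M_def)

text \<open>On \<open>M\<close> this is \<open>triple_31\<close> with \<open>y = z = e\<close> and
  \<open>x = m\<close>: the first defect contributes \<open>- 12 * \<mu> * g m w\<close>, and each
  of the other three contributes \<open>4 * g (J (J m)) w\<close>.\<close>

lemma J_J [simp]: "J (J x) = \<mu> *s x"
proof (induction x rule: EM_induct)
  case (M m)
  show ?case
  proof (rule eqI)
    fix w
    have "t e (t e e e) m = 0"
      using M by (simp add: t_e_e_e t_e_s M_iff)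
    then have "q4 m (t e e e) e w = 0"
      by (metis q4_def q4_sym g_diff(1))
    moreover have "q4 e (t m e e) e w = 4 * g (J (J m)) w"
      using t_e_e_M[OF M] t_e_e_M[OF J_in_M[OF M]] t_sym(2)[of e m e] t_sym(1)[of m e e]
        t_sym(2)[of e "J m" e] by (simp add: q4_def)
    moreover have "g (t m e e) e = 0"
      using t_e_e_M[OF M] t_sym(2)[of e m e] t_sym(1)[of m e e] J_in_M[OF M] by (simp add: M_iff)
    moreover have "g (t e e e) e = - 12 * \<mu>"
      by (simp add: t_e_e_e)
    ultimately have "12 * g (J (J m)) w = 12 * g (\<mu> *s m) w"
      using triple_31[of e w m e] M by (simp add: defect_def M_iff)
    then show "g (J (J m)) w = g (\<mu> *s m) w"
      by (rule mult_left_cancel[OF numeral_nonzero(6), THEN iffD1])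
  qed
next
  case (add x y)
  then show ?case by (simp add: scale_right_distrib)
next
  case (scale c x)
  then show ?case by (simp add: mult.commute)
qed simp_all

lemma g_J_J: "g (J x) (J y) = - \<mu> * g x y"
  by (simp add: g_J)

lemma D_invariant:
  "q4 (D x y z) w u v + q4 z (D x y w) u v + q4 z w (D x y u) v + q4 z w u (D x y v) = 0"
proof -
  have "q4 z w u (D x y v) = - g (D x y (t z w u)) v"
    by (simp add: q4_def D_skew)
  then show ?thesis by (simp add: q4_def D_derivation)
qed

text \<open>The derivation \<open>D e e\<close> is applied to \<open>t e s s\<close>, which is
  already known to be a multiple of \<open>s\<close>; only the term with \<open>t s s s\<close> is
  new.\<close>

lemma t_s_s_s: "t s s s = (6 * \<mu>\<^sup>2) *s e"
proof (rule eqI)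
  fix w
  have 1: "t e s s = (2 * \<mu>) *s s" by (simp add: t_e_s)
  have 2: "t e e s = - (2 * \<mu>) *s e" using t_sym(2)[of e s e] by (simp add: t_e_s)
  have "D e e (t e s s) = t (D e e e) s s + t e (D e e s) s + t e s (D e e s)"
    by (rule D_derivation)
  then have "(2 * \<mu>) *s (- (3 * \<mu>) *s e) =
      - 3 *s t s s s + - (3 * \<mu>) *s (- (2 * \<mu>) *s e) + - (3 * \<mu>) *s (- (2 * \<mu>) *s e)"
    unfolding 1 D_linear D_e_e_e D_e_e_s t_scale t_right 2 t_sym(2)[of e s e] .
  then have "g ((2 * \<mu>) *s (- (3 * \<mu>) *s e)) w =
      g (- 3 *s t s s s + - (3 * \<mu>) *s (- (2 * \<mu>) *s e) + - (3 * \<mu>) *s (- (2 * \<mu>) *s e)) w"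
    by simp
  then have "3 * g (t s s s) w = 3 * (6 * \<mu>\<^sup>2 * g e w)"
    unfolding g_add g_scale by algebra
  then have "g (t s s s) w = 6 * \<mu>\<^sup>2 * g e w"
    by (rule mult_left_cancel[OF numeral_nonzero(2), THEN iffD1])
  then show "g (t s s s) w = g ((6 * \<mu>\<^sup>2) *s e) w" by simp
qed

lemma q4_e_e_M_M: "m \<in> M \<Longrightarrow> q4 e e m m' = 2 * g (J m) m'"
  by (simp add: q4_def t_e_e_M)

lemma q4_e_s_M: "m \<in> M \<Longrightarrow> q4 e s x m = 0"
  by (simp add: q4_def t_e_s M_iff)

text \<open>Invariance under \<open>D e e\<close> is applied to \<open>q4 e s m m'\<close>. The
  terms that keep both \<open>e\<close> and \<open>s\<close> vanish, which ties
  \<open>q4 s s\<close> to \<open>q4 e e\<close> on \<open>M\<close>.\<close>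

lemma q4_s_s_M_M: "m \<in> M \<Longrightarrow> m' \<in> M \<Longrightarrow> q4 s s m m' = - 2 * \<mu> * g (J m) m'"
proof -
  assume M: "m \<in> M" "m' \<in> M"
  have "- 3 * q4 s s m m' - 3 * \<mu> * q4 e e m m' + q4 e s (J m) m' + q4 e s m (J m') = 0"
    using D_invariant[of e e e s m m'] M by (simp add: D_e_e_e D_e_e_s J_M)
  then have "3 * q4 s s m m' = 3 * (- 2 * \<mu> * g (J m) m')"
    using M by (simp add: q4_e_s_M q4_e_e_M_M) algebra
  then show ?thesis
    by (rule mult_left_cancel[OF numeral_nonzero(2), THEN iffD1])
qed

lemma invariant_e_M: "a \<in> M \<Longrightarrow> b \<in> M \<Longrightarrow> c \<in> M \<Longrightarrow>
  q4 e (J a) b c + q4 e a (J b) c + q4 e a b (J c) = 3 * q4 s a b c"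
  using D_invariant[of e e e a b c] by (simp add: D_e_e_e J_M) algebra

lemma invariant_s_M: "a \<in> M \<Longrightarrow> b \<in> M \<Longrightarrow> c \<in> M \<Longrightarrow>
  q4 s (J a) b c + q4 s a (J b) c + q4 s a b (J c) = 3 * \<mu> * q4 e a b c"
  using D_invariant[of e e s a b c] by (simp add: D_e_e_s J_M) algebra

lemma invariant_M: "a \<in> M \<Longrightarrow> b \<in> M \<Longrightarrow> c \<in> M \<Longrightarrow> d \<in> M \<Longrightarrow>
  q4 (J a) b c d + q4 a (J b) c d + q4 a b (J c) d + q4 a b c (J d) = 0"
  using D_invariant[of e e a b c d] by (simp add: J_M)

text \<open>Let S be the sum of the three operations "apply \<open>J\<close> in one slot" on
  \<open>q4 e a b c\<close>. By \<open>invariant_e_M\<close> and \<open>invariant_s_M\<close>,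
  applying S twice multiplies by \<open>9 * \<mu>\<close>; the squares contribute
  \<open>3 * \<mu>\<close>, and the rest is twice the left-hand side.\<close>

lemma q4_e_J_sum:
  assumes M: "a \<in> M" "b \<in> M" "c \<in> M"
  shows "q4 e (J a) (J b) c + q4 e (J a) b (J c) + q4 e a (J b) (J c) = 3 * \<mu> * q4 e a b c"
proof -
  have "2 * (q4 e (J a) (J b) c + q4 e (J a) b (J c) + q4 e a (J b) (J c)) = 2 * (3 * \<mu> * q4 e a b c)"
    using invariant_s_M[OF M] invariant_e_M[of "J a" b c] invariant_e_M[of a "J b" c]
      invariant_e_M[of a b "J c"] M by simp algebra
  then show ?thesis by (rule cancel_two)
qed

text \<open>\<open>q4_e_J_sum\<close> is used at \<open>(a, b, c)\<close> and at
  \<open>(J a, J b, c)\<close>; eliminating the two other pair terms leaves 4 times the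
  claim.\<close>

lemma q4_e_J_J:
  assumes M: "a \<in> M" "b \<in> M" "c \<in> M"
  shows "q4 e (J a) (J b) c = \<mu> * q4 e a b c"
proof -
  have "\<mu> * (\<mu> * q4 e a b c) + \<mu> * q4 e a (J b) (J c) + \<mu> * q4 e (J a) b (J c)
      = 3 * \<mu> * q4 e (J a) (J b) c"
    using q4_e_J_sum[of "J a" "J b" c] M by simp
  then have "\<mu> * (4 * q4 e (J a) (J b) c) = \<mu> * (4 * (\<mu> * q4 e a b c))"
    using q4_e_J_sum[OF M] by algebra
  then show ?thesis by simp
qed

text \<open>By \<open>q4_e_J_J\<close> it does not matter in which slot \<open>J\<close> stands, so
  the left-hand side of \<open>invariant_e_M\<close> consists of three equal terms.\<close>

lemma q4_s_M:
  assumes M: "a \<in> M" "b \<in> M" "c \<in> M"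
  shows "q4 s a b c = q4 e (J a) b c"
proof -
  have *: "q4 e (J a) b c = q4 e a (J b) c" if "a \<in> M" "b \<in> M" "c \<in> M" for a b c
    using q4_e_J_J[of a "J b" c] that by simp
  have "3 * q4 s a b c = 3 * q4 e (J a) b c"
    using invariant_e_M[OF M] *[OF M] *[of a c b] M q4_sym(3)[of e a b "J c"]
      q4_sym(3)[of e "J a" b c] by simp
  then show ?thesis
    by (rule mult_left_cancel[OF numeral_nonzero(2), THEN iffD1])
qed

text \<open>Adding \<open>invariant_M\<close> with an extra \<open>J\<close> in slot a, b and c and
  subtracting it with the extra \<open>J\<close> in slot d gives \<open>pairs\<close>. Using
  \<open>pairs\<close> with \<open>J a\<close> for \<open>a\<close>, three factors \<open>J\<close>
  on the first slots are exchanged for one on the last; putting \<open>J d\<close> there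
  finishes.\<close>

lemma q4_J_M:
  assumes M: "a \<in> M" "b \<in> M" "c \<in> M" "d \<in> M"
  shows "q4 (J a) (J b) (J c) (J d) = \<mu>\<^sup>2 * q4 a b c d"
proof -
  have pairs: "q4 (J a) (J b) c d + q4 (J a) b (J c) d + q4 a (J b) (J c) d = - \<mu> * q4 a b c d"
    if "a \<in> M" "b \<in> M" "c \<in> M" "d \<in> M" for a b c d
  proof -
    have "2 * (q4 (J a) (J b) c d + q4 (J a) b (J c) d + q4 a (J b) (J c) d)
        = 2 * (- \<mu> * q4 a b c d)"
      using invariant_M[of "J a" b c d] invariant_M[of a "J b" c d]
        invariant_M[of a b "J c" d] invariant_M[of a b c "J d"] that by simp algebra
    then show ?thesis by (rule cancel_two)
  qed
  have "q4 (J a) (J b) (J c) d = \<mu> * q4 a b c (J d)" if "a \<in> M" "b \<in> M" "c \<in> M" "d \<in> M" for a b c d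
    using pairs[of "J a" b c d] invariant_M[of a b c d] that by simp algebra
  from this[of a b c "J d"] M show ?thesis by (simp add: power2_eq_square)
qed

text \<open>In coordinates \<open>J\<close> sends \<open>(a, b, m)\<close> to
  \<open>(\<mu> * b, a, J m)\<close>, so it multiplies \<open>a\<^sup>2 - \<mu> * b\<^sup>2\<close>
  by \<open>- \<mu>\<close> and exchanges the two terms that are cubic in \<open>m\<close>. Each
  part of the quartic form, ordered by degree in \<open>m\<close>, is thus multiplied by
  \<open>\<mu>\<^sup>2\<close>.\<close>

lemma q4_J_diagonal: "q4 (J x) (J x) (J x) (J x) = \<mu>\<^sup>2 * q4 x x x x"
proof -
  obtain a b m where x: "x = a *s e + b *s s + m" and m [simp]: "m \<in> M"
    by (rule decomposition)
  have split: "q4 (a *s e + b *s s + m) (a *s e + b *s s + m) (a *s e + b *s s + m) (a *s e + b *s s + m)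
     = - 12 * \<mu> * (a\<^sup>2 - \<mu> * b\<^sup>2)\<^sup>2 + 12 * (a\<^sup>2 - \<mu> * b\<^sup>2) * g (J m) m
       + 4 * (a * q4 e m m m + b * q4 s m m m) + q4 m m m m" if [simp]: "m \<in> M" for a b m
  proof -
    define y where "y = a *s e + b *s s"
    have 4: "q4 y y y y = - 12 * \<mu> * (a\<^sup>2 - \<mu> * b\<^sup>2)\<^sup>2"
    proof -
      have v: "q4 e e e e = - 12 * \<mu>" "q4 e e e s = 0" "q4 e e s s = 4 * \<mu>\<^sup>2" "q4 e s s s = 0"
        "q4 s s s s = - 12 * \<mu> ^ 3"
      proof -
        show "q4 e e e e = - 12 * \<mu>" "q4 e e e s = 0" by (simp_all add: q4_def t_e_e_e)
        have "q4 e s e s = 4 * \<mu>\<^sup>2" "q4 e s s s = 0"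
          by (simp_all add: q4_def t_e_s power2_eq_square)
        then show "q4 e e s s = 4 * \<mu>\<^sup>2" "q4 e s s s = 0" by (simp_all add: q4_sym(2)[of e s e])
        show "q4 s s s s = - 12 * \<mu> ^ 3"
          by (simp add: q4_def t_s_s_s power2_eq_square power3_eq_cube)
      qed
      have "q4 y y y y = a ^ 4 * q4 e e e e + 4 * a ^ 3 * b * q4 e e e s + 6 * a\<^sup>2 * b\<^sup>2 * q4 e e s s
         + 4 * a * b ^ 3 * q4 e s s s + b ^ 4 * q4 s s s s"
        unfolding y_def q4_linear q4_sym(1)[of s e] q4_sym(2)[of _ s e] q4_sym(3)[of _ _ s e]
        by (simp add: algebra_simps power2_eq_square power3_eq_cube power4_eq_xxxx)
      also have "\<dots> = - 12 * \<mu> * (a\<^sup>2 - \<mu> * b\<^sup>2)\<^sup>2"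
        unfolding v by (simp add: algebra_simps power2_eq_square power3_eq_cube power4_eq_xxxx)
      finally show ?thesis .
    qed
    have 3: "q4 y y y m = 0"
    proof -
      have "q4 e e e m = 0" "q4 s s s m = 0"
        using \<open>m \<in> M\<close> by (simp_all add: q4_def t_e_e_e t_s_s_s M_iff)
      then show ?thesis
        unfolding y_def q4_linear q4_sym(1)[of s e] q4_sym(2)[of _ s e]
        by (simp add: q4_e_s_M q4_sym(2)[of e e s])
    qed
    have 2: "q4 y y m m = 2 * (a\<^sup>2 - \<mu> * b\<^sup>2) * g (J m) m"
      unfolding y_def q4_linear q4_sym(1)[of s e]
      by (simp add: q4_e_s_M q4_e_e_M_M q4_s_s_M_M algebra_simps power2_eq_square)
    have 1: "q4 y m m m = a * q4 e m m m + b * q4 s m m m"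
      by (simp add: y_def)
    have "q4 (y + m) (y + m) (y + m) (y + m) =
        q4 y y y y + 4 * q4 y y y m + 6 * q4 y y m m + 4 * q4 y m m m + q4 m m m m"
      unfolding q4_linear q4_sym(1)[of m y] q4_sym(2)[of _ m y] q4_sym(3)[of _ _ m y]
      by (simp add: algebra_simps)
    also have "\<dots> = - 12 * \<mu> * (a\<^sup>2 - \<mu> * b\<^sup>2)\<^sup>2 + 12 * (a\<^sup>2 - \<mu> * b\<^sup>2) * g (J m) m
       + 4 * (a * q4 e m m m + b * q4 s m m m) + q4 m m m m"
      unfolding 4 3 2 1 by simp
    finally show ?thesis unfolding y_def .
  qed
  have J: "J x = (\<mu> * b) *s e + a *s s + J m"
    by (simp add: x algebra_simps)
  have "q4 e m m (J m) = q4 e (J m) m m" "q4 e m (J m) (J m) = q4 e (J m) (J m) m"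
    by (metis q4_sym)+
  then have e: "q4 e (J m) (J m) (J m) = \<mu> * q4 s m m m"
      "q4 s (J m) (J m) (J m) = \<mu>\<^sup>2 * q4 e m m m"
    by (simp_all add: q4_e_J_J[of m m "J m"] q4_s_M q4_e_J_J[of m m m] power2_eq_square)
  show ?thesis
    unfolding J split[OF J_in_M[OF m]] unfolding x split[OF m] e
    by (simp add: q4_J_M g_J[of m] algebra_simps power2_eq_square)
qed

text \<open>Here \<open>B\<close> is symmetric in all arguments, so
  \<open>quartic_polarization\<close> reduces to \<open>4 * B x z z z = 0\<close>, and the cubic
  form \<open>B x\<close> can be polarized in turn.\<close>

lemma q4_J: "q4 (J x) (J y) (J z) (J w) = \<mu>\<^sup>2 * q4 x y z w"
proof -
  define B where "B x y z w = q4 (J x) (J y) (J z) (J w) - \<mu>\<^sup>2 * q4 x y z w" for x y z w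
  have add: "B (a + a') b c d = B a b c d + B a' b c d"
    "B a (b + b') c d = B a b c d + B a b' c d" for a a' b b' c d
    by (simp_all add: B_def algebra_simps)
  have sym: "B a b c d = B b a c d" "B a b c d = B a c b d" "B a b c d = B a b d c" for a b c d
    unfolding B_def
    by (simp only: q4_sym(1)[of a b c d] q4_sym(1)[of "J a" "J b" "J c" "J d"],
        simp only: q4_sym(2)[of a b c d] q4_sym(2)[of "J a" "J b" "J c" "J d"],
        simp only: q4_sym(3)[of a b c d] q4_sym(3)[of "J a" "J b" "J c" "J d"])
  have 1: "B x z z z + 3 * B z x z z = 0" for x z
    by (rule quartic_polarization[OF two three add sym(2,3)]) (simp add: B_def q4_J_diagonal)
  have "4 * B x z z z = 0" for x z
    using 1[of x z] sym(1)[of z x z z] by simp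
  then have "B x z z z = 0" for x z
    by (simp only: mult_eq_0_iff) simp
  then have "B x y z w = 0"
    by (rule cubic_polarization[of "B x", OF two three add(2) sym(2,3)])
  then show ?thesis by (simp add: B_def)
qed

lemma g_T: "g (T x y z) w = (q4 x y z w + g x z * g y w + g y z * g x w - g x y * g z w) / 2"
  by (simp add: T_def g_D diff_divide_distrib)

text \<open>\<open>J\<close> multiplies \<open>g\<close> by \<open>- \<mu>\<close> and
  \<open>q4\<close> by \<open>\<mu>\<^sup>2\<close>, hence every summand of \<open>g_T\<close> by
  \<open>\<mu>\<^sup>2\<close>; one factor \<open>- \<mu>\<close> is absorbed when \<open>J\<close>
  is moved out of \<open>g\<close>.\<close>

lemma T_J: "T (J x) (J y) (J z) = - \<mu> *s J (T x y z)"
proof (rule eqI)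
  fix w
  define v where "v = (1 / \<mu>) *s J w"
  have w: "w = J v" by (simp add: v_def)
  have "g (T (J x) (J y) (J z)) (J v) = \<mu>\<^sup>2 * g (T x y z) v"
    unfolding g_T q4_J g_J_J times_divide_eq_right
    by (rule arg_cong[of _ _ "\<lambda>a. a / 2"]) algebra
  then show "g (T (J x) (J y) (J z)) w = g (- \<mu> *s J (T x y z)) w"
    by (simp add: w g_J_J power2_eq_square)
qed

end


section \<open>The structurable algebra of a pointed Freudenthal triple system\<close>

context pointed_freudenthal_triple_system
begin

lemma D_zero [simp]: "D x y 0 = 0"
  using D_linear(6)[of x y 0 0] by simp

lemma double: "x + x = 2 *s x"
  using scale_left_distrib[of 1 1 x] by simp

text \<open>As \<open>g e s\<close> is \<open>- 2 * \<mu>\<close>, this is the reflection that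
  negates \<open>s\<close> and fixes \<open>e\<close> and \<open>M\<close>.\<close>

definition bar :: "'x \<Rightarrow> 'x" where
  "bar x = x + (g e x / \<mu>) *s s"

text \<open>
  The product is forced: \<open>V\<^bsub>x,1\<^esub> z = x z\<close> for hermitian \<open>x\<close>, where \<open>V\<^bsub>x,1\<^esub> = T x s / \<mu>\<close>; the second
  summand corrects the contribution of the skew part \<open>- (g e x / (2 * \<mu>)) *s s\<close> of \<open>x\<close>.
\<close>

definition mul :: "'x \<Rightarrow> 'x \<Rightarrow> 'x" where
  "mul x z = (1 / \<mu>) *s T x s z - (g e x / (2 * \<mu>)) *s (J z + D e e z)"

definition Jinv :: "'x \<Rightarrow> 'x" where
  "Jinv x = (1 / \<mu>) *s J x"

lemma bar_linear [simp]:
  "bar (x + y) = bar x + bar y" "bar (c *s x) = c *s bar x" "bar (- x) = - bar x"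
  "bar (x - y) = bar x - bar y"
  by (simp_all add: bar_def algebra_simps add_divide_distrib diff_divide_distrib)

lemma mul_linear [simp]:
  "mul (x + y) z = mul x z + mul y z" "mul (c *s x) z = c *s mul x z" "mul (- x) z = - mul x z"
  "mul (x - y) z = mul x z - mul y z"
  "mul z (x + y) = mul z x + mul z y" "mul z (c *s x) = c *s mul z x" "mul z (- x) = - mul z x"
  "mul z (x - y) = mul z x - mul z y"
  by (simp_all add: mul_def algebra_simps add_divide_distrib diff_divide_distrib)

lemma Jinv_linear [simp]:
  "Jinv (x + y) = Jinv x + Jinv y" "Jinv (c *s x) = c *s Jinv x"
  by (simp_all add: Jinv_def algebra_simps)

lemma Jinv_simps [simp]: "Jinv (J x) = x" "J (Jinv x) = x" "Jinv s = e" "Jinv e = (1 / \<mu>) *s s"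
  by (simp_all add: Jinv_def)

lemma bar_simps [simp]: "bar e = e" "bar s = - s" "m \<in> M \<Longrightarrow> bar m = m" "bar (bar x) = x"
proof -
  have "bar s = s + - 2 *s s" by (simp add: bar_def)
  then show "bar s = - s" by (metis add_diff_cancel_left' scale_minus_left scale_left_distrib
        one_add_one scale_one minus_add_distrib add_uminus_conv_diff diff_add_cancel)
  show "bar (bar x) = x"
    by (simp add: bar_def algebra_simps)
qed (simp_all add: bar_def M_def)

text \<open>Since \<open>D e s\<close> vanishes, so does its commutator with \<open>D e m\<close>,
  which by \<open>D_commutator\<close> is \<open>D (J m) s\<close> minus \<open>\<mu>\<close> times
  \<open>D e m\<close>. The claim follows with \<open>J m\<close> in place of
  \<open>m\<close>.\<close>

lemma D_M_s: "m \<in> M \<Longrightarrow> D m s z = D e (J m) z"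
proof -
  have *: "D (J m) s z = \<mu> *s D e m z" if "m \<in> M" for m
  proof -
    have "t e m e = 2 *s J m" "t e m s = 0"
      using that t_e_e_M t_sym(2)[of e m] by (simp_all add: t_e_s M_iff)
    then have "D e m e = J m" "D e m s = - \<mu> *s m"
      using that by (simp_all add: D_def M_iff)
    then show ?thesis
      using D_commutator[of e m e s z] by simp
  qed
  assume "m \<in> M"
  from *[OF J_in_M[OF this]] have "\<mu> *s D m s z = \<mu> *s D e (J m) z" by simp
  then show ?thesis by simp
qed

lemma D_e_M_s: "m \<in> M \<Longrightarrow> D e m s = - \<mu> *s m"
  using t_sym(2)[of e m s] by (simp add: D_def M_iff t_e_s)

text \<open>The commutator of \<open>D e e\<close> with the vanishing operator \<open>D e s\<close>
  is -3 times the difference of the two sides.\<close>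

lemma D_s_s: "D s s z = - \<mu> *s D e e z"
proof -
  have "3 *s D s s z = 3 *s (- \<mu> *s D e e z)"
    using D_commutator[of e e e s z] by (simp add: D_e_e_e D_e_e_s algebra_simps eq_neg_iff_add_eq_0)
  then show ?thesis by (simp only: scale_cancel_left) simp
qed

lemma mul_e [simp]: "mul e z = z"
  by (simp add: mul_def T_def)

lemma mul_s [simp]: "mul s z = J z"
  by (simp add: mul_def T_def D_s_s)

lemma mul_M: "m \<in> M \<Longrightarrow> mul m z = (1 / \<mu>) *s D e (J m) z"
  by (simp add: mul_def T_def M_iff D_M_s)

lemma mul_M_T: "m \<in> M \<Longrightarrow> \<mu> *s mul m z = T m s z"
  by (simp add: mul_def M_iff)

lemma mul_J_M: "m \<in> M \<Longrightarrow> mul (J m) z = D e m z"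
  by (simp add: mul_M)

lemma mul_M_s: "m \<in> M \<Longrightarrow> mul m s = - J m"
  by (simp add: mul_M D_e_M_s)

lemma mul_e_right [simp]: "mul x e = x"
proof (induction x rule: EM_induct)
  case (M m)
  have "t e (J m) e = (2 * \<mu>) *s m"
    using M t_e_e_M[of "J m"] t_sym(2)[of e "J m" e] by simp
  then have "D e (J m) e = \<mu> *s m"
    using J_in_M[OF M] by (simp add: D_def M_iff)
  then show ?case using M by (simp add: mul_M)
qed simp_all

lemma mul_s_right: "2 *s mul z s = - (J z + D e e z)"
proof (induction z rule: EM_induct)
  case e
  show ?case by (rule eqI) (simp add: D_e_e_e)
next
  case s
  show ?case by (rule eqI) (simp add: D_e_e_s)
next
  case (M m)
  then show ?case by (simp add: mul_M_s J_M double)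
next
  case (add x y)
  then show ?case by (simp add: scale_right_distrib)
next
  case (scale c x)
  have "2 *s mul (c *s x) s = c *s (2 *s mul x s)"
    by (simp add: mult.commute)
  then show ?case unfolding scale by (simp add: scale_right_distrib scale_right_diff_distrib)
qed

lemma g_mul_s_right: "2 * g (mul z s) w = - (g (J z) w + g (D e e z) w)"
  using arg_cong[OF mul_s_right, of "\<lambda>x. g x w"] by simp

lemma mul_swap_M: "m \<in> M \<Longrightarrow> m' \<in> M \<Longrightarrow> mul m m' = mul m' m + (g m m' / \<mu>) *s s"
proof -
  assume M: "m \<in> M" "m' \<in> M"
  have "\<mu> *s mul m m' = \<mu> *s (mul m' m + (g m m' / \<mu>) *s s)"
    using T_swap[of m s m'] M by (simp add: mul_M_T scale_right_distrib algebra_simps)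
  then show ?thesis by simp
qed

lemma g_mul_M: "m \<in> M \<Longrightarrow> g (mul m x) y = - g x (mul m y)"
  by (simp add: mul_M D_skew)

lemma g_e_mul_M: "m \<in> M \<Longrightarrow> g e (mul m x) = - g m x"
  using g_mul_M[of m e x] by simp

text \<open>On \<open>M\<close> the two products in opposite order differ by a multiple of
  \<open>s\<close> (\<open>mul_swap_M\<close>), and by \<open>g_e_mul_M\<close> this is exactly what
  \<open>bar\<close> removes.\<close>

lemma bar_mul: "bar (mul x y) = mul (bar y) (bar x)"
proof (induction x rule: EM_induct)
  case s
  show ?case
  proof (induction y rule: EM_induct)
    case s then show ?case by simp
  next
    case (M m) then show ?case by (simp add: mul_M_s)
  qed simp_all
next
  case (M m)
  show ?case
  proof (induction y rule: EM_induct)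
    case s then show ?case using M by (simp add: mul_M_s)
  next
    case (M m')
    then show ?case
      using \<open>m \<in> M\<close> by (simp add: mul_swap_M[of m' m] bar_def[of "mul m m'"] g_e_mul_M g_skew[of m' m])
  qed (use M in simp_all)
qed simp_all

text \<open>Multiplied by \<open>s\<close> on the right, this identifies \<open>g\<close> with the
  form <x,z> that defines the conjugate norm.\<close>

lemma mul_bar_swap: "mul x (bar z) - mul z (bar x) = (g x z / \<mu>) *s s"
proof (induction x rule: EM_induct)
  case e
  show ?case
    by (simp add: bar_def)
next
  case s
  show ?case
  proof (induction z rule: EM_induct)
    case (M m) then show ?case by (simp add: mul_M_s M_iff)
  next
    case (scale c z)
    from arg_cong[OF this, of "\<lambda>x. c *s x"] show ?case by (simp add: scale_right_distrib)
  next
    case (add x y)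
    have "mul s (bar (x + y)) - mul (x + y) (bar s) =
        (mul s (bar x) - mul x (bar s)) + (mul s (bar y) - mul y (bar s))"
      by simp
    then show ?case unfolding add by (simp add: scale_left_distrib add_divide_distrib)
  qed (simp_all add: double)
next
  case (M m)
  show ?case
  proof (induction z rule: EM_induct)
    case (M m') then show ?case using \<open>m \<in> M\<close> by (simp add: mul_swap_M[of m m'])
  next
    case s then show ?case using M by (simp add: mul_M_s M_iff)
  next
    case e then show ?case using M by (simp add: M_iff)
  qed (use M in \<open>simp_all add: algebra_simps add_divide_distrib\<close>)
qed (simp_all add: algebra_simps add_divide_distrib)

text \<open>This is \<open>T_J\<close> with middle argument \<open>s\<close>: there
  \<open>J s\<close> is a multiple of \<open>e\<close>, and both \<open>T m s\<close> and
  \<open>D e (J m)\<close> are \<open>\<mu>\<close> times left multiplication by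
  \<open>m\<close>.\<close>

lemma J_mul_M: "m \<in> M \<Longrightarrow> m' \<in> M \<Longrightarrow> J (mul m m') = - mul m (J m')"
proof -
  assume M: "m \<in> M" "m' \<in> M"
  have "\<mu> *s (\<mu> *s J (mul m m')) = \<mu> *s J (\<mu> *s mul m m')" by simp
  also have "\<dots> = - T (J m) (J s) (J m')"
    unfolding mul_M_T[OF M(1)] T_J by simp
  also have "\<dots> = \<mu> *s (\<mu> *s - mul m (J m'))"
    using M by (simp add: T_def mul_M M_iff D_sym[of _ e] g_J)
  finally show ?thesis by (metis mu_nonzero scale_cancel_left)
qed

text \<open>The involution turns right multiplication by \<open>s\<close> into \<open>J\<close> up
  to sign, so this is the conjugate of \<open>J_mul_M\<close>.\<close>

lemma mul_mul_M_s: "m \<in> M \<Longrightarrow> m' \<in> M \<Longrightarrow> mul (mul m' m) s = mul (J m') m"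
proof -
  assume M: "m \<in> M" "m' \<in> M"
  have "mul (mul m' m) s = bar (bar (mul (mul m' m) s))" by simp
  also have "\<dots> = bar (- J (mul m m'))"
    using M by (simp add: bar_mul del: bar_simps(4))
  also have "\<dots> = bar (mul m (J m'))"
    using M by (simp add: J_mul_M)
  also have "\<dots> = mul (J m') m"
    using M by (simp add: bar_mul)
  finally show ?thesis .
qed

section \<open>Identification of the structurable triple product with T\<close>

definition V :: "'x \<Rightarrow> 'x \<Rightarrow> 'x \<Rightarrow> 'x" where
  "V x y z = mul (mul x (bar y)) z + mul (mul z (bar y)) x - mul (mul z (bar x)) y"

lemma V_linear [simp]:
  "V (x + x') y z = V x y z + V x' y z" "V (c *s x) y z = c *s V x y z"
  "V y (x + x') z = V y x z + V y x' z" "V y (c *s x) z = c *s V y x z"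
  "V y z (x + x') = V y z x + V y z x'" "V y z (c *s x) = c *s V y z x"
  by (simp_all add: V_def algebra_simps)

lemma V_swap: "V x y z - V z y x = (g x z / \<mu>) *s J y"
proof -
  have "V x y z - V z y x = mul (mul x (bar z) - mul z (bar x)) y"
    by (simp add: V_def algebra_simps)
  then show ?thesis by (simp add: mul_bar_swap)
qed

text \<open>Both sides change by the same amount when the outer arguments are exchanged, so each
  case of \<open>V_eq_T\<close> has to be proved in one order only.\<close>

lemma V_eq_T_swap: "V z y x = T z (Jinv y) x \<Longrightarrow> V x y z = T x (Jinv y) z"
proof -
  have "V x y z - V z y x = T x (Jinv y) z - T z (Jinv y) x"
    unfolding V_swap T_swap by (simp add: Jinv_def)
  then show "V z y x = T z (Jinv y) x \<Longrightarrow> V x y z = T x (Jinv y) z" by simp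
qed

lemma V_e: "V e y z = T e (Jinv y) z"
proof (induction y rule: EM_induct)
  case e
  show ?case by (simp add: V_def T_def)
next
  case s
  show ?case
  proof (rule eqI)
    fix w show "g (V e s z) w = g (T e (Jinv s) z) w"
      using g_mul_s_right[of z w] by (simp add: V_def T_def)
  qed
next
  case (M m)
  then have "J m \<in> M" by simp
  with M show ?case by (simp add: V_def T_def mul_M Jinv_def M_iff)
qed simp_all

lemma V_s: "V s y z = T s (Jinv y) z"
proof (induction y rule: EM_induct)
  case e
  show ?case
  proof (rule eqI)
    fix w show "g (V s e z) w = g (T s (Jinv e) z) w"
      using g_mul_s_right[of z w] by (simp add: V_def T_def D_s_s)
  qed
next
  case s
  show ?case by (simp add: V_def T_def D_sym[of s e])
next
  case (M m)
  have T: "T s (Jinv m) z = D e m z" for z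
    using M J_in_M[OF M] by (simp add: T_def Jinv_def M_iff D_sym[of s "J m"] D_M_s)
  show ?case
  proof (induction z rule: EM_induct)
    case e
    show ?case by (rule V_eq_T_swap) (rule V_e)
  next
    case s
    show ?case using M by (simp add: T V_def mul_M_s D_e_M_s)
  next
    case (M m')
    then show ?case
      using \<open>m \<in> M\<close> by (simp add: T V_def mul_M_s mul_mul_M_s mul_J_M)
  qed simp_all
qed simp_all

text \<open>\<open>Z\<close> is a commutator of left multiplications applied to \<open>c\<close>. It
  is orthogonal to \<open>e\<close>, hence equal to its conjugate, which consists of the last two
  terms of \<open>V b a c\<close>. On the other hand \<open>T_commutator\<close> for
  \<open>T a s\<close> and \<open>T b s\<close> expresses \<open>Z\<close> through
  \<open>T\<close>.\<close>

lemma V_M_M_M: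
  assumes M: "a \<in> M" "b \<in> M" "c \<in> M"
  shows "V b a c = T b (Jinv a) c"
proof -
  define Z where "Z = mul b (mul a c) - mul a (mul b c)"
  have "g e Z = 0"
    using M by (simp add: Z_def g_e_mul_M g_mul_M[symmetric])
       (simp add: mul_swap_M[of a b] M_iff flip: g_mul_M)
  then have "Z = bar Z" by (simp add: bar_def)
  also have "\<dots> = mul (mul c a) b - mul (mul c b) a"
    using M by (simp add: Z_def bar_mul)
  finally have Z: "Z = mul (mul c a) b - mul (mul c b) a" .
  have "T s a s = - \<mu> *s J a"
    using M(1) J_in_M[OF M(1)] M_iff[of a] by (simp add: T_def D_sym[of s a] D_M_s D_e_M_s)
  then have "T a s (T b s c) - T b s (T a s c) = T (T a s b) s c - \<mu> *s T b (J a) c"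
    using T_commutator[of a s b s c] by simp
  then have "\<mu> *s (\<mu> *s (mul a (mul b c) - mul b (mul a c))) =
      \<mu> *s (T (mul a b) s c - \<mu> *s T b (Jinv a) c)"
    using M by (simp add: Jinv_def scale_right_diff_distrib flip: mul_M_T)
  then have "\<mu> *s (mul a (mul b c) - mul b (mul a c)) = T (mul a b) s c - \<mu> *s T b (Jinv a) c"
    by (metis mu_nonzero scale_cancel_left)
  then have "\<mu> *s T b (Jinv a) c = T (mul a b) s c + \<mu> *s Z"
    by (simp add: Z_def algebra_simps)
  \<comment> \<open>The product \<open>mul a b\<close> need not lie in \<open>M\<close>. The second
    summand of \<open>mul\<close> gives the term with \<open>J c\<close>, which then turns
    \<open>mul a b\<close> into \<open>mul b a\<close>.\<close>
  also have "T (mul a b) s c = \<mu> *s (mul (mul a b) c + (g b a / \<mu>) *s J c)"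
    using M by (simp add: mul_def[of "mul a b"] g_e_mul_M g_skew[of b a] J_M algebra_simps
       flip: scale_left_distrib)
  also have "mul (mul a b) c + (g b a / \<mu>) *s J c = mul (mul b a) c"
    using M by (simp add: mul_swap_M[of a b] g_skew[of b a])
  finally have "T b (Jinv a) c = mul (mul b a) c + Z"
    by (simp flip: scale_right_distrib)
  then show ?thesis using M by (simp add: V_def Z)
qed

lemma V_eq_T: "V x y z = T x (Jinv y) z"
proof (induction x rule: EM_induct)
  case (M a)
  show ?case
  proof (induction z rule: EM_induct)
    case (M c)
    show ?case
    proof (induction y rule: EM_induct)
      case e
      show ?case using \<open>a \<in> M\<close> \<open>c \<in> M\<close> by (simp add: V_def mul_M_T[symmetric])
    next
      case s
      show ?case using \<open>a \<in> M\<close> \<open>c \<in> M\<close>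
        by (simp add: V_def T_def D_sym[of a e] M_iff mul_M_s mul_mul_M_s mul_J_M)
    next
      case (M b)
      then show ?case using \<open>a \<in> M\<close> \<open>c \<in> M\<close> by (simp add: V_M_M_M)
    qed simp_all
  qed (simp_all add: V_eq_T_swap V_e V_s)
qed (simp_all add: V_e V_s)

section \<open>Structurability, skew-dimension, conjugate norm and conjugate inverses\<close>

definition A :: "'x inv_alg" where
  "A = \<lparr>amul = mul, aone = e, ainv = bar\<rparr>"

lemma A_simps [simp]: "amul A = mul" "aone A = e" "ainv A = bar"
  by (simp_all add: A_def)

lemma Vop_A: "Vop A x y z = T x (Jinv y) z"
  unfolding V_eq_T[symmetric] by (simp add: Vop_def V_def)

lemma T_Jinv: "T (Jinv x) y (Jinv z) = - Jinv (T x (Jinv y) z)"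
  using T_J[of x "Jinv y" z] by (simp add: Jinv_def[of x] Jinv_def[of z] Jinv_def[of "T _ _ _"])

lemma structurable_algebra_A: "structurable_algebra (*s) A"
proof -
  have c: "CHAR('k) \<noteq> 2" "CHAR('k) \<noteq> 3"
    by (metis two three of_nat_CHAR of_nat_numeral)+
  show ?thesis
  proof
    show "Vop A x y (Vop A z w u) - Vop A z w (Vop A x y u) =
         Vop A (Vop A x y z) w u - Vop A z (Vop A y x w) u" for x y z w u
      unfolding Vop_A T_commutator T_Jinv by simp
  qed (simp_all add: c bilinear_map_def Vector_Spaces.linear_iff vector_space_axioms bar_mul)
qed

lemma skew_elements_A: "skew_elements A = span {s}"
proof
  show "skew_elements A \<subseteq> span {s}"
  proof
    fix x assume "x \<in> skew_elements A"
    then have "x + x = - ((g e x / \<mu>) *s s)"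
      by (simp add: skew_elements_def bar_def eq_neg_iff_add_eq_0 algebra_simps)
    then have "2 *s x = 2 *s ((- g e x / (2 * \<mu>)) *s s)"
      by (simp add: double)
    then have "x = (- g e x / (2 * \<mu>)) *s s"
      by (simp only: scale_cancel_left) simp
    then show "x \<in> span {s}"
      by (metis span_base span_scale singletonI)
  qed
  show "span {s} \<subseteq> skew_elements A"
    by (auto simp: skew_elements_def span_singleton)
qed

lemma skew_dimension_A: "skew_dimension (*s) A = 1"
proof -
  have "s \<noteq> 0" using g_e_s(1) by fastforce
  then have "independent {s}" by simp
  then show ?thesis by (simp add: skew_dimension_def skew_elements_A dim_eq_card_independent)
qed

text \<open>The skew element chosen in \<open>conj_norm\<close> is some nonzero multiple
  \<open>c *s s\<close>. The form and the symmetric triple product each gain a factor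
  \<open>c\<close>, and the square gains \<open>c\<^sup>2\<close>, so the choice cancels.\<close>

lemma conj_norm_A: "conj_norm (*s) A x = g x (t x x x) / (12 * \<mu>)"
proof -
  define s' where "s' = (SOME s'. s' \<in> skew_elements A \<and> s' \<noteq> 0)"
  have "s \<noteq> 0" using g_e_s(1) by fastforce
  have "e \<noteq> 0"
    using e_nondegenerate g_diff(1)[of "t e e e"] by metis
  have "s \<in> skew_elements A" by (simp add: skew_elements_def)
  with \<open>s \<noteq> 0\<close> have "s' \<in> skew_elements A \<and> s' \<noteq> 0"
    unfolding s'_def by (metis (mono_tags, lifting) someI)
  then obtain c where s': "s' = c *s s" and c: "c \<noteq> 0"
    unfolding skew_elements_A span_singleton by (metis rangeE scale_zero_left)
  have form: "skew_form (*s) A s' x y = c * g x y" for x y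
  proof -
    have "mul (mul x (bar y) - mul y (bar x)) s' = (c * g x y) *s e"
      unfolding mul_bar_swap s' by simp
    then show ?thesis
      unfolding skew_form_def A_simps using \<open>e \<noteq> 0\<close> by simp
  qed
  have square: "skew_square (*s) A s' = c\<^sup>2 * \<mu>"
  proof -
    have "mul s' s' = (c\<^sup>2 * \<mu>) *s e"
      unfolding s' by (simp add: power2_eq_square)
    then show ?thesis
      unfolding skew_square_def A_simps using \<open>e \<noteq> 0\<close> by simp
  qed
  have triple: "sym_triple (*s) A s' x x x = c *s t x x x"
    unfolding sym_triple_def Vop_A form A_simps unfolding s' by (simp add: T_def D_def)
  show ?thesis
    using c unfolding conj_norm_def Let_def s'_def[symmetric] form square triple
    by (simp add: power2_eq_square)
qed

text \<open>By \<open>triple\<close>, \<open>D u (t u u u)\<close> vanishes, so \<open>T u v\<close>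
  is the scalar \<open>- g u v / 2\<close>; the factor in \<open>v\<close> makes it 1. Since
  \<open>Jinv\<close> undoes the outer \<open>J\<close>, this is one half of the claim. For the
  other, \<open>T v u\<close> is -1, and \<open>T_J\<close> carries it over.\<close>

lemma is_conj_inverse_A:
  assumes "g u (t u u u) \<noteq> 0"
  shows "is_conj_inverse A u (J ((- 2 / g u (t u u u)) *s t u u u))"
proof -
  define v where "v = (- 2 / g u (t u u u)) *s t u u u"
  have "D u (t u u u) z = 0" for z
    by (simp add: D_def triple algebra_simps)
  then have D: "D u v z = 0" for z
    by (simp add: v_def)
  have g: "g u v = - 2" using assms by (simp add: v_def)
  have 1: "T u v z = z" for z
    by (simp add: T_def D g)
  have 2: "T (J v) (Jinv u) z = z" for z
  proof -
    have "T v u z = - z" for z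
      using g g_skew[of v u] by (simp add: T_def D_sym[of v u] D)
    then have "T (J v) (J ((1 / \<mu>) *s u)) (J (Jinv z)) = z"
      unfolding T_J by simp
    then show ?thesis by (simp add: Jinv_def[of u])
  qed
  show ?thesis
    unfolding v_def[symmetric] is_conj_inverse_def by (auto simp: Vop_A 1 2 fun_eq_iff)
qed

end


section \<open>The Freudenthal triple system of a quadrangular algebra\<close>

context quadrangular_algebra
begin

interpretation L: vector_space "scaleL \<Omega>" by (rule vector_space_L)
interpretation X: vector_space "scaleX \<Omega>" by (rule vector_space_X)

abbreviation scaleL' (infixr \<open>*l\<close> 75) where "c *l v \<equiv> scaleL \<Omega> c v"
abbreviation scaleX' (infixr \<open>*x\<close> 75) where "c *x a \<equiv> scaleX \<Omega> c a"
abbreviation act' (infixl \<open>\<cdot>\<close> 76) where "a \<cdot> v \<equiv> act \<Omega> a v"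
abbreviation "q \<equiv> qform \<Omega>"
abbreviation "f \<equiv> fform \<Omega>"
abbreviation "h \<equiv> hmap \<Omega>"
abbreviation "g \<equiv> gform \<Omega>"
abbreviation "\<pi> \<equiv> pi_map \<Omega>"
abbreviation "\<epsilon> \<equiv> base \<Omega>"
abbreviation "\<sigma> \<equiv> sigmaL \<Omega>"

lemma two [simp]: "(2::'k) \<noteq> 0"
proof
  assume "(2::'k) = 0"
  then have "CHAR('k) dvd 2" by (metis of_nat_eq_0_iff_char_dvd of_nat_numeral)
  then have "CHAR('k) \<le> 2" "CHAR('k) \<noteq> 0"
    by (auto dest: dvd_imp_le intro: Nat.gr0I)
  then show False using char_not_2 CHAR_not_1[where 'a = 'k] by linarith
qed

lemma four [simp]: "(4::'k) \<noteq> 0"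
proof -
  have "2 * 2 \<noteq> (0::'k)" by (simp only: mult_eq_0_iff) simp
  then show ?thesis by simp
qed

lemma act_linear [simp]:
  "(a + b) \<cdot> v = a \<cdot> v + b \<cdot> v" "(c *x a) \<cdot> v = c *x (a \<cdot> v)"
  "a \<cdot> (v + w) = a \<cdot> v + a \<cdot> w" "a \<cdot> (c *l v) = c *x (a \<cdot> v)"
  using A1 by (simp_all add: bilinear_map_def Vector_Spaces.linear_iff)

lemma h_linear [simp]:
  "h (a + b) d = h a d + h b d" "h (c *x a) d = c *l h a d"
  "h d (a + b) = h d a + h d b" "h d (c *x a) = c *l h d a"
  using B1 by (simp_all add: bilinear_map_def Vector_Spaces.linear_iff)

lemma f_linear [simp]:
  "f (u + v) w = f u w + f v w" "f (c *l u) w = c * f u w"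
  "f w (u + v) = f w u + f w v" "f w (c *l u) = c * f w u"
  using quadratic_form_q
  by (simp_all add: quadratic_form_def bilinear_map_def Vector_Spaces.linear_iff fform_def)

lemma act_diff [simp]:
  "0 \<cdot> v = 0" "(- a) \<cdot> v = - (a \<cdot> v)" "(a - b) \<cdot> v = a \<cdot> v - b \<cdot> v"
  "a \<cdot> 0 = 0" "a \<cdot> (- v) = - (a \<cdot> v)" "a \<cdot> (v - w) = a \<cdot> v - a \<cdot> w"
proof -
  interpret a: additive "\<lambda>a. a \<cdot> v" by standard simp
  interpret b: additive "\<lambda>v. a \<cdot> v" by standard simp
  show "0 \<cdot> v = 0" "(- a) \<cdot> v = - (a \<cdot> v)" "(a - b) \<cdot> v = a \<cdot> v - b \<cdot> v"
    "a \<cdot> 0 = 0" "a \<cdot> (- v) = - (a \<cdot> v)" "a \<cdot> (v - w) = a \<cdot> v - a \<cdot> w"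
    by (rule a.zero a.minus a.diff b.zero b.minus b.diff)+
qed

lemma h_diff [simp]:
  "h 0 d = 0" "h (- a) d = - h a d" "h (a - b) d = h a d - h b d"
  "h d 0 = 0" "h d (- a) = - h d a" "h d (a - b) = h d a - h d b"
proof -
  interpret a: additive "\<lambda>a. h a d" by standard simp
  interpret b: additive "\<lambda>a. h d a" by standard simp
  show "h 0 d = 0" "h (- a) d = - h a d" "h (a - b) d = h a d - h b d"
    "h d 0 = 0" "h d (- a) = - h d a" "h d (a - b) = h d a - h d b"
    by (rule a.zero a.minus a.diff b.zero b.minus b.diff)+
qed

lemma f_diff [simp]:
  "f 0 w = 0" "f (- v) w = - f v w" "f (u - v) w = f u w - f v w"
  "f w 0 = 0" "f w (- v) = - f w v" "f w (u - v) = f w u - f w v"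
proof -
  interpret a: additive "\<lambda>a. f a w" by standard simp
  interpret b: additive "\<lambda>a. f w a" by standard simp
  show "f 0 w = 0" "f (- v) w = - f v w" "f (u - v) w = f u w - f v w"
    "f w 0 = 0" "f w (- v) = - f w v" "f w (u - v) = f w u - f w v"
    by (rule a.zero a.minus a.diff b.zero b.minus b.diff)+
qed

lemma q_scale: "q (c *l v) = c\<^sup>2 * q v"
  using quadratic_form_q by (simp add: quadratic_form_def)

lemma q_zero [simp]: "q 0 = 0"
  using q_scale[of 0 0] by simp

lemma q_eq_0_iff [simp]: "q v = 0 \<longleftrightarrow> v = 0"
  using anisotropic_q by (auto simp: anisotropic_def)

lemma q_add: "q (u + v) = q u + q v + f u v"
  by (simp add: fform_def polar_def)

lemma f_sym: "f u v = f v u"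
  by (simp add: fform_def polar_def add.commute)

lemma f_self: "f v v = 2 * q v"
proof -
  have "v + v = 2 *l v" using L.scale_left_distrib[of 1 1 v] by simp
  then have "q (v + v) = 4 * q v" by (simp add: q_scale)
  then show ?thesis by (simp add: q_add)
qed

lemma f_base_base [simp]: "f \<epsilon> \<epsilon> = 2"
  by (simp add: f_self q_base)

lemma L_eqI:
  assumes "\<And>w. f u w = f v w"
  shows "u = v"
proof -
  have "2 * q (u - v) = 0"
    unfolding f_self[symmetric] by (simp only: f_diff(3) assms diff_self)
  then show ?thesis by simp
qed

lemma act_sigma: "a \<cdot> v \<cdot> \<sigma> v = q v *x a"
proof (cases "v = 0")
  case False
  then have "a = (1 / q v) *x (a \<cdot> v \<cdot> \<sigma> v)"
    using A3[of v a] by (simp add: inverseL_def)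
  then show ?thesis using False
    by (metis X.scale_scale X.scale_one nonzero_mult_div_cancel_left mult.right_neutral
        times_divide_eq_right q_eq_0_iff)
qed simp

text \<open>The Clifford relation for the action of \<open>L\<close> on \<open>X\<close>. On vectors
  orthogonal to the base point, where \<open>\<sigma>\<close> is -1, it says that the actions
  anticommute up to a scalar.\<close>

lemma act_sigma_polar: "a \<cdot> v \<cdot> \<sigma> w + a \<cdot> w \<cdot> \<sigma> v = f v w *x a"
proof -
  have s: "\<sigma> (v + w) = \<sigma> v + \<sigma> w"
    by (simp add: sigmaL_def L.scale_left_distrib)
  show ?thesis
    using act_sigma[of a "v + w"] act_sigma[of a v] act_sigma[of a w]
    by (simp add: s q_add X.scale_left_distrib add.commute)
qed

lemma act_eq_0_iff [simp]: "a \<cdot> v = 0 \<longleftrightarrow> a = 0 \<or> v = 0"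
  using A3[of v a] by fastforce

lemma act_cancel: "a \<noteq> 0 \<Longrightarrow> a \<cdot> v = a \<cdot> w \<Longrightarrow> v = w"
  using act_eq_0_iff[of a "v - w"] by simp

lemma f_h_base: "f (h a b) \<epsilon> = 2 * g a b"
  by (simp add: gform_def)

lemma h_swap: "h a b = h b a + (2 * g a b) *l \<epsilon>"
  using B2[of a b \<epsilon>] by (simp add: A2 f_h_base)

lemma g_linear:
  "g (a + b) d = g a d + g b d" "g (c *x a) d = c * g a d"
  by (simp_all add: gform_def add_divide_distrib)

lemma g_skew: "g a b = - g b a"
proof -
  have "2 * g a b = 2 * - g b a"
    using arg_cong[OF h_swap[of a b], of "\<lambda>v. f v \<epsilon>"] by (simp add: f_h_base) algebra
  then show ?thesis by (simp only: mult_cancel_left) simp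
qed

lemma g_self [simp]: "g a a = 0"
proof -
  have "2 * g a a = 0" using g_skew[of a a] by (metis add.right_inverse mult_2)
  then show ?thesis by simp
qed

lemma g_act: "2 * g (a \<cdot> v) b = f (h a b) v"
  using B3[of a v b] by (simp add: f_h_base)

lemma pi_eq: "\<pi> a = (1 / 2) *l h a a" "h a a = 2 *l \<pi> a"
  by (simp_all add: pi_map_def C A2)

lemma theta_eq: "theta \<Omega> a v = (1 / 2) *l h a (a \<cdot> v)" "h a (a \<cdot> v) = 2 *l theta \<Omega> a v"
  by (simp_all add: C)

lemma f_pi_base [simp]: "f (\<pi> a) \<epsilon> = 0" "f \<epsilon> (\<pi> a) = 0"
  by (simp_all add: pi_eq(1) f_h_base f_sym[of \<epsilon>])

lemma sigma_orthogonal: "f v \<epsilon> = 0 \<Longrightarrow> \<sigma> v = - v"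
  by (simp add: sigmaL_def f_sym[of \<epsilon>])

lemma act_pi_pi: "a \<cdot> \<pi> b \<cdot> \<pi> b = - q (\<pi> b) *x a"
  using act_sigma[of a "\<pi> b"] by (simp add: sigma_orthogonal) (metis minus_minus)

text \<open>After multiplication by \<open>a\<close> this is (D1) combined with
  \<open>act_pi_pi\<close>.\<close>

lemma theta_pi: "a \<noteq> 0 \<Longrightarrow> theta \<Omega> a (\<pi> a) = - q (\<pi> a) *l \<epsilon>"
  by (rule act_cancel[of a]) (simp_all add: D1 act_pi_pi A2)

lemma pi_nonzero: "a \<noteq> 0 \<Longrightarrow> \<pi> a \<noteq> 0"
  using D2[of a] by (metis L.scale_zero_left)

lemma g_act_pi: "g (a \<cdot> \<pi> a) a = 2 * q (\<pi> a)"
proof -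
  have "2 * g (a \<cdot> \<pi> a) a = 2 * (2 * q (\<pi> a))"
    by (simp add: g_act pi_eq(2) f_self)
  then show ?thesis by (simp only: mult_cancel_left) simp
qed

text \<open>Twice the polarization of \<open>\<pi>\<close>.\<close>

definition h_sym :: "'x \<Rightarrow> 'x \<Rightarrow> 'l" where
  "h_sym a b = h a b + h b a"

lemma h_sym_linear [simp]:
  "h_sym (a + b) d = h_sym a d + h_sym b d" "h_sym (c *x a) d = c *l h_sym a d"
  "h_sym d (a + b) = h_sym d a + h_sym d b" "h_sym d (c *x a) = c *l h_sym d a"
  by (simp_all add: h_sym_def L.scale_right_distrib)

lemma h_sym_commute: "h_sym a b = h_sym b a"
  by (simp add: h_sym_def add.commute)

lemma f_h_sym_base [simp]: "f (h_sym a b) \<epsilon> = 0"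
  using g_skew[of a b] by (simp add: h_sym_def f_h_base)

lemma h_eq_h_sym: "2 *l h a b = h_sym a b + (2 * g a b) *l \<epsilon>"
  unfolding h_sym_def using h_swap[of a b] L.scale_left_distrib[of 1 1 "h a b"]
  by (simp add: algebra_simps)

lemma g_act_h_sym: "4 * g (a \<cdot> h_sym c d) b = f (h_sym a b) (h_sym c d)"
proof -
  have "4 * g (a \<cdot> h_sym c d) b = 2 * (2 * g (a \<cdot> h_sym c d) b)" by simp
  then have "4 * g (a \<cdot> h_sym c d) b = f (2 *l h a b) (h_sym c d)"
    unfolding g_act f_linear .
  then show ?thesis by (simp add: h_eq_h_sym f_sym[of \<epsilon>])
qed

lemma g_nondegenerate:
  assumes "\<And>w. g x w = 0"
  shows "x = 0"
proof (rule ccontr)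
  assume "x \<noteq> 0"
  then have "g (x \<cdot> \<pi> x) x \<noteq> 0" by (simp add: g_act_pi pi_nonzero)
  then show False using assms[of "x \<cdot> \<pi> x"] g_skew[of x] by simp
qed

text \<open>The part of (D1) that is linear in \<open>y\<close>: \<open>F\<close> is additive in
  each slot and vanishes on the diagonal, and comparing \<open>x + y\<close> with
  \<open>x - y\<close> isolates \<open>S\<close>.\<close>

lemma D1_polar:
  "y \<cdot> h x (x \<cdot> v) + x \<cdot> h y (x \<cdot> v) + x \<cdot> h x (y \<cdot> v)
   = y \<cdot> h x x \<cdot> v + x \<cdot> h_sym x y \<cdot> v"
proof -
  define F where "F a b c = a \<cdot> h b (c \<cdot> v) - a \<cdot> h b c \<cdot> v" for a b c
  have add: "F (a + a') b c = F a b c + F a' b c" "F a (b + b') c = F a b c + F a b' c"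
    "F a b (c + c') = F a b c + F a b c'" "F (- a) b c = - F a b c" "F a (- b) c = - F a b c"
    "F a b (- c) = - F a b c" for a a' b b' c c'
    by (simp_all add: F_def)
  have zero: "F a a a = 0" for a
    using D1[of a v] by (simp add: F_def theta_eq(2) pi_eq(2))
  define S where "S = F y x x + F x y x + F x x y"
  define R where "R = F x y y + F y x y + F y y x"
  have "F (x + y) (x + y) (x + y) = F x x x + S + R + F y y y"
    unfolding add S_def R_def by (simp add: add_ac)
  moreover have "F (x + - y) (x + - y) (x + - y) = F x x x - S + R - F y y y"
    unfolding add S_def R_def by (simp add: algebra_simps)
  ultimately have "S + R = 0" "R = S"
    unfolding zero by (simp_all add: eq_neg_iff_add_eq_0)
  then have "2 *x S = 0" using X.scale_left_distrib[of 1 1 S] by simp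
  then have "S = 0" by simp
  then show ?thesis by (simp add: S_def F_def h_sym_def algebra_simps)
qed

text \<open>In \<open>D1_polar\<close> with \<open>v = \<pi> x\<close>, the two terms with
  \<open>y\<close> on the outside are both \<open>- 2 * q (\<pi> x)\<close> times \<open>y\<close>
  and cancel. The Clifford relation then moves \<open>\<pi> x\<close> in front of
  \<open>h_sym x y\<close>, (D1) turns the result into \<open>theta\<close>, and \<open>x\<close>
  can be cancelled.\<close>

lemma key_identity:
  assumes "x \<noteq> 0"
  shows "theta \<Omega> x (h_sym x y) + h_sym (x \<cdot> \<pi> x) y
     = - (2 * g (x \<cdot> \<pi> x) y) *l \<epsilon> - (2 * g x y) *l \<pi> x"
proof -
  have "h x (x \<cdot> \<pi> x) = - (2 * q (\<pi> x)) *l \<epsilon>"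
    by (simp add: theta_eq(2) theta_pi assms)
  then have "x \<cdot> (h y (x \<cdot> \<pi> x) + h x (y \<cdot> \<pi> x)) = x \<cdot> h_sym x y \<cdot> \<pi> x"
    using D1_polar[of y x "\<pi> x"] by (simp add: A2 pi_eq(2) act_pi_pi)
  also have "\<dots> = - (f (h_sym x y) (\<pi> x) *x x) - x \<cdot> \<pi> x \<cdot> h_sym x y"
  proof -
    have "- (x \<cdot> h_sym x y \<cdot> \<pi> x) - x \<cdot> \<pi> x \<cdot> h_sym x y = f (h_sym x y) (\<pi> x) *x x"
      using act_sigma_polar[of x "h_sym x y" "\<pi> x"] by (simp add: sigma_orthogonal)
    then show ?thesis by (simp flip: \<open>_ = f (h_sym x y) (\<pi> x) *x x\<close>)
  qed
  also have "x \<cdot> \<pi> x \<cdot> h_sym x y = x \<cdot> theta \<Omega> x (h_sym x y)"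
    by (simp add: D1)
  also have "- (f (h_sym x y) (\<pi> x) *x x) - x \<cdot> theta \<Omega> x (h_sym x y) =
      x \<cdot> (- f (h_sym x y) (\<pi> x) *l \<epsilon> - theta \<Omega> x (h_sym x y))"
    by (simp add: A2)
  finally have 1: "h y (x \<cdot> \<pi> x) + h x (y \<cdot> \<pi> x) = - f (h_sym x y) (\<pi> x) *l \<epsilon> - theta \<Omega> x (h_sym x y)"
    by (rule act_cancel[OF assms])
  have 2: "h x (y \<cdot> \<pi> x) = h y (x \<cdot> \<pi> x) + (2 * g x y) *l \<pi> x"
    by (simp add: B2[of x y] f_h_base)
  have 3: "f (h_sym x y) (\<pi> x) = 4 * g (x \<cdot> \<pi> x) y"
  proof -
    have "f (h_sym x y) (\<pi> x) = 2 * f (h x y) (\<pi> x)"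
      using arg_cong[OF h_eq_h_sym[of x y], of "\<lambda>v. f v (\<pi> x)"] by simp
    then show ?thesis by (simp flip: g_act)
  qed
  have 4: "h_sym (x \<cdot> \<pi> x) y = h y (x \<cdot> \<pi> x) + h y (x \<cdot> \<pi> x) + (2 * g (x \<cdot> \<pi> x) y) *l \<epsilon>"
    using h_swap[of "x \<cdot> \<pi> x" y] by (simp add: h_sym_def algebra_simps)
  show ?thesis
  proof (rule L_eqI)
    fix w
    show "f (theta \<Omega> x (h_sym x y) + h_sym (x \<cdot> \<pi> x) y) w =
        f (- (2 * g (x \<cdot> \<pi> x) y) *l \<epsilon> - (2 * g x y) *l \<pi> x) w"
      using arg_cong[OF 1, of "\<lambda>v. f v w"] unfolding 2 3 4 by simp algebra
  qed
qed

definition triple_product :: "'x \<Rightarrow> 'x \<Rightarrow> 'x \<Rightarrow> 'x" where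
  "triple_product a b c = (1 / 2) *x (a \<cdot> h_sym b c + b \<cdot> h_sym a c + c \<cdot> h_sym a b)"

lemma triple_product_diagonal: "triple_product a a a = 6 *x (a \<cdot> \<pi> a)"
proof -
  have "h_sym a a = 4 *l \<pi> a"
    using L.scale_left_distrib[of 2 2 "\<pi> a"] by (simp add: h_sym_def pi_eq(2))
  then have "triple_product a a a = (1 / 2) *x ((4 + 4 + 4) *x (a \<cdot> \<pi> a))"
    by (simp only: triple_product_def act_linear X.scale_left_distrib)
  also have "4 + 4 + 4 = 2 * (6::'k)" by simp
  finally show ?thesis by (simp del: numeral_times_numeral)
qed

text \<open>By \<open>g_act_h_sym\<close> the quartic form is, up to a factor, the sum of
  \<open>f (h_sym _ _) (h_sym _ _)\<close> over the three pairings of its arguments, which is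
  symmetric. Since \<open>h_sym (x \<cdot> \<pi> x) x\<close> vanishes, \<open>triple\<close> is
  \<open>key_identity\<close> acting on \<open>x\<close>.\<close>

lemma freudenthal_triple_system:
  assumes "(3::'k) \<noteq> 0"
  shows "freudenthal_triple_system (scaleX \<Omega>) g triple_product"
proof (intro freudenthal_triple_system.intro freudenthal_triple_system_axioms.intro)
  show "vector_space (scaleX \<Omega>)" by (rule vector_space_X)
  show "(2::'k) \<noteq> 0" "(3::'k) \<noteq> 0" by (simp_all add: assms)
  show "g (x + y) z = g x z + g y z" "g (c *x x) z = c * g x z" for x y z c
    by (rule g_linear)+
  show "g x y = - g y x" for x y by (rule g_skew)
  show "x = 0" if "\<And>w. g x w = 0" for x
    using that by (rule g_nondegenerate)
  show "triple_product (x + y) z w = triple_product x z w + triple_product y z w" "triple_product (c *x x) z w = c *x triple_product x z w" for x y z w c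
    by (simp_all add: triple_product_def X.scale_right_distrib mult.commute add_ac)
  show "triple_product x y z = triple_product y x z" "triple_product x y z = triple_product x z y" for x y z
    by (simp_all add: triple_product_def h_sym_commute[of z y] h_sym_commute[of y x] add_ac)
  show "g (triple_product x y z) w = g (triple_product w y z) x" for x y z w
  proof -
    have g: "2 * (4 * g (triple_product x y z) w) =
        f (h_sym x w) (h_sym y z) + f (h_sym y w) (h_sym x z) + f (h_sym z w) (h_sym x y)" for x y z w
      by (simp add: triple_product_def g_linear g_act_h_sym[symmetric])
    have "2 * (4 * g (triple_product x y z) w) = 2 * (4 * g (triple_product w y z) x)"
      unfolding g h_sym_commute[of w x] h_sym_commute[of w z] h_sym_commute[of y x] h_sym_commute[of z x] h_sym_commute[of w y]
        f_sym[of "h_sym x z"] f_sym[of "h_sym z w"] by simp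
    then show ?thesis by (simp only: mult_cancel_left) simp
  qed
  show "triple_product x (triple_product x x x) y = - (g (triple_product x x x) y *x x) - g x y *x triple_product x x x" for x y
  proof (cases "x = 0")
    case False
    have "h_sym (x \<cdot> \<pi> x) x = 0"
      using h_swap[of "x \<cdot> \<pi> x" x] theta_pi[OF False]
      by (intro L_eqI) (simp add: h_sym_def theta_eq(2) g_act_pi)
    then have "triple_product x (x \<cdot> \<pi> x) y = (1 / 2) *x (x \<cdot> (theta \<Omega> x (h_sym x y) + h_sym (x \<cdot> \<pi> x) y))"
      by (simp add: triple_product_def h_sym_commute[of x "x \<cdot> \<pi> x"] D1 algebra_simps)
    also have "\<dots> = - (g (x \<cdot> \<pi> x) y *x x) - g x y *x (x \<cdot> \<pi> x)"
      unfolding key_identity[OF False] by (simp add: A2 algebra_simps)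
    finally have "6 *x triple_product x (x \<cdot> \<pi> x) y = 6 *x (- (g (x \<cdot> \<pi> x) y *x x) - g x y *x (x \<cdot> \<pi> x))"
      by simp
    moreover have "triple_product x (c *x z) y = c *x triple_product x z y" for c z
      by (simp add: triple_product_def X.scale_right_distrib mult.commute)
    ultimately show ?thesis
      unfolding triple_product_diagonal g_linear by (simp add: X.scale_right_diff_distrib mult.commute)
  qed (simp add: triple_product_def g_linear h_sym_def)
qed

lemma pointed_freudenthal_triple_system:
  assumes "(3::'k) \<noteq> 0" "e \<noteq> 0"
  shows "pointed_freudenthal_triple_system (scaleX \<Omega>) g triple_product e"
proof -
  interpret freudenthal_triple_system "scaleX \<Omega>" g triple_product
    by (rule freudenthal_triple_system[OF assms(1)])
  show ?thesis
    by standard (simp add: triple_product_diagonal pi_nonzero assms(2) g_act_pi g_skew[of e "e \<cdot> \<pi> e"])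
qed

end


section \<open>Generalized quadrangles\<close>

text \<open>Turns explicit cycles of length 4, 6 and 8 into periodic labellings, to which the girth
  condition applies.\<close>

lemma circuit_list:
  assumes "distinct xs" "3 \<le> length xs"
    and "\<And>i. i < length xs \<Longrightarrow> E (xs ! i) (xs ! (Suc i mod length xs))"
  shows "circuit E (length xs) (\<lambda>i. xs ! nat (i mod int (length xs)))"
  unfolding circuit_def
proof (intro conjI allI)
  have pos: "0 < int (length xs)" using assms(2) by linarith
  show "inj_on (\<lambda>i. xs ! nat (i mod int (length xs))) {0..<int (length xs)}"
    using assms(1) by (auto simp: inj_on_def nth_eq_iff_index_eq)
  show "E (xs ! nat (i mod int (length xs))) (xs ! nat ((i + 1) mod int (length xs)))" for i
  proof -
    define j where "j = nat (i mod int (length xs))"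
    have j: "int j = i mod int (length xs)" "j < length xs"
      using pos by (auto simp: j_def nat_less_iff)
    have "int (Suc j mod length xs) = (i + 1) mod int (length xs)"
      by (simp add: zmod_int j mod_simps add.commute)
    then have "nat ((i + 1) mod int (length xs)) = Suc j mod length xs"
      by (metis nat_int)
    then show ?thesis using assms(3)[OF j(2)] by (simp add: j_def)
  qed
next
  show "3 \<le> length xs" by (fact assms(2))
  show "xs ! nat ((i + int (length xs)) mod int (length xs)) = xs ! nat (i mod int (length xs))" for i
    by simp
qed

lemma circuit_8:
  assumes "circuit E 8 c"
  shows circuit_edge: "E (c i) (c (i + 1))"
    and circuit_mod: "c (i mod 8) = c i"
    and circuit_eq_iff: "c i = c j \<longleftrightarrow> 8 dvd (i - j)"
    and circuit_shift: "c (i + j mod 8) = c (i + j)"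
proof -
  show "E (c i) (c (i + 1))" using assms by (simp add: circuit_def)
  have p: "c (i + 8) = c i" for i
    using assms by (simp add: circuit_def)
  have m: "c (i + 8 * n) = c i" for i n
  proof (induction n rule: int_induct[where k = 0])
    case (step1 n)
    then show ?case using p[of "i + 8 * n"] by (simp add: algebra_simps)
  next
    case (step2 n)
    then show ?case using p[of "i + 8 * (n - 1)"] by (simp add: algebra_simps)
  qed simp
  have m: "c (i mod 8) = c i" for i
    using m[of "i mod 8" "i div 8"] by simp
  then show "c (i mod 8) = c i" .
  have "inj_on c {0..<8}" using assms by (simp add: circuit_def)
  then have "c (i mod 8) = c (j mod 8) \<longleftrightarrow> i mod 8 = j mod 8"
    by (simp add: inj_on_eq_iff)
  then show "c i = c j \<longleftrightarrow> 8 dvd (i - j)" by (simp add: m mod_eq_dvd_iff)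
  show "c (i + j mod 8) = c (i + j)"
    using m[of "i + j mod 8"] m[of "i + j"] by (simp add: mod_add_right_eq)
qed

lemma nat_less_6: "(i::nat) < 6 \<longleftrightarrow> i = 0 \<or> i = 1 \<or> i = 2 \<or> i = 3 \<or> i = 4 \<or> i = 5"
  by auto

lemma nat_less_8: "(i::nat) < 8 \<longleftrightarrow> i = 0 \<or> i = 1 \<or> i = 2 \<or> i = 3 \<or> i = 4 \<or> i = 5 \<or> i = 6 \<or> i = 7"
  by auto

context thick_generalized_quadrangle
begin

lemma adj_commute: "E x y \<longleftrightarrow> E y x"
  using adj_sym by blast

lemma no_square:
  assumes "E a b" "E b c" "E c d" "E d a" "a \<noteq> c"
  shows "b = d"
proof (rule ccontr)
  assume "b \<noteq> d"
  let ?xs = "[a, b, c, d]"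
  have "circuit E (length ?xs) (\<lambda>i. ?xs ! nat (i mod int (length ?xs)))"
  proof (rule circuit_list)
    show "distinct ?xs" using assms \<open>b \<noteq> d\<close> adj_irrefl by auto
    show "E (?xs ! i) (?xs ! (Suc i mod length ?xs))" if "i < length ?xs" for i
    proof -
      have "i = 0 \<or> i = 1 \<or> i = 2 \<or> i = 3" using that by auto
      then show ?thesis using assms by (elim disjE) simp_all
    qed
  qed simp
  then show False using girth_8 by fastforce
qed

text \<open>The bipartition separates vertices of different parity, so it suffices that vertices of
  equal parity are distinct.\<close>

lemma no_hexagon:
  assumes "E a b" "E b c" "E c d" "E d e" "E e f" "E f a"
    and "a \<noteq> c" "c \<noteq> e" "e \<noteq> a" "b \<noteq> d" "d \<noteq> f" "f \<noteq> b"
  shows False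
proof -
  obtain P where P: "E x y \<Longrightarrow> x \<in> P \<longleftrightarrow> y \<notin> P" for x y using bipartite by metis
  let ?xs = "[a, b, c, d, e, f]"
  have "circuit E (length ?xs) (\<lambda>i. ?xs ! nat (i mod int (length ?xs)))"
  proof (rule circuit_list)
    show "distinct ?xs"
      using assms(7-) P[OF assms(1)] P[OF assms(2)] P[OF assms(3)] P[OF assms(4)] P[OF assms(5)]
      by auto
    show "E (?xs ! i) (?xs ! (Suc i mod length ?xs))" if "i < length ?xs" for i
    proof -
      have "i < 6" using that by simp
      then show ?thesis using assms unfolding nat_less_6 by (elim disjE) simp_all
    qed
  qed simp
  then show False using girth_8 by fastforce
qed

text \<open>If opposite vertices coincided, half of the closed path would be a square; vertices of
  different parity are separated by the bipartition.\<close>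

lemma octagon:
  assumes "E a b" "E b c" "E c d" "E d e" "E e f" "E f g" "E g h" "E h a"
    and "a \<noteq> c" "b \<noteq> d" "c \<noteq> e" "d \<noteq> f" "e \<noteq> g" "f \<noteq> h" "g \<noteq> a" "h \<noteq> b"
  shows "circuit E 8 (\<lambda>i. [a, b, c, d, e, f, g, h] ! nat (i mod 8))"
proof -
  obtain P where P: "E x y \<Longrightarrow> x \<in> P \<longleftrightarrow> y \<notin> P" for x y using bipartite by metis
  let ?xs = "[a, b, c, d, e, f, g, h]"
  have opposite: "a \<noteq> e" "b \<noteq> f" "c \<noteq> g" "d \<noteq> h"
    using no_square assms by metis+
  have "circuit E (length ?xs) (\<lambda>i. ?xs ! nat (i mod int (length ?xs)))"
  proof (rule circuit_list)
    show "distinct ?xs"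
      using assms(9-) opposite P[OF assms(1)] P[OF assms(2)] P[OF assms(3)] P[OF assms(4)]
        P[OF assms(5)] P[OF assms(6)] P[OF assms(7)]
      by auto
    show "E (?xs ! i) (?xs ! (Suc i mod length ?xs))" if "i < length ?xs" for i
    proof -
      have "i < 8" using that by simp
      then show ?thesis using assms unfolding nat_less_8 by (elim disjE) simp_all
    qed
  qed simp
  moreover have "length ?xs = 8" by simp
  ultimately show ?thesis by (simp only: of_nat_numeral)
qed

lemma unique_path:
  assumes "E p a" "E a b" "E b r" "E p a'" "E a' b'" "E b' r" "\<not> E p r"
  shows "a = a' \<and> b = b'"
proof -
  have ne: "p \<noteq> b" "p \<noteq> b'" "a \<noteq> r" "a' \<noteq> r" using assms by auto
  have "a = a'"
  proof (rule ccontr)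
    assume "a \<noteq> a'"
    moreover from this have "b \<noteq> b'"
      using no_square[of p a b a'] assms ne adj_commute by metis
    ultimately show False
      using no_hexagon[of p a b r b' a'] assms ne adj_commute by metis
  qed
  moreover from this have "b = b'"
    using no_square[of a b r b'] assms ne adj_commute by metis
  ultimately show ?thesis by simp
qed

lemma circuit_not_adjacent:
  assumes c: "circuit E 8 c"
  shows "\<not> E (c i) (c (i + 3))"
proof
  assume "E (c i) (c (i + 3))"
  moreover have "E (c i) (c (i + 1))" "E (c (i + 1)) (c (i + 2))" "E (c (i + 2)) (c (i + 3))"
    using circuit_edge[OF c, of i] circuit_edge[OF c, of "i + 1"] circuit_edge[OF c, of "i + 2"]
    by (simp_all add: add.assoc)
  moreover have "c i \<noteq> c (i + 2)" "c (i + 1) \<noteq> c (i + 3)"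
    by (simp_all add: circuit_eq_iff[OF c])
  ultimately show False using no_square adj_sym by metis
qed

text \<open>The distance from \<open>p\<close> to \<open>c i\<close> is at most 4 and odd by the
  bipartition, and it is not 1 because there is no hexagon. A path of length 3 therefore closes the
  root and \<open>p\<close> to an octagon.\<close>

lemma apartment_through:
  assumes c: "circuit E 8 c" and p: "E (c (i + 4)) p" "p \<noteq> c (i + 3)"
  obtains c' where "circuit E 8 c'" "\<And>j. j \<in> {0..4} \<Longrightarrow> c' j = c (i + j)" "c' 5 = p"
proof -
  define v where "v j = c (i + j)" for j
  have e: "E (v 0) (v 1)" "E (v 1) (v 2)" "E (v 2) (v 3)" "E (v 3) (v 4)" "E (v 4) p"
    using circuit_edge[OF c, of i] circuit_edge[OF c, of "i + 1"] circuit_edge[OF c, of "i + 2"]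
     circuit_edge[OF c, of "i + 3"] p(1) by (simp_all add: v_def add.assoc)
  have ne: "v 0 \<noteq> v 2" "v 1 \<noteq> v 3" "v 2 \<noteq> v 4" "v 3 \<noteq> p" "v 0 \<noteq> v 4"
    using p(2) unfolding v_def by (auto simp: circuit_eq_iff[OF c])
  have p1: "\<not> E (v 4) (v 1)"
    using no_square[OF e(2,3,4)] ne by blast
  then have p1': "p \<noteq> v 1" using e(5) by blast
  have p2: "\<not> E (v 3) (v 0)"
    using no_square[OF e(1,2,3)] ne by blast
  have p0: "\<not> E p (v 0)"
    using no_hexagon[of p "v 0" "v 1" "v 2" "v 3" "v 4"] e p1' ne by metis
  obtain P where P: "E x y \<Longrightarrow> x \<in> P \<longleftrightarrow> y \<notin> P" for x y using bipartite by metis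
  define n where "n = graph_dist E p (v 0)"
  have "n \<le> 4" using diameter_4 by (simp add: n_def)
  have n: "(E ^^ n) p (v 0)"
    using connected[of p "v 0"] unfolding n_def graph_dist_def
    by (metis LeastI_ex rtranclp_imp_relpowp)
  have "odd n"
  proof -
    have "(E ^^ n) x y \<Longrightarrow> (x \<in> P \<longleftrightarrow> y \<in> P) \<longleftrightarrow> even n" for x y n
    proof (induction n arbitrary: y)
      case (Suc n)
      then show ?case using P by (fastforce elim: relpowp_Suc_E)
    qed auto
    from this[OF n] show ?thesis using e P by metis
  qed
  moreover have "n = 0 \<or> n = 1 \<or> n = 2 \<or> n = 3 \<or> n = 4" using \<open>n \<le> 4\<close> by linarith
  ultimately have "n = 1 \<or> n = 3" by auto
  with n p0 have "(E ^^ 3) p (v 0)" by auto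
  then obtain a b where ab: "E p a" "E a b" "E b (v 0)"
    by (auto simp: numeral_3_eq_3)
  have a4: "v 4 \<noteq> a"
  proof
    assume a: "v 4 = a"
    then have "b \<noteq> v 1" "b \<noteq> v 3" using ab p1 p2 by auto
    then show False
      using no_hexagon[OF e(1-4), of b] ab ne unfolding a by blast
  qed
  show ?thesis
  proof
    let ?c = "\<lambda>j. [v 0, v 1, v 2, v 3, v 4, p, a, b] ! nat (j mod 8)"
    show "circuit E 8 ?c"
    proof (rule octagon)
      show "v 4 \<noteq> a" by (fact a4)
      show "p \<noteq> b" "a \<noteq> v 0" using p0 ab by auto
      show "b \<noteq> v 1"
      proof
        assume b: "b = v 1"
        have "a \<noteq> v 2"
          using no_square[OF e(3-5)] ab(1) ne by blast
        then show False
          using no_hexagon[OF e(2-5) ab(1)] ab(2) p1' ne a4 unfolding b by blast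
      qed
    qed (use e ne ab in auto)
    show "?c 5 = p" by simp
    show "?c j = c (i + j)" if "j \<in> {0..4}" for j
    proof -
      from that have "j = 0 \<or> j = 1 \<or> j = 2 \<or> j = 3 \<or> j = 4" by auto
      then show ?thesis by (elim disjE) (simp_all add: v_def)
    qed
  qed
qed

end


section \<open>Root groups and reflections\<close>

lemma aut_group_simps [simp]:
  "\<phi> \<in> carrier (aut_group E) \<longleftrightarrow> bij \<phi> \<and> (\<forall>x y. E (\<phi> x) (\<phi> y) \<longleftrightarrow> E x y)"
  "\<phi> \<otimes>\<^bsub>aut_group E\<^esub> \<psi> = \<psi> \<circ> \<phi>" "\<one>\<^bsub>aut_group E\<^esub> = id"
  by (simp_all add: aut_group_def)

lemma inv_aut:
  assumes "\<phi> \<in> carrier (aut_group E)"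
  shows "inv_into UNIV \<phi> \<in> carrier (aut_group E)"
  using assms by simp (metis bij_imp_bij_inv bij_inv_eq_iff)

lemma group_aut_group: "group (aut_group E)"
proof (rule groupI)
  show "\<exists>\<psi>\<in>carrier (aut_group E). \<psi> \<otimes>\<^bsub>aut_group E\<^esub> \<phi> = \<one>\<^bsub>aut_group E\<^esub>"
    if "\<phi> \<in> carrier (aut_group E)" for \<phi>
    using inv_aut[OF that] that
    by (intro bexI[of _ "inv_into UNIV \<phi>"]) (auto simp: bij_is_surj surj_f_inv_f)
qed (auto simp: bij_comp)

lemma inv_aut_group: "\<phi> \<in> carrier (aut_group E) \<Longrightarrow> inv\<^bsub>aut_group E\<^esub> \<phi> = inv_into UNIV \<phi>"
  by (rule group.inv_equality[OF group_aut_group _ _ inv_aut])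
    (auto simp: bij_is_surj surj_f_inv_f)

lemma inv_aut_apply:
  assumes "\<phi> \<in> carrier (aut_group E)"
  shows "(inv\<^bsub>aut_group E\<^esub> \<phi>) (\<phi> x) = x" "\<phi> ((inv\<^bsub>aut_group E\<^esub> \<phi>) x) = x"
    "(inv\<^bsub>aut_group E\<^esub> \<phi>) x = y \<longleftrightarrow> x = \<phi> y"
  using assms unfolding inv_aut_group[OF assms]
  by (auto simp: bij_is_inj bij_is_surj surj_f_inv_f)

lemma conjugate_apply:
  "conjugate (aut_group E) m \<phi> x = m (\<phi> ((inv\<^bsub>aut_group E\<^esub> m) x))"
  by (simp add: conjugate_def)

lemma root_list: "map c [i..i + 4] = [c i, c (i + 1), c (i + 2), c (i + 3), c (i + 4)]"
  for i :: int
  by (simp add: upto_rec1 add.commute)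

lemma Ugrp_iff:
  "\<phi> \<in> Ugrp E c i \<longleftrightarrow> \<phi> \<in> carrier (aut_group E) \<and>
    (\<forall>j\<in>{1, 2, 3}. \<forall>y. E (c (i + j)) y \<longrightarrow> \<phi> y = y)"
  unfolding Ugrp_def root_group_def root_list by (auto simp: numeral_eq_Suc)

text \<open>Apartments have no chords: even distances are excluded by the bipartition, distance 3 by
  the absence of squares.\<close>

lemma (in thick_generalized_quadrangle) circuit_neighbour:
  assumes c: "circuit E 8 c" and j: "E (c i) (c j)" "c j \<noteq> c (i - 1)"
  shows "c j = c (i + 1)"
proof -
  obtain P where P: "E x y \<Longrightarrow> x \<in> P \<longleftrightarrow> y \<notin> P" for x y using bipartite by metis
  have e: "c n \<in> P \<longleftrightarrow> c (n + 1) \<notin> P" for n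
    by (rule P[OF circuit_edge[OF c]])
  have "\<not> E (c i) (c (i + 3))" "\<not> E (c i) (c (i + 5))"
    using circuit_not_adjacent[OF c, of i] circuit_not_adjacent[OF c, of "i + 5"] adj_sym
      circuit_eq_iff[OF c, of "i + 8" i] by (auto simp: add.assoc)
  moreover have "\<not> E (c i) (c (i + 0))" "\<not> E (c i) (c (i + 2))" "\<not> E (c i) (c (i + 4))"
    "\<not> E (c i) (c (i + 6))"
    using P[of "c i" "c i"] P[of "c i" "c (i + 2)"] P[of "c i" "c (i + 4)"] P[of "c i" "c (i + 6)"]
      e[of i] e[of "i + 1"] e[of "i + 2"] e[of "i + 3"] e[of "i + 4"] e[of "i + 5"]
    by (auto simp: add.assoc)
  moreover have "c (i + 7) = c (i - 1)"
    by (simp add: circuit_eq_iff[OF c])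
  moreover have "\<exists>n\<in>{0..7}. c j = c (i + n)"
  proof
    show "(j - i) mod 8 \<in> {0..7}" by auto
    show "c j = c (i + (j - i) mod 8)" by (simp add: circuit_shift[OF c])
  qed
  then have "c j = c (i + 0) \<or> c j = c (i + 1) \<or> c j = c (i + 2) \<or> c j = c (i + 3) \<or>
      c j = c (i + 4) \<or> c j = c (i + 5) \<or> c j = c (i + 6) \<or> c j = c (i + 7)"
  proof
    fix n :: int assume "n \<in> {0..7}" and n: "c j = c (i + n)"
    then have "n = 0 \<or> n = 1 \<or> n = 2 \<or> n = 3 \<or> n = 4 \<or> n = 5 \<or> n = 6 \<or> n = 7" by auto
    with n show ?thesis by blast
  qed
  ultimately show ?thesis using j by metis
qed

locale apartment_in_quadrangle = moufang_quadrangle E for E :: "'v \<Rightarrow> 'v \<Rightarrow> bool" +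
  fixes c :: "int \<Rightarrow> 'v"
  assumes circuit: "circuit E 8 c"
begin

sublocale G: group "aut_group E" by (rule group_aut_group)

abbreviation U :: "int \<Rightarrow> ('v \<Rightarrow> 'v) set" where "U \<equiv> Ugrp E c"
abbreviation conj :: "('v \<Rightarrow> 'v) \<Rightarrow> ('v \<Rightarrow> 'v) \<Rightarrow> ('v \<Rightarrow> 'v)" where
  "conj \<equiv> conjugate (aut_group E)"

lemmas c_edge = circuit_edge[OF circuit]
lemmas c_eq_iff = circuit_eq_iff[OF circuit]

lemma c_edge': "E (c (i + 1)) (c i)"
  using c_edge adj_sym by blast

lemma U_carrier: "\<phi> \<in> U i \<Longrightarrow> \<phi> \<in> carrier (aut_group E)"
  unfolding Ugrp_iff by blast

lemma U_subgroup: "subgroup (U i) (aut_group E)"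
proof (rule G.subgroupI)
  show "U i \<subseteq> carrier (aut_group E)" using U_carrier by blast
  have "id \<in> U i" by (simp add: Ugrp_iff)
  then show "U i \<noteq> {}" by blast
  show "inv\<^bsub>aut_group E\<^esub> \<phi> \<in> U i" if "\<phi> \<in> U i" for \<phi>
    using that G.inv_closed[OF U_carrier[OF that]] inv_aut_apply(3)[OF U_carrier[OF that]]
    unfolding Ugrp_iff by metis
  show "\<phi> \<otimes>\<^bsub>aut_group E\<^esub> \<psi> \<in> U i" if "\<phi> \<in> U i" "\<psi> \<in> U i" for \<phi> \<psi>
    using that G.m_closed[OF U_carrier[OF that(1)] U_carrier[OF that(2)]] unfolding Ugrp_iff
    by (simp only: aut_group_simps(2) comp_apply) metis
qed

lemma U_fixes:
  assumes "\<phi> \<in> U i" "j \<in> {0..4}"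
  shows "\<phi> (c (i + j)) = c (i + j)"
proof -
  have "j = 0 \<or> j = 1 \<or> j = 2 \<or> j = 3 \<or> j = 4" using assms(2) by auto
  moreover have "\<phi> (c i) = c i" "\<phi> (c (i + 1)) = c (i + 1)" "\<phi> (c (i + 2)) = c (i + 2)"
    "\<phi> (c (i + 3)) = c (i + 3)" "\<phi> (c (i + 4)) = c (i + 4)"
    using assms(1) c_edge[of "i + 1"] c_edge[of "i + 2"] c_edge[of "i + 3"]
      c_edge'[of i] c_edge'[of "i + 1"]
    unfolding Ugrp_iff by (auto simp: add.assoc)
  ultimately show ?thesis by auto
qed

lemma aut_path:
  assumes \<phi>: "\<phi> \<in> carrier (aut_group E)"
    and c: "\<phi> (c i) = a 0" "\<phi> (c (i + 3)) = a 3"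
    and a: "E (a 0) (a 1)" "E (a 1) (a 2)" "E (a 2) (a (3::nat))" "\<not> E (a 0) (a 3)"
  shows "\<phi> (c (i + 1)) = a 1 \<and> \<phi> (c (i + 2)) = a 2"
proof (rule unique_path)
  have "E (\<phi> (c i)) (\<phi> (c (i + 1)))" "E (\<phi> (c (i + 1))) (\<phi> (c (i + 2)))"
    "E (\<phi> (c (i + 2))) (\<phi> (c (i + 3)))"
    using \<phi> c_edge[of i] c_edge[of "i + 1"] c_edge[of "i + 2"] by (simp_all add: add.assoc)
  then show "E (a 0) (\<phi> (c (i + 1)))" "E (\<phi> (c (i + 1))) (\<phi> (c (i + 2)))"
    "E (\<phi> (c (i + 2))) (a 3)" by (simp_all add: c)
qed (use a in auto)

lemma is_root_c: "is_root E (map c [i..i + 4])"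
proof -
  have "c (i + int j) \<noteq> c (i + int (j + 2))" for j
    by (simp add: c_eq_iff)
  from this[of 0] this[of 1] this[of 2] show ?thesis
    using c_edge[of i] c_edge[of "i + 1"] c_edge[of "i + 2"] c_edge[of "i + 3"]
    unfolding is_root_def root_list by (auto simp: add.assoc less_Suc_eq numeral_3_eq_3)
qed

text \<open>The path from \<open>c (i + 5)\<close> to \<open>c (i + 8) = c i\<close> is the only one
  of length 3, so the whole apartment is fixed; by regularity only the identity does this.\<close>

lemma U_trivial:
  assumes \<phi>: "\<phi> \<in> U i" and fix5: "\<phi> (c (i + 5)) = c (i + 5)"
  shows "\<phi> = id"
proof -
  have c8: "c (i + 8) = c i" by (simp add: c_eq_iff)
  have "\<phi> (c (i + 5 + 1)) = c (i + 6) \<and> \<phi> (c (i + 5 + 2)) = c (i + 7)"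
    using aut_path[OF U_carrier[OF \<phi>], of "i + 5" "\<lambda>n. c (i + 5 + int n)"]
      U_fixes[OF \<phi>, of 0] fix5 c_edge[of "i + 5"] c_edge[of "i + 6"] c_edge[of "i + 7"]
      circuit_not_adjacent[OF circuit, of "i + 5"]
    by (simp add: add.assoc c8)
  then have f: "\<phi> (c (i + j)) = c (i + j)" if "j \<in> {0..<8}" for j
  proof -
    have "j \<in> {0..4} \<or> j = 5 \<or> j = 6 \<or> j = 7" using that by auto
    then show ?thesis
      using U_fixes[OF \<phi>, of j] fix5 \<open>\<phi> (c (i + 5 + 1)) = _ \<and> _\<close> by (auto simp: add.assoc)
  qed
  have fixed: "\<phi> (c j) = c j" for j
  proof -
    have "c (i + (j - i) mod 8) = c j" by (simp add: circuit_shift[OF circuit])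
    then show ?thesis using f[of "(j - i) mod 8"] by simp
  qed
  have A: "is_apartment E (range c)" "set (map c [i..i + 4]) \<subseteq> range c"
    using circuit by (auto simp: is_apartment_def)
  have "\<exists>!\<phi>. \<phi> \<in> root_group E (map c [i..i + 4]) \<and> \<phi> ` range c = range c"
    using roots_moufang[OF is_root_c] A unfolding moufang_root_def by blast
  moreover have "\<phi> ` range c = range c" using fixed by (simp add: image_image)
  moreover have "id \<in> U i" by (simp add: Ugrp_iff)
  ultimately show ?thesis using \<phi> unfolding Ugrp_def by (metis image_id id_apply)
qed

lemma U_trivial':
  assumes \<phi>: "\<phi> \<in> U i" and fix5: "\<phi> (c (i - 1)) = c (i - 1)"
  shows "\<phi> = id"
proof (rule U_trivial[OF \<phi>])
  have c7: "c (i + 7) = c (i - 1)" by (simp add: c_eq_iff)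
  show "\<phi> (c (i + 5)) = c (i + 5)"
    using aut_path[OF U_carrier[OF \<phi>], of "i + 4" "\<lambda>n. c (i + 4 + int n)"]
      U_fixes[OF \<phi>, of 4] fix5 c_edge[of "i + 4"] c_edge[of "i + 5"] c_edge[of "i + 6"]
      circuit_not_adjacent[OF circuit, of "i + 4"]
    by (simp add: add.assoc c7)
qed

text \<open>Regularity gives an element mapping the apartment to one through the root and
  \<open>p\<close>. The image of \<open>c (i + 5)\<close> is a neighbour of \<open>c (i + 4)\<close>
  in it other than \<open>c (i + 3)\<close>, hence \<open>p\<close>.\<close>

lemma U_transitive:
  assumes p: "E (c (i + 4)) p" "p \<noteq> c (i + 3)"
  obtains \<phi> where "\<phi> \<in> U i" "\<phi> (c (i + 5)) = p"
proof -
  obtain c' where c': "circuit E 8 c'" "\<And>j. j \<in> {0..4} \<Longrightarrow> c' j = c (i + j)" "c' 5 = p"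
    using apartment_through[OF circuit p] by blast
  have "c (i + j) \<in> range c'" if "j \<in> {0..4}" for j
    using c'(2)[OF that] by (metis rangeI)
  from this[of 0] this[of 1] this[of 2] this[of 3] this[of 4]
  have A: "is_apartment E (range c)" "set (map c [i..i + 4]) \<subseteq> range c"
    "is_apartment E (range c')" "set (map c [i..i + 4]) \<subseteq> range c'"
    using circuit c'(1) by (auto simp: is_apartment_def root_list)
  have "\<exists>!\<phi>. \<phi> \<in> U i \<and> \<phi> ` range c = range c'"
    using roots_moufang[OF is_root_c] A unfolding moufang_root_def Ugrp_def by simp
  then obtain \<phi> where \<phi>: "\<phi> \<in> U i" "\<phi> ` range c = range c'"
    by blast
  have inj: "inj \<phi>" using U_carrier[OF \<phi>(1)] by (simp add: bij_is_inj)
  have "\<phi> (c (i + 5)) \<in> range c'" using \<phi>(2) by blast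
  then obtain j where j: "\<phi> (c (i + 5)) = c' j" by blast
  have "E (\<phi> (c (i + 4))) (\<phi> (c (i + 5)))"
    using U_carrier[OF \<phi>(1)] c_edge[of "i + 4"] by (simp add: add.assoc)
  then have e: "E (c' 4) (c' j)" using U_fixes[OF \<phi>(1), of 4] c'(2)[of 4] j by simp
  have "c (i + 5) \<noteq> c (i + 3)" by (simp add: c_eq_iff)
  then have "c' j \<noteq> c' 3"
    using U_fixes[OF \<phi>(1), of 3] c'(2)[of 3] j injD[OF inj, of "c (i + 5)" "c (i + 3)"] by auto
  with e have "c' j = c' 5"
    by (rule circuit_neighbour[OF c'(1), of 4, simplified])
  with \<phi>(1) j c'(3) show ?thesis using that by simp
qed

section \<open>Reflections of the apartment and existence of the mu-maps\<close>

definition reflection :: "('v \<Rightarrow> 'v) \<Rightarrow> bool" where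
  "reflection m \<longleftrightarrow> m \<in> carrier (aut_group E) \<and> (\<forall>i. m (c i) = c (2 - i))"

lemma reflection_inv: "reflection m \<Longrightarrow> reflection (inv\<^bsub>aut_group E\<^esub> m)"
proof -
  assume m: "reflection m"
  then have c: "m \<in> carrier (aut_group E)" unfolding reflection_def by blast
  show ?thesis
    unfolding reflection_def inv_aut_apply(3)[OF c] using G.inv_closed[OF c] m
    by (simp add: reflection_def del: aut_group_simps)
qed

text \<open>The root from \<open>c i\<close> to \<open>c (i + 4)\<close> is mapped to the one from
  \<open>c (2 - i)\<close> to \<open>c (- 2 - i)\<close>. Read backwards it starts at
  \<open>- 2 - i\<close>, which is \<open>6 - i\<close> modulo 8, and its interior vertices
  correspond under \<open>j\<close> to \<open>4 - j\<close>.\<close>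

lemma conj_U:
  assumes m: "reflection m" and \<phi>: "\<phi> \<in> U i"
  shows "conj m \<phi> \<in> U (6 - i)"
  unfolding Ugrp_iff
proof (intro conjI ballI allI impI)
  have c: "m \<in> carrier (aut_group E)" using m unfolding reflection_def by blast
  show "conj m \<phi> \<in> carrier (aut_group E)"
    unfolding conjugate_def by (intro G.m_closed G.inv_closed c U_carrier[OF \<phi>])
  fix j :: int and y assume j: "j \<in> {1, 2, 3}" and y: "E (c (6 - i + j)) y"
  have "c (6 - i + j) = c (2 - (i + (4 - j)))" by (simp add: c_eq_iff)
  also have "\<dots> = m (c (i + (4 - j)))" using m unfolding reflection_def by simp
  finally have "E (m (c (i + (4 - j)))) (m ((inv\<^bsub>aut_group E\<^esub> m) y))"
    using y by (simp add: inv_aut_apply[OF c] del: aut_group_simps)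
  then have "E (c (i + (4 - j))) ((inv\<^bsub>aut_group E\<^esub> m) y)"
    using c by simp
  moreover have "4 - j \<in> {1, 2, 3}" using j by auto
  ultimately have "\<phi> ((inv\<^bsub>aut_group E\<^esub> m) y) = (inv\<^bsub>aut_group E\<^esub> m) y"
    using \<phi> unfolding Ugrp_iff by blast
  then show "conj m \<phi> y = y"
    unfolding conjugate_apply by (simp add: inv_aut_apply[OF c] del: aut_group_simps)
qed

lemma conj_inv:
  assumes "m \<in> carrier (aut_group E)" "\<phi> \<in> carrier (aut_group E)"
  shows "conj m (conj (inv\<^bsub>aut_group E\<^esub> m) \<phi>) = \<phi>"
  unfolding conjugate_def using assms
  by (simp add: G.m_assoc G.inv_solve_left' del: aut_group_simps)

lemma conj_U_image:
  assumes m: "reflection m"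
  shows "conj m ` U i = U (6 - i)"
proof
  show "conj m ` U i \<subseteq> U (6 - i)" using conj_U[OF m] by blast
  show "U (6 - i) \<subseteq> conj m ` U i"
  proof
    fix \<phi> assume \<phi>: "\<phi> \<in> U (6 - i)"
    have "conj m (conj (inv\<^bsub>aut_group E\<^esub> m) \<phi>) = \<phi>"
      using m U_carrier[OF \<phi>] by (intro conj_inv) (simp_all add: reflection_def del: aut_group_simps)
    moreover have "conj (inv\<^bsub>aut_group E\<^esub> m) \<phi> \<in> U i"
      using conj_U[OF reflection_inv[OF m] \<phi>] by simp
    ultimately show "\<phi> \<in> conj m ` U i" by (metis imageI)
  qed
qed

lemma c_periodic: "c 9 = c 1" "c 10 = c 2" "c 8 = c 0" "c (- 1) = c 7" "c (- 2) = c 6" "c (- 3) = c 5"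
  "c (- 4) = c 4" "c (- 5) = c 3"
  by (simp_all add: c_eq_iff)

text \<open>The remaining vertices lie on two paths of length 3 whose end vertices have prescribed
  images, and such paths are unique.\<close>

lemma reflectionI:
  assumes m: "m \<in> carrier (aut_group E)"
    and "m (c 1) = c 1" "m (c 5) = c 5" "m (c 2) = c 0" "m (c 0) = c 2"
  shows "reflection m"
proof -
  have "\<not> E (c 8) (c 5)" "\<not> E (c 2) (c 5)"
    using circuit_not_adjacent[OF circuit, of 5] circuit_not_adjacent[OF circuit, of 2] adj_sym
    by auto
  then have "m (c 3) = c 7 \<and> m (c 4) = c 6" "m (c 6) = c 4 \<and> m (c 7) = c 3"
    using aut_path[OF m, of 2 "\<lambda>n. c (8 - int n)"] aut_path[OF m, of 5 "\<lambda>n. c (5 - int n)"]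
      c_edge'[of 7] c_edge'[of 6] c_edge'[of 5] c_edge'[of 4] c_edge'[of 3] c_edge'[of 2]
      assms(2-) adj_sym
    by (auto simp: c_periodic)
  then have *: "m (c j) = c (2 - j)" if "j \<in> {0..7}" for j
  proof -
    have "j = 0 \<or> j = 1 \<or> j = 2 \<or> j = 3 \<or> j = 4 \<or> j = 5 \<or> j = 6 \<or> j = 7" using that by auto
    then show ?thesis
      using assms(2-) \<open>m (c 3) = _ \<and> _\<close> \<open>m (c 6) = _ \<and> _\<close>
      by (elim disjE) (simp_all add: c_periodic)
  qed
  have "m (c i) = c (2 - i)" for i
  proof -
    have "c (2 - i mod 8) = c (2 - i)"
      by (simp add: c_eq_iff mod_eq_dvd_iff[symmetric] mod_diff_right_eq)
    then show ?thesis using *[of "i mod 8"] circuit_mod[OF circuit] by simp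
  qed
  with m show ?thesis by (simp add: reflection_def)
qed

lemma U_1_5_fix:
  assumes "w \<in> U 1" shows "w (c 1) = c 1" "w (c 2) = c 2" "w (c 5) = c 5"
  using U_fixes[OF assms, of 0] U_fixes[OF assms, of 1] U_fixes[OF assms, of 4] by simp_all

lemma U_5_1_fix:
  assumes "y \<in> U 5" shows "y (c 1) = c 1" "y (c 0) = c 0" "y (c 5) = c 5"
  using U_fixes[OF assms, of 0] U_fixes[OF assms, of 3] U_fixes[OF assms, of 4]
  by (simp_all add: c_periodic)

lemma U_5_move:
  assumes w: "w \<in> U 1" "w \<noteq> id"
  obtains y where "y \<in> U 5" "y (c 2) = w (c 0)"
proof (rule U_transitive[of 5 "w (c 0)"])
  have "E (w (c 1)) (w (c 0))"
    using U_carrier[OF w(1)] c_edge'[of 0] by simp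
  then show "E (c (5 + 4)) (w (c 0))"
    using U_1_5_fix[OF w(1)] by (simp add: c_periodic)
  show "w (c 0) \<noteq> c (5 + 3)"
    using U_trivial'[OF w(1)] w(2) by (auto simp: c_periodic)
qed (use that in \<open>simp add: c_periodic\<close>)

text \<open>Products act from left to right. Choosing \<open>y\<close> to send \<open>c 2\<close> to
  the preimage of \<open>c 0\<close> under \<open>w\<close>, and \<open>z\<close> to send
  \<open>w (c 0)\<close> to \<open>c 2\<close>, makes the product exchange \<open>c 0\<close> and
  \<open>c 2\<close> while fixing \<open>c 1\<close> and \<open>c 5\<close>. Any other factorization
  meets the same two conditions.\<close>

lemma mu_exists:
  assumes w: "w \<in> U 1" "w \<noteq> id"
  obtains y z where "y \<in> U 5" "z \<in> U 5"
    "mu E c w = y \<otimes>\<^bsub>aut_group E\<^esub> w \<otimes>\<^bsub>aut_group E\<^esub> z" "reflection (mu E c w)"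
proof -
  let ?inv = "\<lambda>\<phi>. inv\<^bsub>aut_group E\<^esub> \<phi>"
  have wi: "?inv w \<in> U 1" by (rule subgroup.m_inv_closed[OF U_subgroup w(1)])
  have "?inv w \<noteq> id"
    using w(2) inv_aut_apply(1)[OF U_carrier[OF w(1)]] by auto
  from U_5_move[OF wi this] obtain y where y: "y \<in> U 5" "y (c 2) = ?inv w (c 0)" by blast
  from U_5_move[OF w] obtain z' where z': "z' \<in> U 5" "z' (c 2) = w (c 0)" by blast
  define z where "z = ?inv z'"
  have z: "z \<in> U 5" "z (w (c 0)) = c 2"
    using subgroup.m_inv_closed[OF U_subgroup z'(1)] z'(2)
      inv_aut_apply(3)[OF U_carrier[OF z'(1)]] by (simp_all add: z_def)
  define m where "m = y \<otimes>\<^bsub>aut_group E\<^esub> w \<otimes>\<^bsub>aut_group E\<^esub> z"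
  have m: "m x = z (w (y x))" for x by (simp add: m_def)
  have mc: "m \<in> carrier (aut_group E)"
    unfolding m_def by (intro G.m_closed U_carrier[OF y(1)] U_carrier[OF w(1)] U_carrier[OF z(1)])
  have refl: "reflection m"
    by (rule reflectionI[OF mc])
      (simp_all add: m U_1_5_fix[OF w(1)] U_5_1_fix[OF y(1)] U_5_1_fix[OF z(1)] y(2) z(2)
        inv_aut_apply(2)[OF U_carrier[OF w(1)]] del: aut_group_simps)
  have c02: "c 0 \<noteq> c 2" by (simp add: c_eq_iff)
  have ne: "y \<noteq> id" "z \<noteq> id"
  proof -
    show "y \<noteq> id"
    proof
      assume "y = id"
      then have "w (c 2) = c 0" using y(2) inv_aut_apply(2)[OF U_carrier[OF w(1)]] by simp
      then show False using c02 U_1_5_fix[OF w(1)] by simp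
    qed
    show "z \<noteq> id"
    proof
      assume "z = id"
      then have "w (c 0) = w (c 2)" using z(2) U_1_5_fix[OF w(1)] by simp
      then show False using c02 U_carrier[OF w(1)] by (simp add: bij_is_inj inj_eq)
    qed
  qed
  have "mu E c w = m"
    unfolding mu_def
  proof (rule the_equality)
    have "\<forall>i. m (c i) = c (2 - i)" using refl by (simp add: reflection_def)
    then show "(\<exists>y\<in>U 5 - {id}. \<exists>z\<in>U 5 - {id}. m = y \<otimes>\<^bsub>aut_group E\<^esub> w \<otimes>\<^bsub>aut_group E\<^esub> z) \<and>
      (\<forall>i. m (c i) = c (2 - i)) \<and> conj m ` U 1 = U 5 \<and> conj m ` U 5 = U 1"
      using y(1) z(1) ne m_def conj_U_image[OF refl, of 1] conj_U_image[OF refl, of 5] by auto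
    fix n
    assume "(\<exists>y\<in>U 5 - {id}. \<exists>z\<in>U 5 - {id}. n = y \<otimes>\<^bsub>aut_group E\<^esub> w \<otimes>\<^bsub>aut_group E\<^esub> z) \<and>
      (\<forall>i. n (c i) = c (2 - i)) \<and> conj n ` U 1 = U 5 \<and> conj n ` U 5 = U 1"
    then obtain y' z' where y': "y' \<in> U 5" and z': "z' \<in> U 5"
      and n: "n = y' \<otimes>\<^bsub>aut_group E\<^esub> w \<otimes>\<^bsub>aut_group E\<^esub> z'" and nc: "n (c i) = c (2 - i)" for i
      by blast
    have n': "n x = z' (w (y' x))" for x by (simp add: n)
    \<comment> \<open>An element of \<open>U_5\<close> is determined by the image of
      \<open>c 2 = c 10\<close>, because \<open>U_trivial\<close> makes the action there
      free.\<close>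
    have unique: "a = b" if "a \<in> U 5" "b \<in> U 5" "a (c 2) = b (c 2)" for a b
    proof -
      have "a \<otimes>\<^bsub>aut_group E\<^esub> ?inv b \<in> U 5"
        using that by (intro subgroup.m_closed[OF U_subgroup] subgroup.m_inv_closed[OF U_subgroup])
      moreover have "(a \<otimes>\<^bsub>aut_group E\<^esub> ?inv b) (c (5 + 5)) = c (5 + 5)"
        using inv_aut_apply[OF U_carrier[OF that(2)]] that(3) by (simp add: c_periodic)
      ultimately have "a \<otimes>\<^bsub>aut_group E\<^esub> ?inv b = \<one>\<^bsub>aut_group E\<^esub>"
        using U_trivial by (simp only: aut_group_simps)
      then show ?thesis
        using G.inv_equality[of a "?inv b"] U_carrier[OF that(1)] U_carrier[OF that(2)]
        by (metis G.inv_closed G.inv_inv)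
    qed
    have inj: "inj (z' \<circ> w)"
      using U_carrier[OF z'] U_carrier[OF w(1)] by (simp add: bij_is_inj inj_compose)
    have "(z' \<circ> w) (y' (c 2)) = (z' \<circ> w) (y (c 2))"
      using n'[of "c 2"] nc[of 2] y(2) U_5_1_fix[OF z'] inv_aut_apply(2)[OF U_carrier[OF w(1)]]
      by simp
    then have "y' = y" using unique[OF y' y(1)] inj by (simp only: inj_eq)
    have "z' (w (c 0)) = c 2" using n'[of "c 0"] nc[of 0] U_5_1_fix[OF y'] by simp
    then have "?inv z' (c 2) = ?inv z (c 2)"
      using z(2) inv_aut_apply(3)[OF U_carrier[OF z']] inv_aut_apply(3)[OF U_carrier[OF z(1)]]
      by metis
    then have "?inv z' = ?inv z"
      by (intro unique subgroup.m_inv_closed[OF U_subgroup] z' z(1))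
    then have "z' = z"
      using G.inv_inv[OF U_carrier[OF z']] G.inv_inv[OF U_carrier[OF z(1)]] by metis
    with \<open>y' = y\<close> show "n = m" by (simp add: n m_def)
  qed
  then show ?thesis using that[OF y(1) z(1)] refl m_def by simp
qed

end


section \<open>The reflections of the quadrangle of a quadrangular algebra\<close>

declare aut_group_simps [simp del]

context group
begin

lemma inv_cancel [simp]:
  "a \<in> carrier G \<Longrightarrow> b \<in> carrier G \<Longrightarrow> inv a \<otimes> (a \<otimes> b) = b"
  "a \<in> carrier G \<Longrightarrow> b \<in> carrier G \<Longrightarrow> a \<otimes> (inv a \<otimes> b) = b"
  by (simp_all flip: m_assoc)

lemma conjugate_closed [simp]:
  "m \<in> carrier G \<Longrightarrow> a \<in> carrier G \<Longrightarrow> conjugate G m a \<in> carrier G"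
  by (simp add: conjugate_def)

lemma conjugate_mult:
  "m \<in> carrier G \<Longrightarrow> a \<in> carrier G \<Longrightarrow> b \<in> carrier G \<Longrightarrow>
   conjugate G m (a \<otimes> b) = conjugate G m a \<otimes> conjugate G m b"
  by (simp add: conjugate_def m_assoc)

lemma conjugate_conjugate:
  "m \<in> carrier G \<Longrightarrow> n \<in> carrier G \<Longrightarrow> a \<in> carrier G \<Longrightarrow>
   conjugate G (m \<otimes> n) a = conjugate G n (conjugate G m a)"
  by (simp add: conjugate_def m_assoc inv_mult_group)

lemma conjugate_distrib:
  "m \<in> carrier G \<Longrightarrow> a \<in> carrier G \<Longrightarrow> b \<in> carrier G \<Longrightarrow>
   conjugate G m (conjugate G a b) = conjugate G (conjugate G m a) (conjugate G m b)"
  by (simp add: conjugate_def m_assoc inv_mult_group)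

lemma conjugate_cancel:
  "m \<in> carrier G \<Longrightarrow> a \<in> carrier G \<Longrightarrow> b \<in> carrier G \<Longrightarrow>
   conjugate G m a = conjugate G m b \<longleftrightarrow> a = b"
  by (simp add: conjugate_def)

lemma conjugate_inv_eq:
  "m \<in> carrier G \<Longrightarrow> a \<in> carrier G \<Longrightarrow> b \<in> carrier G \<Longrightarrow>
   conjugate G (inv m) a = b \<longleftrightarrow> conjugate G m b = a"
  by (auto simp: conjugate_def m_assoc)

lemma conjugate_eq_iff_commute:
  "a \<in> carrier G \<Longrightarrow> b \<in> carrier G \<Longrightarrow> conjugate G a b = b \<longleftrightarrow> a \<otimes> b = b \<otimes> a"
  by (auto simp: conjugate_def m_assoc inv_solve_left')

text \<open>The inverse in the second argument is the one in the commutator relations, which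
  therefore describe conjugation directly.\<close>

lemma conjugate_commutator:
  "a \<in> carrier G \<Longrightarrow> b \<in> carrier G \<Longrightarrow> conjugate G a b = commutator G a (inv b) \<otimes> b"
  by (simp add: conjugate_def commutator_def m_assoc)

lemma commutator_eq_one:
  assumes "a \<in> carrier G" "b \<in> carrier G" "commutator G a b = \<one>"
  shows "a \<otimes> b = b \<otimes> a"
proof -
  have "b \<otimes> (a \<otimes> commutator G a b) = a \<otimes> b"
    using assms(1,2) by (simp add: commutator_def m_assoc)
  then show ?thesis using assms by simp
qed

end

context quadrangle_of
begin

interpretation apartment_in_quadrangle E c
  by standard (rule apartment)

interpretation L: vector_space "scaleL \<Omega>" by (rule vector_space_L)
interpretation X: vector_space "scaleX \<Omega>" by (rule vector_space_X)

abbreviation mult' (infixl \<open>\<odot>\<close> 70) where "a \<odot> b \<equiv> a \<otimes>\<^bsub>aut_group E\<^esub> b"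
abbreviation inv' where "inv' a \<equiv> inv\<^bsub>aut_group E\<^esub> a"

lemma U_mult: "a \<in> Ugrp E c i \<Longrightarrow> b \<in> Ugrp E c i \<Longrightarrow> a \<odot> b \<in> Ugrp E c i"
  by (rule subgroup.m_closed[OF U_subgroup])

lemma U_inv: "a \<in> Ugrp E c i \<Longrightarrow> inv' a \<in> Ugrp E c i"
  by (rule subgroup.m_inv_closed[OF U_subgroup])

lemma x_in_U [simp]: "x1 w \<in> Ugrp E c 1" "x2 v \<in> Ugrp E c 2" "x3 w \<in> Ugrp E c 3" "x4 v \<in> Ugrp E c 4"
  using x1_iso x2_iso x3_iso x4_iso
  by (auto simp: iso_def hom_def XK_group_def additive_group_def)

lemma x_in_carrier [simp]:
  "x1 w \<in> carrier (aut_group E)" "x2 v \<in> carrier (aut_group E)"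
  "x3 w \<in> carrier (aut_group E)" "x4 v \<in> carrier (aut_group E)"
  using x_in_U U_carrier by blast+

lemma U_eq_range: "Ugrp E c 1 = range x1" "Ugrp E c 2 = range x2" "Ugrp E c 3 = range x3"
   "Ugrp E c 4 = range x4"
  using x1_iso x2_iso x3_iso x4_iso
  by (auto simp: iso_def bij_betw_def XK_group_def additive_group_def)

lemma x_inj: "inj x1" "inj x2" "inj x3" "inj x4"
  using x1_iso x2_iso x3_iso x4_iso
  by (auto simp: iso_def bij_betw_def XK_group_def additive_group_def)

lemma x_mult: "x1 (a, s) \<odot> x1 (b, r) = x1 (a + b, s + r + g b a)"
  "x3 (a, s) \<odot> x3 (b, r) = x3 (a + b, s + r + g b a)"
  "x2 u \<odot> x2 v = x2 (u + v)" "x4 u \<odot> x4 v = x4 (u + v)"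
  using x1_iso x2_iso x3_iso x4_iso
  by (auto simp: iso_def hom_def XK_group_def additive_group_def)

lemma x_0 [simp]: "x1 (0, 0) = \<one>\<^bsub>aut_group E\<^esub>" "x2 0 = \<one>\<^bsub>aut_group E\<^esub>"
  "x3 (0, 0) = \<one>\<^bsub>aut_group E\<^esub>" "x4 0 = \<one>\<^bsub>aut_group E\<^esub>"
  using x_mult(1)[of 0 0 0 0] x_mult(2)[of 0 0 0 0] x_mult(3)[of 0 0] x_mult(4)[of 0 0]
  by (simp_all add: gform_def del: x_in_U)

lemma g_uminus [simp]: "g (- a) a = 0" "g a (- a) = 0"
  by (simp_all add: gform_def) (simp_all add: f_h_base)

lemma x_inv: "inv' (x1 (a, s)) = x1 (- a, - s)" "inv' (x3 (a, s)) = x3 (- a, - s)"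
  "inv' (x2 v) = x2 (- v)" "inv' (x4 v) = x4 (- v)"
  by (rule G.inv_equality; simp add: x_mult)+

lemma conj_14: "conj (x1 (a, r)) (x4 v) =
    x2 (theta \<Omega> a v + r *l v) \<odot> x3 (a \<cdot> v, r * q v) \<odot> x4 v"
  by (simp add: G.conjugate_commutator comm_14)

lemma conj_13: "conj (x1 (a, r)) (x3 (b, s)) = x2 (h a b) \<odot> x3 (b, s)"
  by (simp add: G.conjugate_commutator comm_13)

lemma swap_42: "x4 v \<odot> x2 u = x2 u \<odot> x3 (0, f u v) \<odot> x4 v"
proof -
  have "x2 u \<odot> conj (x2 u) (x4 v) = x4 v \<odot> x2 u"
    by (simp add: conjugate_def G.m_assoc)
  then show ?thesis by (simp add: G.conjugate_commutator comm_24 G.m_assoc)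
qed

lemma commute_adjacent:
  assumes "i \<in> {1, 2, 3}" "a \<in> Ugrp E c i" "b \<in> Ugrp E c (i + 1)"
  shows "a \<odot> b = b \<odot> a"
  using comm_adjacent[OF assms] U_carrier[OF assms(2)] U_carrier[OF assms(3)]
  by (intro G.commutator_eq_one) (simp_all add: aut_group_simps(3))

lemma commute_12: "a \<in> Ugrp E c 1 \<Longrightarrow> b \<in> Ugrp E c 2 \<Longrightarrow> a \<odot> b = b \<odot> a"
  and commute_23: "a \<in> Ugrp E c 2 \<Longrightarrow> b \<in> Ugrp E c 3 \<Longrightarrow> a \<odot> b = b \<odot> a"
  and commute_34: "a \<in> Ugrp E c 3 \<Longrightarrow> b \<in> Ugrp E c 4 \<Longrightarrow> a \<odot> b = b \<odot> a"
  using commute_adjacent[of 1 a b] commute_adjacent[of 2 a b] commute_adjacent[of 3 a b] by simp_all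

text \<open>\<open>a3\<close> and \<open>a4\<close> fix \<open>c 7\<close>, so \<open>a2\<close>
  does and is trivial by \<open>U_trivial\<close>; then \<open>a4\<close> fixes \<open>c 8\<close>,
  and the same argument applies to \<open>a3\<close>.\<close>

lemma U_234_trivial:
  assumes "a2 \<in> Ugrp E c 2" "a3 \<in> Ugrp E c 3" "a4 \<in> Ugrp E c 4"
    and "a2 \<odot> a3 \<odot> a4 = \<one>\<^bsub>aut_group E\<^esub>"
  shows "a2 = \<one>\<^bsub>aut_group E\<^esub> \<and> a3 = \<one>\<^bsub>aut_group E\<^esub>"
proof -
  have eq: "a4 (a3 (a2 x)) = x" for x
    using fun_cong[OF assms(4), of x] by (simp add: aut_group_simps)
  have inj: "inj a3" "inj a4"
    using U_carrier[OF assms(2)] U_carrier[OF assms(3)] by (simp_all add: aut_group_simps bij_is_inj)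
  have "a3 (c 7) = c 7" "a4 (c 7) = c 7" "a4 (c 8) = c 8"
    using U_fixes[OF assms(2), of 4] U_fixes[OF assms(3), of 3] U_fixes[OF assms(3), of 4] by simp_all
  then have "a2 (c 7) = c 7"
    using eq[of "c 7"] inj by (metis injD)
  then have a2: "a2 = id" using U_trivial[OF assms(1)] by simp
  then have "a3 (c 8) = c 8" using eq[of "c 8"] inj \<open>a4 (c 8) = c 8\<close> by (metis injD id_apply)
  then have "a3 = id" using U_trivial[OF assms(2)] by simp
  with a2 show ?thesis by (simp add: aut_group_simps)
qed

lemma decomposition_unique:
  assumes "a2 \<in> Ugrp E c 2" "a3 \<in> Ugrp E c 3" "a4 \<in> Ugrp E c 4" "b2 \<in> Ugrp E c 2"
    and "a2 \<odot> a3 \<odot> a4 = b2"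
  shows "b2 = a2 \<and> a3 = \<one>\<^bsub>aut_group E\<^esub>"
proof -
  note [simp] = assms(1-4)[THEN U_carrier]
  have "inv' b2 \<odot> a2 \<odot> a3 \<odot> a4 = \<one>\<^bsub>aut_group E\<^esub>"
    by (simp add: G.m_assoc flip: assms(5))
  from U_234_trivial[OF U_mult[OF U_inv[OF assms(4)] assms(1)] assms(2,3) this]
  have "inv' b2 \<odot> a2 = \<one>\<^bsub>aut_group E\<^esub>" "a3 = \<one>\<^bsub>aut_group E\<^esub>" by auto
  then show ?thesis by (metis G.inv_cancel(2) G.r_one G.inv_closed assms(1,4) U_carrier)
qed

lemma decomposition_34_unique:
  assumes "a3 \<in> Ugrp E c 3" "a4 \<in> Ugrp E c 4" "b3 \<in> Ugrp E c 3" "b4 \<in> Ugrp E c 4" "a2 \<in> Ugrp E c 2"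
    and "a2 \<odot> a3 \<odot> a4 = a2 \<odot> b3 \<odot> b4"
  shows "a3 = b3"
proof -
  note [simp] = assms(1-5)[THEN U_carrier]
  have "a3 \<odot> a4 = b3 \<odot> b4" using assms(6) by (simp add: G.m_assoc)
  then have "inv' b3 \<odot> (a3 \<odot> a4) \<odot> inv' b4 = \<one>\<^bsub>aut_group E\<^esub>"
    by (simp add: G.m_assoc)
  then have "\<one>\<^bsub>aut_group E\<^esub> \<odot> (inv' b3 \<odot> a3) \<odot> (a4 \<odot> inv' b4) = \<one>\<^bsub>aut_group E\<^esub>"
    by (simp add: G.m_assoc)
  from U_234_trivial[OF _ U_mult[OF U_inv[OF assms(3)] assms(1)] U_mult[OF assms(2) U_inv[OF assms(4)]] this]
  have "inv' b3 \<odot> a3 = \<one>\<^bsub>aut_group E\<^esub>"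
    using subgroup.one_closed[OF U_subgroup] by blast
  then show ?thesis by (metis G.inv_cancel(2) G.r_one G.inv_closed assms(1,3) U_carrier)
qed

lemma x1_nontrivial: "w \<noteq> (0, 0) \<Longrightarrow> x1 w \<noteq> id"
  using x_inj(1) x_0(1) by (metis injD aut_group_simps(3))

section \<open>The reflection belonging to \<open>x1 (0, 1)\<close>\<close>

definition m0 where "m0 = mu E c (x1 (0, 1))"

lemma m0_reflection: "reflection m0"
  unfolding m0_def by (rule mu_exists[of "x1 (0, 1)"]) (simp_all add: x1_nontrivial)

lemma m0_carrier [simp]: "m0 \<in> carrier (aut_group E)"
  using m0_reflection by (simp add: reflection_def)

lemma m0_U:
  "a \<in> Ugrp E c 1 \<Longrightarrow> conj m0 a \<in> Ugrp E c 5" "a \<in> Ugrp E c 2 \<Longrightarrow> conj m0 a \<in> Ugrp E c 4"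
  "a \<in> Ugrp E c 3 \<Longrightarrow> conj m0 a \<in> Ugrp E c 3" "a \<in> Ugrp E c 4 \<Longrightarrow> conj m0 a \<in> Ugrp E c 2"
  using conj_U[OF m0_reflection, of a 1] conj_U[OF m0_reflection, of a 2]
    conj_U[OF m0_reflection, of a 3] conj_U[OF m0_reflection, of a 4] by simp_all

lemma m0_U_image:
  "Ugrp E c 5 = conj m0 ` range x1" "Ugrp E c 4 = conj m0 ` range x2"
  "Ugrp E c 3 = conj m0 ` range x3" "Ugrp E c 2 = conj m0 ` range x4"
  using conj_U_image[OF m0_reflection, of 1] conj_U_image[OF m0_reflection, of 2]
    conj_U_image[OF m0_reflection, of 3] conj_U_image[OF m0_reflection, of 4]
  by (simp_all add: U_eq_range)

text \<open>The given relations concern \<open>U_1\<close> to \<open>U_4\<close> only. Conjugation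
  by \<open>m0\<close> carries these groups to \<open>U_5\<close>, \<open>U_4\<close>,
  \<open>U_3\<close>, \<open>U_2\<close>, and so transports the action of \<open>U_1\<close> to one
  of \<open>U_5\<close>; the next two lemmas use this as well.\<close>

lemma U_5_conj_4: "z \<in> Ugrp E c 5 \<Longrightarrow> a \<in> Ugrp E c 4 \<Longrightarrow> conj z a = a"
proof -
  assume "z \<in> Ugrp E c 5" "a \<in> Ugrp E c 4"
  then obtain w v where z: "z = conj m0 (x1 w)" and a: "a = conj m0 (x2 v)"
    unfolding m0_U_image by blast
  have "conj (x1 w) (x2 v) = x2 v"
    using commute_12[of "x1 w" "x2 v"] by (simp add: G.conjugate_eq_iff_commute)
  then show ?thesis by (simp add: z a flip: G.conjugate_distrib)
qed

lemma U_5_conj_3: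
  assumes "z \<in> Ugrp E c 5" "a \<in> Ugrp E c 3"
  obtains b where "b \<in> Ugrp E c 4" "conj z a = b \<odot> a"
proof -
  obtain w v where z: "z = conj m0 (x1 w)" and a: "a = conj m0 (x3 v)"
    using assms unfolding m0_U_image by blast
  obtain r s where w: "w = (r, s)" by force
  obtain r' s' where v: "v = (r', s')" by force
  have "conj z a = conj m0 (x2 (h r r')) \<odot> a"
    by (simp add: z a w v conj_13 G.conjugate_mult flip: G.conjugate_distrib)
  then show ?thesis using that m0_U(2) x_in_U by blast
qed

lemma U_5_conj_2:
  assumes "z \<in> Ugrp E c 5" "a \<in> Ugrp E c 2"
  obtains b3 b4 where "b3 \<in> Ugrp E c 3" "b4 \<in> Ugrp E c 4" "conj z a = a \<odot> b3 \<odot> b4"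
proof -
  obtain w v where z: "z = conj m0 (x1 w)" and a: "a = conj m0 (x4 v)"
    using assms unfolding m0_U_image by blast
  obtain r s where w: "w = (r, s)" by force
  define p where "p = conj m0 (x2 (theta \<Omega> r v + s *l v))"
  define d where "d = conj m0 (x3 (r \<cdot> v, s * q v))"
  have p: "p \<in> Ugrp E c 4" and d: "d \<in> Ugrp E c 3"
    by (simp_all add: p_def d_def m0_U)
  note [simp] = p[THEN U_carrier] d[THEN U_carrier] assms(2)[THEN U_carrier]
  obtain p' where p': "p = x4 p'" using p by (auto simp: U_eq_range)
  obtain a' where a': "a = x2 a'" using assms(2) by (auto simp: U_eq_range)
  have "conj z a = p \<odot> d \<odot> a"
    by (simp add: z a w conj_14 G.conjugate_mult p_def d_def flip: G.conjugate_distrib)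
  also have "\<dots> = p \<odot> a \<odot> d"
    using commute_23[OF assms(2) d] by (simp add: G.m_assoc)
  also have "\<dots> = a \<odot> x3 (0, f a' p') \<odot> (p \<odot> d)"
    by (simp add: a' p' swap_42 G.m_assoc)
  also have "p \<odot> d = d \<odot> p" using commute_34[OF d p] by simp
  finally have "conj z a = a \<odot> (x3 (0, f a' p') \<odot> d) \<odot> p"
    by (simp add: G.m_assoc)
  then show ?thesis using that[OF U_mult[OF x_in_U(3) d] p] by blast
qed

text \<open>
  Since the reflection maps \<open>U\<^sub>4\<close> to \<open>U\<^sub>2\<close>, the conjugation by the third factor \<open>z\<close> has to cancel the
  \<open>U\<^sub>3\<close>-component of \<open>[x\<^sub>1(a,r), x\<^sub>4(v)\<^sup>-\<^sup>1]\<close>; this determines \<open>z\<close>.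
\<close>

lemma reflection_action:
  assumes y: "y \<in> Ugrp E c 5" and z: "z \<in> Ugrp E c 5" and n: "reflection (y \<odot> x1 (a, r) \<odot> z)"
  defines "\<Phi> \<equiv> \<lambda>v. theta \<Omega> a v + r *l v"
  shows "conj (y \<odot> x1 (a, r) \<odot> z) (x4 v) = x2 (\<Phi> v)"
    and "\<exists>b4\<in>Ugrp E c 4. conj z (x2 (\<Phi> v)) = x2 (\<Phi> v) \<odot> x3 (- (a \<cdot> v), - (r * q v)) \<odot> b4"
proof -
  obtain b3 b4 where b3: "b3 \<in> Ugrp E c 3" and b4: "b4 \<in> Ugrp E c 4"
    and b: "conj z (x2 (\<Phi> v)) = x2 (\<Phi> v) \<odot> b3 \<odot> b4"
    using U_5_conj_2[OF z x_in_U(2)] by blast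
  obtain d4 where d4: "d4 \<in> Ugrp E c 4"
    and d: "conj z (x3 (a \<cdot> v, r * q v)) = d4 \<odot> x3 (a \<cdot> v, r * q v)"
    using U_5_conj_3[OF z x_in_U(3)] by blast
  note [simp] = b3[THEN U_carrier] b4[THEN U_carrier] d4[THEN U_carrier] y[THEN U_carrier] z[THEN U_carrier]
  let ?x3 = "x3 (a \<cdot> v, r * q v)"
  have "conj (y \<odot> x1 (a, r) \<odot> z) (x4 v) = conj z (conj (x1 (a, r)) (conj y (x4 v)))"
    by (simp add: G.conjugate_conjugate)
  also have "\<dots> = conj z (x2 (\<Phi> v) \<odot> ?x3 \<odot> x4 v)"
    by (simp add: U_5_conj_4[OF y] conj_14 \<Phi>_def)
  also have "\<dots> = x2 (\<Phi> v) \<odot> b3 \<odot> (b4 \<odot> d4 \<odot> ?x3) \<odot> x4 v"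
    by (simp add: G.conjugate_mult U_5_conj_4[OF z] b d G.m_assoc)
  also have "b4 \<odot> d4 \<odot> ?x3 = ?x3 \<odot> (b4 \<odot> d4)"
    using commute_34[OF x_in_U(3) U_mult[OF b4 d4]] by simp
  finally have 1: "x2 (\<Phi> v) \<odot> (b3 \<odot> ?x3) \<odot> (b4 \<odot> d4 \<odot> x4 v) = conj (y \<odot> x1 (a, r) \<odot> z) (x4 v)"
    by (simp add: G.m_assoc)
  have "conj (y \<odot> x1 (a, r) \<odot> z) (x4 v) \<in> Ugrp E c 2"
    using conj_U[OF n, of "x4 v" 4] by simp
  from decomposition_unique[OF x_in_U(2) U_mult[OF b3 x_in_U(3)]
    U_mult[OF U_mult[OF b4 d4] x_in_U(4)] this 1]
  have 2: "conj (y \<odot> x1 (a, r) \<odot> z) (x4 v) = x2 (\<Phi> v)" "b3 \<odot> ?x3 = \<one>\<^bsub>aut_group E\<^esub>"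
    by blast+
  show "conj (y \<odot> x1 (a, r) \<odot> z) (x4 v) = x2 (\<Phi> v)" by (fact 2)
  have "b3 = inv' ?x3" using 2(2) by (simp add: G.inv_equality)
  then show "\<exists>b4\<in>Ugrp E c 4. conj z (x2 (\<Phi> v)) = x2 (\<Phi> v) \<odot> x3 (- (a \<cdot> v), - (r * q v)) \<odot> b4"
    using b b4 by (auto simp: x_inv)
qed

lemma m0_decomposition:
  obtains y z where "y \<in> Ugrp E c 5" "z \<in> Ugrp E c 5" "m0 = y \<odot> x1 (0, 1) \<odot> z"
  unfolding m0_def by (rule mu_exists[of "x1 (0, 1)"]) (simp_all add: x1_nontrivial)

lemma theta_0 [simp]: "theta \<Omega> 0 v = 0"
  by (simp add: C)

lemma inv_decomposition:
  assumes "y \<in> carrier (aut_group E)" "z \<in> carrier (aut_group E)"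
  shows "inv' (y \<odot> x1 (a, r) \<odot> z) = inv' z \<odot> x1 (- a, - r) \<odot> inv' y"
  using assms by (simp add: G.inv_mult_group G.m_assoc x_inv)

lemma m0_x4: "conj m0 (x4 v) = x2 v"
proof -
  obtain y z where "y \<in> Ugrp E c 5" "z \<in> Ugrp E c 5" "m0 = y \<odot> x1 (0, 1) \<odot> z"
    by (rule m0_decomposition)
  then show ?thesis
    using reflection_action(1)[of y z 0 1 v] m0_reflection by simp
qed

text \<open>The inverse of \<open>m0\<close> is again a reflection of the form covered by
  \<open>reflection_action\<close>, with middle factor \<open>x1 (0, - 1)\<close>; this is the
  source of the sign.\<close>

lemma m0_x2: "conj m0 (x2 v) = x4 (- v)"
proof -
  obtain y z where y: "y \<in> Ugrp E c 5" and z: "z \<in> Ugrp E c 5" and m: "m0 = y \<odot> x1 (0, 1) \<odot> z"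
    by (rule m0_decomposition)
  have i: "inv' m0 = inv' z \<odot> x1 (0, - 1) \<odot> inv' y"
    using inv_decomposition[OF U_carrier[OF y] U_carrier[OF z], of 0 1] by (simp add: m)
  have "conj (inv' m0) (x4 (- v)) = x2 v"
    using reflection_action(1)[OF U_inv[OF z] U_inv[OF y], of 0 "- 1" "- v"]
      reflection_inv[OF m0_reflection] by (simp add: i)
  then show ?thesis by (simp add: G.conjugate_inv_eq)
qed

text \<open>Conjugating \<open>swap_42\<close> by \<open>m0\<close> exchanges the roles of
  \<open>x2\<close> and \<open>x4\<close>, and comparison with \<open>swap_42\<close> itself settles
  the elements \<open>x3 (0, f u v)\<close>. Multiples of \<open>\<epsilon>\<close> show that
  \<open>f\<close> takes every value.\<close>

lemma m0_x3_center: "conj m0 (x3 (0, s)) = x3 (0, s)"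
proof -
  have *: "conj m0 (x3 (0, f u v)) = x3 (0, f v u)" for u v
  proof -
    have "conj m0 (x4 v \<odot> x2 u) = conj m0 (x2 u \<odot> x3 (0, f u v) \<odot> x4 v)"
      by (simp add: swap_42)
    then have "x2 v \<odot> x4 (- u) = x4 (- u) \<odot> conj m0 (x3 (0, f u v)) \<odot> x2 v"
      by (simp add: G.conjugate_mult m0_x4 m0_x2)
    also have "\<dots> = x4 (- u) \<odot> x2 v \<odot> conj m0 (x3 (0, f u v))"
      using commute_23[OF x_in_U(2) m0_U(3)[OF x_in_U(3)], of v "(0, f u v)"]
      by (simp add: G.m_assoc)
    also have "\<dots> = x2 v \<odot> x3 (0, - f v u) \<odot> x4 (- u) \<odot> conj m0 (x3 (0, f u v))"
      by (simp add: swap_42)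
    also have "\<dots> = x2 v \<odot> x3 (0, - f v u) \<odot> conj m0 (x3 (0, f u v)) \<odot> x4 (- u)"
      using commute_34[OF m0_U(3)[OF x_in_U(3)] x_in_U(4), of "(0, f u v)" "- u"]
      by (simp add: G.m_assoc)
    finally have "x4 (- u) = x3 (0, - f v u) \<odot> conj m0 (x3 (0, f u v)) \<odot> x4 (- u)"
      by (simp add: G.m_assoc)
    then have "x3 (0, - f v u) \<odot> conj m0 (x3 (0, f u v)) = \<one>\<^bsub>aut_group E\<^esub>"
      by (metis G.m_closed G.r_cancel_one' G.conjugate_closed m0_carrier x_in_carrier(3,4))
    then have "inv' (x3 (0, - f v u)) = conj m0 (x3 (0, f u v))"
      by (metis G.inv_equality G.inv_inv G.inv_closed G.conjugate_closed m0_carrier x_in_carrier(3))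
    then show ?thesis by (simp add: x_inv)
  qed
  have "f ((s / 2) *l \<epsilon>) \<epsilon> = s" "f \<epsilon> ((s / 2) *l \<epsilon>) = s" by simp_all
  then show ?thesis using *[of "(s / 2) *l \<epsilon>" \<epsilon>] by simp
qed

abbreviation "x5 \<equiv> x5_param E c x1"

lemma x5_eq: "x5 w = conj m0 (x1 w)"
  by (simp add: x5_param_def m0_def)

lemma x5_carrier [simp]: "x5 w \<in> carrier (aut_group E)"
  by (simp add: x5_eq)

lemma x5_inv: "inv' (x5 (a, r)) = x5 (- a, - r)"
proof -
  have "conj m0 (x1 (- a, - r) \<odot> x1 (a, r)) = \<one>\<^bsub>aut_group E\<^esub>"
    by (simp add: x_mult conjugate_def)
  then show ?thesis
    by (intro G.inv_equality) (simp_all add: x5_eq G.conjugate_mult)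
qed

lemma U_5_eq: "Ugrp E c 5 = range x5"
  unfolding m0_U_image by (auto simp: x5_eq)

lemma f_theta: "f v (theta \<Omega> b v + r *l v) = 2 * (r * q v)"
proof -
  have "f (theta \<Omega> b v) v = (1 / 2) * f (h b (b \<cdot> v)) v" by (simp add: C)
  also have "f (h b (b \<cdot> v)) v = f (h (b \<cdot> v) (b \<cdot> v)) \<epsilon>" by (simp add: B3)
  finally have "f (theta \<Omega> b v) v = 0" by (simp add: f_h_base)
  then show ?thesis by (simp add: f_self f_sym[of v "theta \<Omega> b v"])
qed

text \<open>This is \<open>conj_14\<close> transported by \<open>m0\<close>. Moving the
  \<open>U_4\<close>-factor to the right past \<open>x2 v\<close> produces the element of
  \<open>U_3\<close> with coordinate \<open>- (2 * (r * q v))\<close>, since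
  \<open>theta \<Omega> b v\<close> is orthogonal to \<open>v\<close>.\<close>

lemma x5_conj_x2:
  obtains b4 where "b4 \<in> Ugrp E c 4"
    "conj (x5 (b, r)) (x2 v) =
       x2 v \<odot> (x3 (0, - (2 * (r * q v))) \<odot> conj m0 (x3 (b \<cdot> v, r * q v))) \<odot> b4"
proof
  let ?\<Phi> = "theta \<Omega> b v + r *l v" and ?d = "conj m0 (x3 (b \<cdot> v, r * q v))"
  have d: "?d \<in> Ugrp E c 3" by (simp add: m0_U)
  have "conj (x5 (b, r)) (conj m0 (x4 v)) = conj m0 (conj (x1 (b, r)) (x4 v))"
    unfolding x5_eq by (rule G.conjugate_distrib[symmetric]) simp_all
  then have "conj (x5 (b, r)) (x2 v) = x4 (- ?\<Phi>) \<odot> ?d \<odot> x2 v"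
    by (simp add: conj_14 G.conjugate_mult m0_x4 m0_x2)
  also have "\<dots> = x4 (- ?\<Phi>) \<odot> x2 v \<odot> ?d"
    using commute_23[OF x_in_U(2) d, of v] by (simp add: G.m_assoc)
  also have "\<dots> = x2 v \<odot> x3 (0, - (2 * (r * q v))) \<odot> (x4 (- ?\<Phi>) \<odot> ?d)"
    unfolding swap_42 f_diff(5) f_theta by (simp add: G.m_assoc)
  also have "x4 (- ?\<Phi>) \<odot> ?d = ?d \<odot> x4 (- ?\<Phi>)"
    using commute_34[OF d x_in_U(4)] by simp
  finally show "conj (x5 (b, r)) (x2 v) =
       x2 v \<odot> (x3 (0, - (2 * (r * q v))) \<odot> ?d) \<odot> x4 (- ?\<Phi>)"
    by (simp add: G.m_assoc)
qed simp

lemma x5_coordinates: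
  assumes b4: "b4 \<in> Ugrp E c 4" and x: "conj (x5 (b, r)) (x2 v) = x2 v \<odot> x3 w \<odot> b4"
  shows "conj m0 (x3 (b \<cdot> v, r * q v)) = x3 (0, 2 * (r * q v)) \<odot> x3 w"
proof -
  let ?d = "conj m0 (x3 (b \<cdot> v, r * q v))"
  obtain b4' where b4': "b4' \<in> Ugrp E c 4"
    and x': "conj (x5 (b, r)) (x2 v) = x2 v \<odot> (x3 (0, - (2 * (r * q v))) \<odot> ?d) \<odot> b4'"
    by (rule x5_conj_x2)
  have "x3 w = x3 (0, - (2 * (r * q v))) \<odot> ?d"
    by (rule decomposition_34_unique[OF x_in_U(3) b4 U_mult[OF x_in_U(3) m0_U(3)[OF x_in_U(3)]] b4'
        x_in_U(2) trans[OF x[symmetric] x']])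
  then have "x3 (0, 2 * (r * q v)) \<odot> x3 w = x3 (0, 2 * (r * q v)) \<odot> x3 (0, - (2 * (r * q v))) \<odot> ?d"
    by (simp add: G.m_assoc)
  then show ?thesis by (simp add: x_mult gform_def)
qed

text \<open>By \<open>x5_coordinates\<close> at \<open>\<epsilon>\<close>, \<open>m0\<close> maps
  \<open>x3 (b, r)\<close> to \<open>x3 (0, 2 * r - \<delta>)\<close>. The latter is its own image
  by \<open>m0_x3_center\<close>, so \<open>b = 0\<close> and
  \<open>r = 2 * r - \<delta>\<close>.\<close>

lemma m0_factor:
  assumes "z = x5 (b, r)" "\<delta> = 1 \<or> \<delta> = - 1" "b4 \<in> Ugrp E c 4"
    and "conj z (x2 \<epsilon>) = x2 \<epsilon> \<odot> x3 (0, - \<delta>) \<odot> b4"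
  shows "z = x5 (0, \<delta>)"
proof -
  have "conj m0 (x3 (b, r)) = x3 (0, 2 * r) \<odot> x3 (0, - \<delta>)"
    using x5_coordinates[OF assms(3), of b r \<epsilon> "(0, - \<delta>)"] assms(1,4) by (simp add: A2 q_base)
  also have "\<dots> = conj m0 (x3 (0, 2 * r - \<delta>))"
    by (simp add: x_mult m0_x3_center gform_def)
  finally have "(b, r) = (0, 2 * r - \<delta>)"
    using x_inj(3) by (simp add: G.conjugate_cancel inj_eq)
  then show ?thesis using assms(1) by simp
qed

lemma m0_eq: "m0 = x5 (0, 1) \<odot> x1 (0, 1) \<odot> x5 (0, 1)"
proof -
  obtain y z where y: "y \<in> Ugrp E c 5" and z: "z \<in> Ugrp E c 5" and m: "m0 = y \<odot> x1 (0, 1) \<odot> z"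
    by (rule m0_decomposition)
  have i: "inv' m0 = inv' z \<odot> x1 (0, - 1) \<odot> inv' y"
    using inv_decomposition[OF U_carrier[OF y] U_carrier[OF z], of 0 1] by (simp add: m)
  obtain b r where zx: "z = x5 (b, r)" using z by (auto simp: U_5_eq)
  obtain b4 where "b4 \<in> Ugrp E c 4" "conj z (x2 \<epsilon>) = x2 \<epsilon> \<odot> x3 (0, - 1) \<odot> b4"
    using reflection_action(2)[OF y z, of 0 1 \<epsilon>] m0_reflection by (auto simp: m q_base)
  then have z5: "z = x5 (0, 1)" using m0_factor[OF zx, of 1] by simp
  obtain b' r' where yx: "inv' y = x5 (b', r')" using U_inv[OF y] by (auto simp: U_5_eq)
  \<comment> \<open>The first factor of \<open>m0\<close> is, up to inversion, the third factor of
    its inverse. There \<open>- \<epsilon>\<close> is used because the scalar is -1, so that the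
    \<open>U_2\<close>-component is again \<open>x2 \<epsilon>\<close>.\<close>
  obtain b4' where "b4' \<in> Ugrp E c 4" "conj (inv' y) (x2 \<epsilon>) = x2 \<epsilon> \<odot> x3 (0, 1) \<odot> b4'"
  proof -
    have "q (- \<epsilon>) = 1" using q_scale[of "- 1" \<epsilon>] by (simp add: q_base)
    then show ?thesis
      using that reflection_action(2)[OF U_inv[OF z] U_inv[OF y], of 0 "- 1" "- \<epsilon>"]
        reflection_inv[OF m0_reflection] by (auto simp: i)
  qed
  then have "inv' y = x5 (0, - 1)" using m0_factor[OF yx, of "- 1"] by simp
  then have "y = x5 (0, 1)"
    using G.inv_inv[OF U_carrier[OF y]] by (simp add: x5_inv)
  with m z5 show ?thesis by simp
qed

text \<open>All three factors in \<open>m0_eq\<close> centralize \<open>U_3\<close>: for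
  \<open>x1 (0, 1)\<close> this is \<open>conj_13\<close> with \<open>h\<close> vanishing at 0, and
  for \<open>x5 (0, 1)\<close> it follows by conjugation with \<open>m0\<close>.\<close>

lemma m0_x3: "conj m0 (x3 w) = x3 w"
proof -
  have 1: "conj (x1 (0, 1)) (x3 w) = x3 w" for w
    by (cases w) (simp add: conj_13)
  have 5: "conj (x5 (0, 1)) (x3 w) = x3 w" for w
  proof -
    have "x3 w \<in> conj m0 ` range x3" using m0_U_image(3) x_in_U(3)[of w] by simp
    then obtain w' where "x3 w = conj m0 (x3 w')" by blast
    then show ?thesis by (simp add: x5_eq 1 flip: G.conjugate_distrib)
  qed
  have "conj m0 (x3 w) = conj (x5 (0, 1)) (conj (x1 (0, 1)) (conj (x5 (0, 1)) (x3 w)))"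
    by (subst m0_eq) (simp add: G.conjugate_conjugate)
  then show ?thesis by (simp add: 1 5)
qed

section \<open>The mu-maps of the elements \<open>x1 (u, 0)\<close>\<close>

lemma act_quad_inverse: "u \<noteq> 0 \<Longrightarrow> quad_inverse \<Omega> u \<cdot> \<pi> u = - u"
  by (simp add: quad_inverse_def act_pi_pi pi_nonzero)

lemma factor_eq_quad_inverse:
  assumes "u \<noteq> 0" "b \<cdot> \<pi> u = - u" shows "b = quad_inverse \<Omega> u"
proof -
  have "(b - quad_inverse \<Omega> u) \<cdot> \<pi> u = 0"
    using assms by (simp add: act_quad_inverse)
  then show ?thesis using pi_nonzero[OF assms(1)] by (simp only: act_eq_0_iff) simp
qed

text \<open>As \<open>m0\<close> acts trivially on \<open>U_3\<close>, \<open>x5_coordinates\<close>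
  at \<open>\<pi> u\<close> reads off both coordinates of \<open>z\<close>: the first satisfies
  \<open>b \<cdot> \<pi> u = - u\<close>, the second equals its double and is 0.\<close>

lemma mu_factor:
  assumes u: "u \<noteq> 0" and z: "z \<in> Ugrp E c 5" and b4: "b4 \<in> Ugrp E c 4"
    and x: "conj z (x2 (\<pi> u)) = x2 (\<pi> u) \<odot> x3 (- u, 0) \<odot> b4"
  shows "z = x5 (quad_inverse \<Omega> u, 0)"
proof -
  obtain b r where zx: "z = x5 (b, r)" using z by (auto simp: U_5_eq)
  have "x3 (b \<cdot> \<pi> u, r * q (\<pi> u)) = x3 (0, 2 * (r * q (\<pi> u))) \<odot> x3 (- u, 0)"
    using x5_coordinates[OF b4, of b r "\<pi> u"] x unfolding zx m0_x3 by blast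
  then have "(b \<cdot> \<pi> u, r * q (\<pi> u)) = (- u, 2 * (r * q (\<pi> u)))"
    using x_inj(3) by (simp add: x_mult gform_def inj_eq)
  then have b: "b \<cdot> \<pi> u = - u" and r: "r * q (\<pi> u) = 2 * (r * q (\<pi> u))"
    by blast+
  from r have "r * q (\<pi> u) = 0" by algebra
  then have "r = 0" using pi_nonzero[OF u] by simp
  with b show ?thesis using factor_eq_quad_inverse[OF u] zx by simp
qed

text \<open>\<open>reflection_action\<close> at \<open>\<epsilon>\<close>, where
  \<open>\<Phi>\<close> takes the value \<open>\<pi> u\<close>, determines \<open>z\<close>. The
  inverse reflection has middle factor \<open>x1 (- u, 0)\<close> and the same
  \<open>\<pi> u\<close>, which determines the inverse of \<open>y\<close>.\<close>

theorem mu_formula: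
  assumes u: "u \<noteq> 0"
  shows "mu E c (x1 (u, 0)) =
    x5 (quad_inverse \<Omega> u, 0) \<odot> x1 (u, 0) \<odot> x5 (quad_inverse \<Omega> u, 0)"
proof -
  obtain y z where y: "y \<in> Ugrp E c 5" and z: "z \<in> Ugrp E c 5"
    and m: "mu E c (x1 (u, 0)) = y \<odot> x1 (u, 0) \<odot> z" and refl: "reflection (y \<odot> x1 (u, 0) \<odot> z)"
    using mu_exists[of "x1 (u, 0)"] x1_nontrivial[of "(u, 0)"] u by (metis Pair_inject x_in_U(1))
  have i: "inv' (y \<odot> x1 (u, 0) \<odot> z) = inv' z \<odot> x1 (- u, 0) \<odot> inv' y"
    using inv_decomposition[OF U_carrier[OF y] U_carrier[OF z], of u 0] by simp
  have pi: "theta \<Omega> u \<epsilon> = \<pi> u" "theta \<Omega> (- u) \<epsilon> = \<pi> u" "\<pi> (- u) = \<pi> u"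
    by (simp_all add: pi_map_def C)
  obtain b4 where "b4 \<in> Ugrp E c 4" "conj z (x2 (\<pi> u)) = x2 (\<pi> u) \<odot> x3 (- u, 0) \<odot> b4"
    using reflection_action(2)[OF y z refl, of \<epsilon>] by (auto simp: pi A2)
  then have z5: "z = x5 (quad_inverse \<Omega> u, 0)" by (rule mu_factor[OF u z])
  obtain b4' where "b4' \<in> Ugrp E c 4" "conj (inv' y) (x2 (\<pi> u)) = x2 (\<pi> u) \<odot> x3 (u, 0) \<odot> b4'"
    using reflection_action(2)[OF U_inv[OF z] U_inv[OF y], of "- u" 0 \<epsilon>] reflection_inv[OF refl]
    by (auto simp: i pi A2)
  then have "inv' y = x5 (quad_inverse \<Omega> (- u), 0)"
    using mu_factor[OF _ U_inv[OF y], of "- u"] u by (simp add: pi)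
  moreover have "quad_inverse \<Omega> (- u) = - quad_inverse \<Omega> u"
    by (simp add: quad_inverse_def pi)
  ultimately have "y = x5 (quad_inverse \<Omega> u, 0)"
    using G.inv_inv[OF U_carrier[OF y]] by (simp add: x5_inv)
  with m z5 show ?thesis by simp
qed

end

section \<open>Assembly: the algebra of one base point and the mu-maps\<close>

theorem theorem5p1:
  fixes \<Omega> :: "('k::field, 'l::ab_group_add, 'x::ab_group_add) quad_data"
  assumes "quadrangular_algebra \<Omega>"
    and "CHAR('k) \<noteq> 2" and "CHAR('k) \<noteq> 3"
  shows "\<exists>F :: 'x inv_alg set. F \<noteq> {} \<and>
    (\<forall>A\<in>F. structurable_algebra (scaleX \<Omega>) A) \<and>
    (\<forall>A\<in>F. \<forall>B\<in>F. isotopic (scaleX \<Omega>) A (scaleX \<Omega>) B) \<and>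
    (\<forall>A\<in>F.
       skew_dimension (scaleX \<Omega>) A = 1 \<and>
       conj_division_algebra A \<and>
       (\<exists>s0\<in>skew_elements A.
          (\<forall>x. Uop A x (amul A s0 x) = scaleX \<Omega> 3 (act \<Omega> x (pi_map \<Omega> x))) \<and>
          (\<exists>k. \<forall>x. conj_norm (scaleX \<Omega>) A x = k * qform \<Omega> (pi_map \<Omega> x)) \<and>
          (\<forall>u. u \<noteq> 0 \<longrightarrow>
             (\<forall>(E :: 'v \<Rightarrow> 'v \<Rightarrow> bool) c x1 x2 x3 x4.
                quadrangle_of \<Omega> E c x1 x2 x3 x4 \<longrightarrow>
                mu E c (x1 (u, 0)) =
                  x5_param E c x1 (quad_inverse \<Omega> u, 0) \<otimes>\<^bsub>aut_group E\<^esub> x1 (u, 0)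
                  \<otimes>\<^bsub>aut_group E\<^esub> x5_param E c x1 (quad_inverse \<Omega> u, 0)) \<and>
             is_conj_inverse A u (amul A s0 (quad_inverse \<Omega> u)))))"
proof -
  interpret quadrangular_algebra \<Omega> by (rule assms(1))
  obtain e :: 'x where "e \<noteq> 0" using X_nonzero by blast
  have "(3::'k) \<noteq> 0"
  proof
    assume "(3::'k) = 0"
    then have "CHAR('k) dvd 3" by (metis of_nat_eq_0_iff_char_dvd of_nat_numeral)
    moreover from this have "CHAR('k) \<le> 3" by (rule dvd_imp_le) simp
    then have "CHAR('k) = 0 \<or> CHAR('k) = 1 \<or> CHAR('k) = 2 \<or> CHAR('k) = 3" by linarith
    ultimately have "CHAR('k) = 1 \<or> CHAR('k) = 3" by (elim disjE) simp_all
    then show False using assms(3) CHAR_not_1[where 'a = 'k] by auto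
  qed
  then interpret P: pointed_freudenthal_triple_system "scaleX \<Omega>" g triple_product e
    using \<open>e \<noteq> 0\<close> by (rule pointed_freudenthal_triple_system)
  have s: "P.s \<in> skew_elements P.A"
    by (simp add: skew_elements_def)
  have U: "Uop P.A x (amul P.A P.s x) = scaleX \<Omega> 3 (act \<Omega> x (pi_map \<Omega> x))" for x
  proof -
    have "Uop P.A x (amul P.A P.s x) = P.T x x x"
      by (simp add: Uop_def P.Vop_A)
    also have "\<dots> = scaleX \<Omega> (1 / 2 * (2 * 3)) (act \<Omega> x (pi_map \<Omega> x))"
      by (simp add: P.T_def P.D_def triple_product_diagonal)
    finally show ?thesis by (simp del: numeral_times_numeral)
  qed
  \<comment> \<open>The scalar is -12 from \<open>g x (triple_product x x x)\<close> over the
    \<open>12 * P.\<mu>\<close> of \<open>conj_norm_A\<close>.\<close>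
  have norm: "conj_norm (scaleX \<Omega>) P.A x = (- 1 / P.\<mu>) * qform \<Omega> (pi_map \<Omega> x)" for x
    by (simp add: P.conj_norm_A triple_product_diagonal g_skew[of x "x \<cdot> \<pi> x"] g_act_pi)
  have inverse: "is_conj_inverse P.A u (amul P.A P.s (quad_inverse \<Omega> u))" if "u \<noteq> 0" for u
  proof -
    have g: "g u (triple_product u u u) = - 12 * q (\<pi> u)"
      by (simp add: triple_product_diagonal g_skew[of u "u \<cdot> \<pi> u"] g_act_pi)
    have "is_conj_inverse P.A u (P.J (scaleX \<Omega> (- 2 / g u (triple_product u u u)) (triple_product u u u)))"
      by (rule P.is_conj_inverse_A) (simp add: g pi_nonzero that)
    also have "scaleX \<Omega> (- 2 / g u (triple_product u u u)) (triple_product u u u) = quad_inverse \<Omega> u"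
    proof -
      \<comment> \<open>The 6 comes from \<open>triple_product_diagonal\<close>; left multiplication
        by \<open>P.s\<close> is \<open>P.J\<close>, so the inverse found in the triple system is
        the required one.\<close>
      have "- 2 / (- 12 * q (\<pi> u)) * 6 = 1 / q (\<pi> u)"
        by (simp add: divide_eq_eq pi_nonzero that)
      then show ?thesis
        unfolding g unfolding triple_product_diagonal quad_inverse_def P.scale_scale by (simp only:)
    qed
    finally show ?thesis by simp
  qed
  have mu: "mu E c (x1 (u, 0)) =
      x5_param E c x1 (quad_inverse \<Omega> u, 0) \<otimes>\<^bsub>aut_group E\<^esub> x1 (u, 0)
      \<otimes>\<^bsub>aut_group E\<^esub> x5_param E c x1 (quad_inverse \<Omega> u, 0)"
    if "u \<noteq> 0" "quadrangle_of \<Omega> E c x1 x2 x3 x4"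
    for u x1 x2 x3 x4 and E :: "'v \<Rightarrow> 'v \<Rightarrow> bool" and c
    using quadrangle_of.mu_formula[OF that(2,1)] .
  have isotopic: "isotopic (scaleX \<Omega>) P.A (scaleX \<Omega>) P.A"
    unfolding isotopic_def by (rule exI[of _ id])+ (simp add: P.linear_id)
  show ?thesis
  proof (intro exI[of _ "{P.A}"] conjI ballI; (elim singletonE; hypsubst)?)
    show "\<exists>s0\<in>skew_elements P.A.
          (\<forall>x. Uop P.A x (amul P.A s0 x) = scaleX \<Omega> 3 (act \<Omega> x (pi_map \<Omega> x))) \<and>
          (\<exists>k. \<forall>x. conj_norm (scaleX \<Omega>) P.A x = k * qform \<Omega> (pi_map \<Omega> x)) \<and>
          (\<forall>u. u \<noteq> 0 \<longrightarrow>
             (\<forall>(E :: 'v \<Rightarrow> 'v \<Rightarrow> bool) c x1 x2 x3 x4.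
                quadrangle_of \<Omega> E c x1 x2 x3 x4 \<longrightarrow>
                mu E c (x1 (u, 0)) =
                  x5_param E c x1 (quad_inverse \<Omega> u, 0) \<otimes>\<^bsub>aut_group E\<^esub> x1 (u, 0)
                  \<otimes>\<^bsub>aut_group E\<^esub> x5_param E c x1 (quad_inverse \<Omega> u, 0)) \<and>
             is_conj_inverse P.A u (amul P.A s0 (quad_inverse \<Omega> u)))"
      using s U norm mu inverse by blast
    show "conj_division_algebra P.A"
      unfolding conj_division_algebra_def using inverse by blast
  qed (use P.structurable_algebra_A P.skew_dimension_A isotopic in simp_all)
qed

end
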